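(* For any constant $\alpha_0<1$, there exists a constant $\varepsilon_0>0$ such that any two-sided, non-adaptive relative-error testing algorithm for deciding whether a function $f:\{0,1\}^n\to\{0,1\}$ with $|f^{-1}(1)|=\Theta(N)$, for some given parameter $N\le 2^{\alpha_0 n}$, is unate or has $\mathrm{reldist}(f,\mathsf{Unate})\ge\varepsilon_0$, must make $\tilde{\Omega}(\log N)$ queries.
   Context: Relative-error testing model: the algorithm has access to the membership oracle $\mathrm{MQ}(f)$ (returns $f(x)$ on query $x$) and the sampling oracle $\mathrm{SAMP}(f)$ (each call returns an independent uniformly random element of $f^{-1}(1)$); the number of queries is the total number of calls to both oracles. A two-sided tester must accept with probability at least $2/3$ if $f$ is unate and reject with probability at least $2/3$ if $\mathrm{reldist}(f,\mathsf{Unate})\ge\varepsilon_0$. It is non-adaptive if, after receiving the results of all its calls to $\mathrm{SAMP}(f)$, it makes a single parallel round of queries to $\mathrm{MQ}(f)$ (these queries may depend on the samples but not on answers of other $\mathrm{MQ}$ queries). $f$ is unate if for every $i\in[n]$, $f$ is either monotone non-decreasing or monotone non-increasing in the $i$-th variable; $\mathsf{Unate}$ is the class of unate functions. $\mathrm{reldist}(f,g)=|f^{-1}(1)\triangle g^{-1}(1)|/|f^{-1}(1)|$, $\mathrm{reldist}(f,\mathsf{Unate})=\min_{g\in\mathsf{Unate}}\mathrm{reldist}(f,g)$. $N$ (up to a constant factor) is given to the algorithm. $\tilde{\Omega}$ hides polylogarithmic factors. *)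

theory Defs
  imports "HOL-Probability.Probability"
begin

section \<open>Boolean functions, unateness and relative distance\<close>

definition cube :: "nat \<Rightarrow> bool list set" where
  "cube n = {x. length x = n}"

text \<open>Functions on the cube are extensional (set to \<open>undefined\<close> off the cube), so that each
  Boolean function has exactly one representative, and querying a list of the wrong
  length reveals nothing about it.\<close>

definition bool_funs :: "nat \<Rightarrow> (bool list \<Rightarrow> bool) set" where
  "bool_funs n = cube n \<rightarrow>\<^sub>E UNIV"

definition ones :: "nat \<Rightarrow> (bool list \<Rightarrow> bool) \<Rightarrow> bool list set" where
  "ones n f = {x \<in> cube n. f x}"

definition nondecreasing_in :: "nat \<Rightarrow> nat \<Rightarrow> (bool list \<Rightarrow> bool) \<Rightarrow> bool" where
  "nondecreasing_in n i f \<longleftrightarrow> (\<forall>x \<in> cube n. f (x[i := False]) \<le> f (x[i := True]))"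

definition nonincreasing_in :: "nat \<Rightarrow> nat \<Rightarrow> (bool list \<Rightarrow> bool) \<Rightarrow> bool" where
  "nonincreasing_in n i f \<longleftrightarrow> (\<forall>x \<in> cube n. f (x[i := True]) \<le> f (x[i := False]))"

definition Unate :: "nat \<Rightarrow> (bool list \<Rightarrow> bool) set" where
  "Unate n = {f \<in> bool_funs n. \<forall>i<n. nondecreasing_in n i f \<or> nonincreasing_in n i f}"

definition reldist :: "nat \<Rightarrow> (bool list \<Rightarrow> bool) \<Rightarrow> (bool list \<Rightarrow> bool) \<Rightarrow> real" where
  "reldist n f g =
     real (card ((ones n f - ones n g) \<union> (ones n g - ones n f))) / real (card (ones n f))"

definition reldist_Unate :: "nat \<Rightarrow> (bool list \<Rightarrow> bool) \<Rightarrow> real" where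
  "reldist_Unate n f = Min (reldist n f ` Unate n)"

text \<open>The minimum is over a finite nonempty set, so \<^const>\<open>Min\<close> has its intended meaning.\<close>

lemma finite_cube: "finite (cube n)"
  using finite_lists_length_eq[of "UNIV :: bool set" n] by (simp add: cube_def)

lemma finite_Unate: "finite (Unate n)"
proof -
  have "finite (bool_funs n)"
    unfolding bool_funs_def by (intro finite_PiE finite_cube) simp
  then show ?thesis
    by (rule rev_finite_subset) (auto simp: Unate_def)
qed

lemma Unate_nonempty: "Unate n \<noteq> {}"
proof -
  have "restrict (\<lambda>_. False) (cube n) \<in> Unate n"
    by (auto simp: Unate_def bool_funs_def nondecreasing_in_def cube_def)
  then show ?thesis by blast
qed

section \<open>Non-adaptive relative-error testers\<close>

text \<open>A deterministic algorithm first makes calls to the sampling oracle, continuing according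
  to the samples received (and possibly choosing in this way how many to request), and then
  makes one parallel round of membership queries: \<open>Query xs d\<close> asks for the values of \<open>f\<close> on
  all of \<open>xs\<close> at once and applies \<open>d\<close> to the list of answers to decide whether to accept.
  A randomized algorithm is a probability distribution over deterministic ones.\<close>

datatype strategy =
    Sample "bool list \<Rightarrow> strategy"
  | Query "bool list list" "bool list \<Rightarrow> bool"

type_synonym nonadaptive_algorithm = "strategy pmf"

text \<open>The joint distribution of the verdict (\<^term>\<open>True\<close> for accept) and the total number of
  calls to both oracles. Each sample is drawn independently and uniformly from the satisfying
  assignments.\<close>

primrec run_strategy ::
    "nat \<Rightarrow> (bool list \<Rightarrow> bool) \<Rightarrow> strategy \<Rightarrow> (bool \<times> nat) pmf" where
  "run_strategy n f (Sample k) =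
     bind_pmf (pmf_of_set (ones n f))
       (\<lambda>x. map_pmf (\<lambda>(b, t). (b, Suc t)) (run_strategy n f (k x)))"
| "run_strategy n f (Query xs d) = return_pmf (d (map f xs), length xs)"

definition run ::
    "nat \<Rightarrow> (bool list \<Rightarrow> bool) \<Rightarrow> nonadaptive_algorithm \<Rightarrow> (bool \<times> nat) pmf" where
  "run n f A = bind_pmf A (run_strategy n f)"

definition accept_prob :: "nat \<Rightarrow> (bool list \<Rightarrow> bool) \<Rightarrow> nonadaptive_algorithm \<Rightarrow> real" where
  "accept_prob n f A = measure_pmf.prob (run n f A) {(b, t). b}"

definition reject_prob :: "nat \<Rightarrow> (bool list \<Rightarrow> bool) \<Rightarrow> nonadaptive_algorithm \<Rightarrow> real" where
  "reject_prob n f A = measure_pmf.prob (run n f A) {(b, t). \<not> b}"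

text \<open>The admissible inputs: the number of satisfying assignments is \<open>N\<close> up to the constant
  factor \<open>C\<close>.\<close>

definition inputs :: "real \<Rightarrow> nat \<Rightarrow> nat \<Rightarrow> (bool list \<Rightarrow> bool) set" where
  "inputs C n N = {f \<in> bool_funs n.
     real N / C \<le> real (card (ones n f)) \<and> real (card (ones n f)) \<le> C * real N}"

text \<open>The algorithm \<open>A\<close> may depend on \<open>n\<close>, \<open>N\<close>, \<open>C\<close> and \<open>\<epsilon>\<close>.\<close>

definition unateness_tester ::
    "real \<Rightarrow> real \<Rightarrow> nat \<Rightarrow> nat \<Rightarrow> nonadaptive_algorithm \<Rightarrow> bool" where
  "unateness_tester C \<epsilon> n N A \<longleftrightarrow> (\<forall>f \<in> inputs C n N.
     (f \<in> Unate n \<longrightarrow> accept_prob n f A \<ge> 2/3) \<and>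
     (reldist_Unate n f \<ge> \<epsilon> \<longrightarrow> reject_prob n f A \<ge> 2/3))"

definition makes_at_most ::
    "real \<Rightarrow> nat \<Rightarrow> nat \<Rightarrow> nonadaptive_algorithm \<Rightarrow> nat \<Rightarrow> bool" where
  "makes_at_most C n N A q \<longleftrightarrow>
     (\<forall>f \<in> inputs C n N. \<forall>(b, t) \<in> set_pmf (run n f A). t \<le> q)"

end

theory Submission
  imports Defs "HOL-Real_Asymp.Real_Asymp"
begin

text \<open>Restrict to \<open>m = \<Theta>(log N)\<close> coordinates and let \<open>f\<close> be false below weight \<open>k\<close> and true above
  weight \<open>k + 1\<close>, where \<open>k / m > 1/2\<close> is a constant so close to \<open>1/2\<close> that layer \<open>k\<close> has
  \<open>N\<close> elements up to a constant, and carries a constant fraction of the mass. On the two middle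
  layers \<open>f\<close> is governed by exponentially many random conjunctions (terms) of width \<open>k\<close>: false if no term
  is satisfied, true if at least two are, and a part function if exactly one is. If the part
  functions are random constants then \<open>f\<close> is monotone. If they are negations of random variables
  then, with high probability for a constant fraction of the choices of terms, a constant fraction
  of the middle layer lies on violating edges, so \<open>f\<close> is far from unate.

  Since the terms are this wide, two queries at distance more than \<open>O(log m)\<close> essentially never
  share a term. Hence all the queries together inspect, inside each part, differences in few
  coordinates, in total \<open>O(q log m)\<close>; unless one of them is the hidden variable of its part, which has
  probability \<open>O(q log m / m)\<close>, the negated variables look exactly like constants. Samples are
  replaced by uniform points labelled with their value (rejection sampling); such points are far
  apart, so a single term influences at most one label, and queries chosen from the labels are
  still nearly independent of every single term.\<close>

section \<open>Random terms and the two families of part functions\<close>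

text \<open>The ratio \<open>k / m\<close> will be (g + 1) / (2 g + 1) for a constant g, because two
  demands pull against each other. At ratio 1/2 one layer would hold only about a 1 / sqrt m
  fraction of the satisfying assignments, and the distance from unateness would vanish with m; a
  fixed gap above 1/2 makes the layers above k shrink geometrically. On the other hand the layer
  must have more than 2 ^ (\<alpha> m) elements: then N \<le> 2 ^ (\<alpha> n) forces m < n, which
  leaves room for one spare coordinate. This is where the assumption that the exponent is below 1
  enters, and it fixes g. The two sources of randomness are averaged in opposite orders. With the
  terms fixed, answers are compared over the choice of part functions; with the part functions
  fixed, distant queries share a term only for few choices of the terms. A one-sided comparison
  suffices: a tester would accept the constants more often than the negated variables by 1/3 on
  average, and it is enough to bound this difference from above.\<close>

lemma card_fun_upd_le:
  assumes "finite I" "j \<in> I" "finite B" "B \<noteq> {}" "\<delta> \<ge> 0"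
    and bound: "\<And>w. w \<in> I \<rightarrow>\<^sub>E B \<Longrightarrow> real (card {t \<in> B. P (w(j := t))}) \<le> \<delta> * real (card B)"
  shows "real (card {w \<in> I \<rightarrow>\<^sub>E B. P w}) \<le> \<delta> * real (card (I \<rightarrow>\<^sub>E B))"
proof -
  let ?R = "(I - {j}) \<rightarrow>\<^sub>E B"
  have fR: "finite ?R" using assms by (intro finite_PiE) auto
  have eq: "I \<rightarrow>\<^sub>E B = (\<lambda>(t, g). g(j := t)) ` (B \<times> ?R)"
    using PiE_insert_eq[of j "I - {j}" "\<lambda>_. B"] by (simp only: insert_Diff[OF \<open>j \<in> I\<close>])
  have card: "card (I \<rightarrow>\<^sub>E B) = card B * card ?R"
    using assms card_Suc_Diff1[OF assms(1,2)] by (simp add: card_PiE flip: power_Suc)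
  have "{w \<in> I \<rightarrow>\<^sub>E B. P w} \<subseteq> (\<Union>g\<in>?R. (\<lambda>t. g(j := t)) ` {t \<in> B. P (g(j := t))})"
    unfolding eq by auto
  then have "card {w \<in> I \<rightarrow>\<^sub>E B. P w} \<le> card (\<Union>g\<in>?R. (\<lambda>t. g(j := t)) ` {t \<in> B. P (g(j := t))})"
    using fR assms(3) by (intro card_mono) auto
  also have "\<dots> \<le> (\<Sum>g\<in>?R. card ((\<lambda>t. g(j := t)) ` {t \<in> B. P (g(j := t))}))"
    by (rule card_UN_le[OF fR])
  also have "\<dots> \<le> (\<Sum>g\<in>?R. card {t \<in> B. P (g(j := t))})"
    using assms(3) by (intro sum_mono card_image_le) auto
  finally have "real (card {w \<in> I \<rightarrow>\<^sub>E B. P w}) \<le> (\<Sum>g\<in>?R. real (card {t \<in> B. P (g(j := t))}))"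
    by (simp flip: of_nat_sum)
  also have "\<dots> \<le> (\<Sum>g\<in>?R. \<delta> * real (card B))"
  proof (rule sum_mono)
    fix g assume g: "g \<in> ?R"
    \<comment> \<open>The value at \<open>j\<close> is overwritten anyway, so any \<open>b\<close>
      extends \<open>g\<close> to a point of the full product.\<close>
    obtain b where "b \<in> B" using assms by auto
    then have "g(j := b) \<in> I \<rightarrow>\<^sub>E B" using g unfolding eq by force
    from bound[OF this] show "real (card {t \<in> B. P (g(j := t))}) \<le> \<delta> * real (card B)" by simp
  qed
  also have "\<dots> = \<delta> * real (card (I \<rightarrow>\<^sub>E B))" by (simp add: card)
  finally show ?thesis .
qed

lemma card_terms_within:
  fixes A :: "nat set"
  assumes "finite A" "C \<subseteq> A"
  shows "card {xs \<in> {xs. set xs \<subseteq> A \<and> length xs = r}. set xs \<subseteq> C} = card C ^ r"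
proof -
  have "{xs \<in> {xs. set xs \<subseteq> A \<and> length xs = r}. set xs \<subseteq> C} = {xs. set xs \<subseteq> C \<and> length xs = r}"
    using assms by auto
  then show ?thesis using card_lists_length_eq[of C r] assms finite_subset by metis
qed

text \<open>\<open>m\<close> counts the coordinates that matter, \<open>k\<close> is both the lower
  middle layer and the width of a term, \<open>L\<close> is the number of terms, and
  \<open>d\<close> is the distance within which queries are allowed to share a term.\<close>

locale term_family =
  fixes m k L d :: nat
  assumes k_pos: "0 < k" and k_less: "k < m" and m_le: "m \<le> 2 * k" and d_pos: "0 < d"
begin

text \<open>Lists with repetition model k independent draws of a variable, so a random term is
  satisfied at a set S with probability exactly (|S| / m) ^ k.\<close>

definition terms :: "nat list set" where
  "terms = {xs. set xs \<subseteq> {..<m} \<and> length xs = k}"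

definition TT :: "(nat \<Rightarrow> nat list) set" where "TT = {..<L} \<rightarrow>\<^sub>E terms"

definition EE :: "(nat \<Rightarrow> nat) set" where "EE = {..<L} \<rightarrow>\<^sub>E {..<m}"

definition hits :: "nat set \<Rightarrow> (nat \<Rightarrow> nat list) \<Rightarrow> nat set \<Rightarrow> nat set" where
  "hits I T S = {j \<in> I. set (T j) \<subseteq> S}"

definition val :: "nat set \<Rightarrow> (nat \<Rightarrow> nat set \<Rightarrow> bool) \<Rightarrow> (nat \<Rightarrow> nat list) \<Rightarrow> nat set \<Rightarrow> bool" where
  "val I b T S \<longleftrightarrow> 2 \<le> card (hits I T S) \<or> (\<exists>j. hits I T S = {j} \<and> b j S)"

text \<open>Both kinds of part functions are driven by the same index \<open>e j < m\<close>: the constant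
  \<open>k \<le> e j\<close> and the negated variable \<open>e j \<notin> S\<close> are true with the same probability
  \<open>(m - k) / m\<close> at a point of weight \<open>k\<close>.\<close>

definition yes :: "(nat \<Rightarrow> nat) \<Rightarrow> nat \<Rightarrow> nat set \<Rightarrow> bool" where
  "yes e j S \<longleftrightarrow> k \<le> e j"

definition no :: "(nat \<Rightarrow> nat) \<Rightarrow> nat \<Rightarrow> nat set \<Rightarrow> bool" where
  "no e j S \<longleftrightarrow> e j \<notin> S"

definition mid :: "nat set set" where
  "mid = {S. S \<subseteq> {..<m} \<and> (card S = k \<or> card S = Suc k)}"

lemma finite_terms: "finite terms"
  unfolding terms_def by (intro finite_lists_length_eq) auto

lemma card_terms: "card terms = m ^ k"
  unfolding terms_def using card_lists_length_eq[of "{..<m}" k] by simp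

lemma terms_nonempty: "terms \<noteq> {}"
  using card_terms k_less by (metis card.empty power_not_zero not_less_zero)

lemma finite_TT: "finite TT" unfolding TT_def by (intro finite_PiE finite_terms) auto

lemma finite_EE: "finite EE" unfolding EE_def by (intro finite_PiE) auto

lemma card_EE: "card EE = m ^ L" unfolding EE_def by (simp add: card_PiE)

lemma card_TT: "card TT = (m ^ k) ^ L" unfolding TT_def by (simp add: card_PiE card_terms)

lemma mid_finite: "S \<in> mid \<Longrightarrow> finite S"
  unfolding mid_def using finite_subset by auto

lemma val_unique: "hits I T S = {j} \<Longrightarrow> val I b T S = b j S"
  unfolding val_def by auto

lemma val_not_unique: "(\<And>j. hits I T S \<noteq> {j}) \<Longrightarrow> val I b T S = (2 \<le> card (hits I T S))"
  unfolding val_def by auto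

text \<open>Labels produced by a constant agree on all of \<open>Q\<close>. For one reference point
  x0 the indices compatible with its label are as many for the negated variable as for the constant,
  up to one. Every further point excludes only indices in which it differs from x0, hence at most d.
  The total loss 1 + (|Q| - 1) d is at most |Q| d, and the constants leave at least m - k indices to
  compare it with.\<close>

lemma part_count:
  fixes S :: "'a \<Rightarrow> nat set"
  assumes fin: "finite Q" and mid: "\<And>x. x \<in> Q \<Longrightarrow> S x \<in> mid"
    and close: "\<And>x y. x \<in> Q \<Longrightarrow> y \<in> Q \<Longrightarrow> card (sym_diff (S x) (S y)) \<le> d"
  shows "(1 - real (card Q * d) / real (m - k)) * real (card {i \<in> {..<m}. \<forall>x\<in>Q. (k \<le> i) = v x})
    \<le> real (card {i \<in> {..<m}. \<forall>x\<in>Q. (i \<notin> S x) = v x})"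
proof (cases "Q = {} \<or> {i \<in> {..<m}. \<forall>x\<in>Q. (k \<le> i) = v x} = {}")
  case True
  then show ?thesis
  proof
    assume "{i \<in> {..<m}. \<forall>x\<in>Q. (k \<le> i) = v x} = {}"
    then show ?thesis by (simp only: card.empty)
  qed simp
next
  case False
  then obtain x0 i0 where x0: "x0 \<in> Q" and i0: "i0 < m" "\<forall>x\<in>Q. (k \<le> i0) = v x" by auto
  let ?E' = "{i \<in> {..<m}. \<forall>x\<in>Q. (k \<le> i) = v x}"
  let ?E = "{i \<in> {..<m}. \<forall>x\<in>Q. (i \<notin> S x) = v x}"
  let ?B = "{i \<in> {..<m}. (i \<notin> S x0) = v x0}"
  let ?D = "\<Union>x\<in>Q - {x0}. sym_diff (S x0) (S x)"
  have S0: "S x0 \<subseteq> {..<m}" "card (S x0) = k \<or> card (S x0) = Suc k"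
    using mid[OF x0] unfolding mid_def by auto
  have vc: "v x = v x0" if "x \<in> Q" for x using i0 x0 that by blast
  have fD: "finite ?D" using fin mid mid_finite x0 by auto
  have "?B - ?D \<subseteq> ?E"
  proof
    fix i assume i: "i \<in> ?B - ?D"
    have "(i \<notin> S x) = v x" if "x \<in> Q" for x
      using i vc[OF that] that by (cases "x = x0") auto
    then show "i \<in> ?E" using i by simp
  qed
  then have "card (?B - ?D) \<le> card ?E" by (intro card_mono) auto
  moreover have "card ?B \<le> card (?B - ?D) + card ?D"
    using diff_card_le_card_Diff[OF fD, of ?B] by linarith
  moreover have "card ?D \<le> (card Q - 1) * d"
  proof -
    have "card ?D \<le> (\<Sum>x\<in>Q - {x0}. card (sym_diff (S x0) (S x)))"
      using fin by (intro card_UN_le) auto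
    also have "\<dots> \<le> (\<Sum>x\<in>Q - {x0}. d)" by (rule sum_mono) (use x0 close in auto)
    finally show ?thesis using fin x0 by simp
  qed
  \<comment> \<open>The extra 1 occurs when x0 has weight k + 1 and label true: only m - k - 1
    indices lie outside its set, against m - k constants. For label false the lower bound m - k on
    the k constants is \<open>m_le\<close>.\<close>
  moreover have "card ?E' \<le> card ?B + 1 \<and> card ?E' \<ge> m - k"
  proof (cases "v x0")
    case True
    have "\<forall>x\<in>Q. v x" using vc True by blast
    then have "?E' = {k..<m}" using x0 by auto
    moreover have "?B = {..<m} - S x0" using True by auto
    moreover have "card ({..<m} - S x0) = m - card (S x0)"
      using S0 by (subst card_Diff_subset) (auto intro: finite_subset)
    ultimately show ?thesis using S0 by auto
  next
    case False
    have "\<forall>x\<in>Q. \<not> v x" using vc False by blast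
    then have "?E' = {..<k}" using x0 k_less by auto
    moreover have "?B = S x0" using False S0 by auto
    ultimately show ?thesis using S0 m_le by auto
  qed
  ultimately have *: "card ?E' \<le> card ?E + 1 + (card Q - 1) * d" "m - k \<le> card ?E'" by linarith+
  have "1 + (card Q - 1) * d \<le> card Q * d"
    using x0 fin d_pos by (cases "card Q") auto
  then have "real (card ?E') \<le> real (card ?E) + real (card Q * d)"
    using * by (simp flip: of_nat_add of_nat_mult)
  moreover have "real (card Q * d) \<le> real (card Q * d) / real (m - k) * real (card ?E')"
  proof -
    have "real (card Q * d) * real (m - k) \<le> real (card Q * d) * real (card ?E')"
      using * by (intro mult_left_mono) (simp_all only: of_nat_le_iff of_nat_0_le_iff)
    moreover have "real (m - k) > 0" using k_less by simp
    ultimately show ?thesis by (simp only: times_divide_eq_left pos_le_divide_eq)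
  qed
  ultimately show ?thesis by (simp add: algebra_simps)
qed

text \<open>With the terms fixed, the labels impose conditions on each \<open>e j\<close>
  separately, so both sides are cardinalities of products. Part j loses a factor 1 - \<delta> j with
  \<delta> j proportional to the number of points seen only by term j. These point sets are
  disjoint, and the product of the factors is at least 1 minus the sum of the \<delta> j.\<close>

lemma pattern_count:
  fixes S :: "'a \<Rightarrow> nat set"
  assumes fin: "finite P" and mid: "\<And>x. x \<in> P \<Longrightarrow> S x \<in> mid"
    and close: "\<And>j x y. j < L \<Longrightarrow> x \<in> P \<Longrightarrow> y \<in> P \<Longrightarrow> set (T j) \<subseteq> S x \<inter> S y \<Longrightarrow>
                  card (sym_diff (S x) (S y)) \<le> d"
  shows "(1 - real (card P * d) / real (m - k)) *
      real (card {e \<in> EE. \<forall>x\<in>P. val {..<L} (yes e) T (S x) = v x})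
    \<le> real (card {e \<in> EE. \<forall>x\<in>P. val {..<L} (no e) T (S x) = v x})"
proof -
  define Q where "Q j = {x \<in> P. hits {..<L} T (S x) = {j}}" for j
  define E where "E j = {i \<in> {..<m}. \<forall>x\<in>Q j. (i \<notin> S x) = v x}" for j
  define E' where "E' j = {i \<in> {..<m}. \<forall>x\<in>Q j. (k \<le> i) = v x}" for j
  define \<delta> where "\<delta> j = real (card (Q j) * d) / real (m - k)" for j
  let ?A' = "{e \<in> EE. \<forall>x\<in>P. val {..<L} (yes e) T (S x) = v x}"
  let ?A = "{e \<in> EE. \<forall>x\<in>P. val {..<L} (no e) T (S x) = v x}"
  let ?\<eta> = "real (card P * d) / real (m - k)"
  have finQ: "finite (Q j)" for j unfolding Q_def using fin by auto
  have "(\<Sum>j<L. card (Q j)) = card (\<Union>j<L. Q j)"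
    using finQ by (intro card_UN_disjoint[symmetric]) (auto simp: Q_def)
  also have "\<dots> \<le> card P" using fin by (intro card_mono) (auto simp: Q_def)
  finally have "(\<Sum>j<L. card (Q j)) * d \<le> card P * d" by simp
  then have "real ((\<Sum>j<L. card (Q j)) * d) \<le> real (card P * d)" by (rule of_nat_mono)
  then have sum\<delta>: "(\<Sum>j<L. \<delta> j) \<le> ?\<eta>"
    unfolding \<delta>_def sum_divide_distrib[symmetric] of_nat_sum[symmetric] sum_distrib_right[symmetric]
    by (rule divide_right_mono) simp
  have \<delta>0: "\<delta> j \<ge> 0" for j unfolding \<delta>_def by auto
  show ?thesis
  proof (cases "?\<eta> > 1 \<or> ?A' = {}")
    case True
    then show ?thesis
    proof
      assume "?\<eta> > 1"
      then have "(1 - ?\<eta>) * real (card ?A') \<le> 0" by (simp add: mult_nonpos_nonneg)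
      then show ?thesis by (meson of_nat_0_le_iff order_trans)
    next
      assume "?A' = {}"
      then show ?thesis by (simp only: card.empty)
    qed
  next
    case False
    then obtain e0 where e0: "e0 \<in> EE" "\<forall>x\<in>P. val {..<L} (yes e0) T (S x) = v x" by auto
    \<comment> \<open>A point satisfying no term, or several, has a value that does not depend on
      the part functions, so the witness \<open>e0\<close> certifies its label for both
      families.\<close>
    have nonuni: "val {..<L} b T (S x) = v x"
      if "x \<in> P" "\<And>j. hits {..<L} T (S x) \<noteq> {j}" for x b
      using e0 that val_not_unique by metis
    have hitL: "j < L" if "hits {..<L} T (S x) = {j}" for x j
      using that unfolding hits_def by auto
    have A: "?A = PiE {..<L} E"
    proof (rule set_eqI)
      fix e
      show "e \<in> ?A \<longleftrightarrow> e \<in> PiE {..<L} E"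
      proof
        assume "e \<in> ?A"
        then show "e \<in> PiE {..<L} E"
          unfolding EE_def E_def Q_def by (auto simp: PiE_iff val_unique no_def)
      next
        assume e: "e \<in> PiE {..<L} E"
        have "val {..<L} (no e) T (S x) = v x" if x: "x \<in> P" for x
        proof (cases "\<exists>j. hits {..<L} T (S x) = {j}")
          case True
          then obtain j where j: "hits {..<L} T (S x) = {j}" by auto
          then have "e j \<in> E j" using e hitL by auto
          then show ?thesis using j x by (auto simp: E_def Q_def val_unique no_def)
        qed (use nonuni x in auto)
        then show "e \<in> ?A" using e unfolding EE_def E_def by (auto simp: PiE_iff)
      qed
    qed
    have A': "?A' = PiE {..<L} E'"
    proof (rule set_eqI)
      fix e
      show "e \<in> ?A' \<longleftrightarrow> e \<in> PiE {..<L} E'"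
      proof
        assume "e \<in> ?A'"
        then show "e \<in> PiE {..<L} E'"
          unfolding EE_def E'_def Q_def by (auto simp: PiE_iff val_unique yes_def)
      next
        assume e: "e \<in> PiE {..<L} E'"
        have "val {..<L} (yes e) T (S x) = v x" if x: "x \<in> P" for x
        proof (cases "\<exists>j. hits {..<L} T (S x) = {j}")
          case True
          then obtain j where j: "hits {..<L} T (S x) = {j}" by auto
          then have "e j \<in> E' j" using e hitL by auto
          then show ?thesis using j x by (auto simp: E'_def Q_def val_unique yes_def)
        qed (use nonuni x in auto)
        then show "e \<in> ?A'" using e unfolding EE_def E'_def by (auto simp: PiE_iff)
      qed
    qed
    have \<delta>1: "\<delta> j \<le> 1" if "j < L" for j
    proof -
      have "\<delta> j \<le> (\<Sum>j<L. \<delta> j)" using that \<delta>0 by (intro member_le_sum) auto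
      then show ?thesis using sum\<delta> False by (meson not_le order_trans)
    qed
    have part: "(1 - \<delta> j) * real (card (E' j)) \<le> real (card (E j))" if "j < L" for j
      unfolding \<delta>_def E_def E'_def
    proof (rule part_count[OF finQ])
      show "S x \<in> mid" if "x \<in> Q j" for x using mid that by (auto simp: Q_def)
      show "card (sym_diff (S x) (S y)) \<le> d" if "x \<in> Q j" "y \<in> Q j" for x y
        by (rule close[of j]) (use that \<open>j < L\<close> in \<open>auto simp: Q_def hits_def\<close>)
    qed
    have "(1 - ?\<eta>) * real (card ?A') \<le> (1 - (\<Sum>j<L. \<delta> j)) * real (card ?A')"
      using sum\<delta> by (intro mult_right_mono) auto
    also have "\<dots> \<le> (\<Prod>j<L. 1 - \<delta> j) * real (card ?A')"
      using \<delta>0 \<delta>1 by (intro mult_right_mono Weierstrass_prod_ineq) auto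
    also have "\<dots> = (\<Prod>j<L. (1 - \<delta> j) * real (card (E' j)))"
      by (simp add: A' card_PiE prod.distrib)
    also have "\<dots> \<le> (\<Prod>j<L. real (card (E j)))"
      using \<delta>1 part by (intro prod_mono) auto
    also have "\<dots> = real (card ?A)" by (simp add: A card_PiE)
    finally show ?thesis .
  qed
qed

end

section \<open>Two rounds of queries\<close>

lemma sum_card_swap:
  assumes "finite A" "finite B"
  shows "(\<Sum>x\<in>A. card {y \<in> B. P x y}) = (\<Sum>y\<in>B. card {x \<in> A. P x y})"
proof -
  have "(\<Sum>x\<in>A. card {y \<in> B. P x y}) = (\<Sum>x\<in>A. \<Sum>y\<in>B. if P x y then 1 else 0)"
    using assms by (simp only: card_eq_sum sum.inter_filter)
  also have "\<dots> = (\<Sum>y\<in>B. \<Sum>x\<in>A. if P x y then 1 else 0)" by (rule sum.swap)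
  also have "\<dots> = (\<Sum>y\<in>B. card {x \<in> A. P x y})"
    using assms by (simp only: card_eq_sum sum.inter_filter)
  finally show ?thesis .
qed

lemma card_sym_diff:
  assumes "finite A" "finite B"
  shows "card (sym_diff A B) + 2 * card (A \<inter> B) = card A + card B"
proof -
  have "card (sym_diff A B) = card (A - B) + card (B - A)"
    using assms by (intro card_Un_disjoint) auto
  moreover have "card (A - B) = card A - card (A \<inter> B)"
    using assms by (intro card_Diff_subset_Int) auto
  moreover have "card (B - A) = card B - card (A \<inter> B)"
    using assms by (subst Int_commute, intro card_Diff_subset_Int) auto
  moreover have "card (A \<inter> B) \<le> card A" "card (A \<inter> B) \<le> card B"
    using assms by (auto intro: card_mono)
  ultimately show ?thesis by simp
qed

text \<open>Positions past the end change nothing, so l = \<open>length a\<close> encodes that no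
  answer is flipped.\<close>

definition flip_at :: "nat \<Rightarrow> bool list \<Rightarrow> bool list" where
  "flip_at l a = (if l < length a then a[l := \<not> a ! l] else a)"

text \<open>Queries are abstract: \<open>S x\<close> is the middle-layer set seen by an active
  query, and an inactive one has the known answer \<open>base x\<close>, whatever the terms and
  parts are.\<close>

locale query_view = term_family +
  fixes S :: "'a \<Rightarrow> nat set" and act base :: "'a \<Rightarrow> bool" and h :: nat
  assumes act_mid: "act x \<Longrightarrow> S x \<in> mid" and d_eq: "d = 2 * h + 2"
begin

definition fl :: "nat set \<Rightarrow> (nat \<Rightarrow> nat set \<Rightarrow> bool) \<Rightarrow> (nat \<Rightarrow> nat list) \<Rightarrow> 'a \<Rightarrow> bool" where
  "fl I b T x = (if act x then val I b T (S x) else base x)"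

definition far :: "'a \<Rightarrow> 'a \<Rightarrow> bool" where
  "far x y \<longleftrightarrow> (act x \<longrightarrow> act y \<longrightarrow> d < card (sym_diff (S x) (S y)))"

definition close :: "(nat \<Rightarrow> nat list) \<Rightarrow> 'a set \<Rightarrow> bool" where
  "close T P \<longleftrightarrow> (\<forall>j<L. \<forall>x\<in>P. \<forall>y\<in>P. act x \<and> act y \<and> set (T j) \<subseteq> S x \<inter> S y \<longrightarrow>
     card (sym_diff (S x) (S y)) \<le> d)"

definition out :: "(nat \<Rightarrow> nat set \<Rightarrow> bool) \<Rightarrow> (nat \<Rightarrow> nat list) \<Rightarrow> 'a list \<Rightarrow>
    (bool list \<Rightarrow> 'a list) \<Rightarrow> (bool list \<Rightarrow> bool list \<Rightarrow> bool) \<Rightarrow> bool" where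
  "out b T us X D =
     (let a = map (fl {..<L} b T) us in D a (map (fl {..<L} b T) (X a)))"

text \<open>In \<open>out\<close>, \<open>us\<close> are the points of the first round and \<open>X\<close> maps their values to the points
  of the second round. The next lemma conditions on the terms: as long as queries sharing a term
  are close to each other, each transcript is almost as likely for the negated variables as for
  the constants.\<close>

lemma out_count:
  assumes len: "\<And>a. length (X a) \<le> q"
  shows "(1 - real ((length us + q) * d) / real (m - k)) *
      real (card {e \<in> EE. out (yes e) T us X D \<and>
        close T (set us \<union> set (X (map (fl {..<L} (yes e) T) us)))})
    \<le> real (card {e \<in> EE. out (no e) T us X D})"
proof -
  let ?\<eta> = "real ((length us + q) * d) / real (m - k)"
  \<comment> \<open>Splitting by complete transcripts removes the dependence between rounds: once
    the first answers \<open>a1\<close> are fixed, the second-round points \<open>X a1\<close> are a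
    fixed list and the count for fixed points applies.\<close>
  define ev where "ev b = (\<lambda>(a1, a2). {e \<in> EE. map (fl {..<L} (b e) T) us = a1 \<and>
      map (fl {..<L} (b e) T) (X a1) = a2})" for b :: "(nat \<Rightarrow> nat) \<Rightarrow> nat \<Rightarrow> nat set \<Rightarrow> bool"
  define PP where "PP = {(a1, a2). length a1 = length us \<and> length a2 = length (X a1) \<and> D a1 a2 \<and>
      close T (set us \<union> set (X a1))}"
  have "PP \<subseteq> {a. set a \<subseteq> UNIV \<and> length a = length us} \<times> {a. set a \<subseteq> UNIV \<and> length a \<le> q}"
    unfolding PP_def using len by auto
  then have finPP: "finite PP"
    by (rule finite_subset) (intro finite_SigmaI finite_lists_length_eq finite_lists_length_le; simp)
  have finev: "finite (ev b p)" for b p unfolding ev_def using finite_EE by (auto split: prod.split)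
  have disj: "ev b p \<inter> ev b p' = {}" if "p \<noteq> p'" for b p p'
    using that unfolding ev_def by (auto split: prod.splits)
  have Y: "{e \<in> EE. out (yes e) T us X D \<and>
        close T (set us \<union> set (X (map (fl {..<L} (yes e) T) us)))} = (\<Union>p\<in>PP. ev yes p)"
    unfolding ev_def PP_def out_def Let_def by auto
  have N: "(\<Union>p\<in>PP. ev no p) \<subseteq> {e \<in> EE. out (no e) T us X D}"
    unfolding ev_def PP_def out_def Let_def by auto
  have each: "(1 - ?\<eta>) * real (card (ev yes p)) \<le> real (card (ev no p))" if p: "p \<in> PP" for p
  proof (cases "ev yes p = {}")
    case True
    then show ?thesis by simp
  next
    case False
    obtain a1 a2 where p_eq: "p = (a1, a2)" by fastforce
    from False obtain e0 where e0: "e0 \<in> EE" "map (fl {..<L} (yes e0) T) us = a1"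
        "map (fl {..<L} (yes e0) T) (X a1) = a2"
      unfolding ev_def p_eq by auto
    define v where "v = fl {..<L} (yes e0) T"
    define P where "P = {x \<in> set us \<union> set (X a1). act x}"
    have ev: "ev b p = {e \<in> EE. \<forall>x\<in>P. val {..<L} (b e) T (S x) = v x}" for b
    proof -
      have "ev b p = {e \<in> EE. map (fl {..<L} (b e) T) us = map v us \<and>
          map (fl {..<L} (b e) T) (X a1) = map v (X a1)}"
        unfolding ev_def p_eq v_def using e0 by simp
      also have "\<dots> = {e \<in> EE. \<forall>x\<in>set us \<union> set (X a1). fl {..<L} (b e) T x = v x}"
        by auto
      also have "\<dots> = {e \<in> EE. \<forall>x\<in>P. val {..<L} (b e) T (S x) = v x}"
        unfolding P_def v_def fl_def by auto
      finally show ?thesis .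
    qed
    have "card P \<le> card (set (us @ X a1))" unfolding P_def by (intro card_mono) auto
    also have "\<dots> \<le> length us + q" using card_length[of "us @ X a1"] len[of a1] by simp
    finally have "card P * d \<le> (length us + q) * d" by simp
    then have "real (card P * d) \<le> real ((length us + q) * d)" by (rule of_nat_mono)
    then have "real (card P * d) / real (m - k) \<le> ?\<eta>" by (rule divide_right_mono) simp
    then have "(1 - ?\<eta>) * real (card (ev yes p)) \<le> (1 - real (card P * d) / real (m - k)) * real (card (ev yes p))"
      by (intro mult_right_mono) auto
    also have "\<dots> \<le> real (card (ev no p))"
      unfolding ev
    proof (rule pattern_count)
      show "finite P" unfolding P_def by auto
      show "S x \<in> mid" if "x \<in> P" for x using that act_mid unfolding P_def by auto
      show "card (sym_diff (S x) (S y)) \<le> d"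
        if "j < L" "x \<in> P" "y \<in> P" "set (T j) \<subseteq> S x \<inter> S y" for j x y
        using p that unfolding PP_def p_eq close_def P_def by auto
    qed
    finally show ?thesis .
  qed
  have "(1 - ?\<eta>) * real (card (\<Union>p\<in>PP. ev yes p)) = (\<Sum>p\<in>PP. (1 - ?\<eta>) * real (card (ev yes p)))"
    using finPP finev disj by (subst card_UN_disjoint) (auto simp: sum_distrib_left)
  also have "\<dots> \<le> (\<Sum>p\<in>PP. real (card (ev no p)))" by (rule sum_mono) (rule each)
  also have "\<dots> = real (card (\<Union>p\<in>PP. ev no p))"
    using finPP finev disj by (subst card_UN_disjoint) auto
  also have "\<dots> \<le> real (card {e \<in> EE. out (no e) T us X D})"
    using N finite_EE by (intro of_nat_mono card_mono) auto
  finally show ?thesis unfolding Y .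
qed

text \<open>This dictates \<open>d = 2 * h + 2\<close>: the weights add up to at most 2 k + 2, so a
  symmetric difference above 2 h + 2 leaves less than 2 (k - h) for twice the intersection.\<close>

lemma card_inter_far:
  assumes "act x" "act y" "far x y"
  shows "card (S x \<inter> S y) \<le> k - h"
proof -
  have mid: "S x \<in> mid" "S y \<in> mid" using act_mid assms by auto
  have "card (S x) \<le> Suc k" "card (S y) \<le> Suc k" using mid by (auto simp: mid_def)
  moreover have "d < card (sym_diff (S x) (S y))" using assms by (simp add: far_def)
  ultimately show ?thesis
    using card_sym_diff[OF mid_finite mid_finite, OF mid] d_eq by linarith
qed

section \<open>Influence of a single term on the queries\<close>

lemma fl_without:
  assumes "\<not> (act x \<and> set (T j) \<subseteq> S x)"
  shows "fl I b T x = fl (I - {j}) b T x"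
proof (cases "act x")
  case True
  then have "hits I T (S x) = hits (I - {j}) T (S x)" using assms unfolding hits_def by auto
  then show ?thesis unfolding fl_def val_def by simp
qed (simp add: fl_def)

lemma answers_without:
  assumes far: "sorted_wrt far us"
    and none: "\<not> (\<exists>x\<in>set us. \<exists>y\<in>set us. act x \<and> act y \<and> far x y \<and> set (T j) \<subseteq> S x \<inter> S y)"
  shows "\<exists>l\<le>length us. map (fl I b T) us = flip_at l (map (fl (I - {j}) b T) us)"
proof -
  let ?a = "map (fl I b T) us" and ?a' = "map (fl (I - {j}) b T) us"
  let ?on = "\<lambda>p. act (us ! p) \<and> set (T j) \<subseteq> S (us ! p)"
  have uniq: "p1 = p2" if p: "p1 < length us" "p2 < length us" "?on p1" "?on p2" for p1 p2
  proof (rule ccontr)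
    assume "p1 \<noteq> p2"
    then have "far (us ! p1) (us ! p2) \<or> far (us ! p2) (us ! p1)"
      using far p unfolding sorted_wrt_iff_nth_less by (meson linorder_neqE_nat)
    then show False using none p by (meson Int_subset_iff nth_mem)
  qed
  show ?thesis
  proof (cases "?a = ?a'")
    case True
    then show ?thesis by (intro exI[of _ "length us"]) (simp add: flip_at_def)
  next
    case False
    then obtain p where p: "p < length us" "fl I b T (us ! p) \<noteq> fl (I - {j}) b T (us ! p)"
      by (auto simp: list_eq_iff_nth_eq)
    then have on: "?on p" using fl_without by metis
    have "?a = flip_at p ?a'"
    proof (rule nth_equalityI)
      fix i assume "i < length ?a"
      then have i: "i < length us" by simp
      show "?a ! i = flip_at p ?a' ! i"
      proof (cases "i = p")
        case True
        then show ?thesis using p by (simp add: flip_at_def)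
      next
        case False
        then have "\<not> ?on i" using uniq i p on by blast
        then show ?thesis using False i p fl_without[of "us ! i" T j I b] by (simp add: flip_at_def)
      qed
    qed (simp add: flip_at_def)
    then show ?thesis using p by (intro exI[of _ p]) auto
  qed
qed

text \<open>The second round depends on the terms through the answers of the first. Removing term \<open>j\<close>
  makes these answers independent of \<open>T j\<close> and changes at most one of them, because the points
  of the first round are far apart; \<open>crowd\<close> allows for this one change.\<close>

definition crowd :: "(nat \<Rightarrow> nat set \<Rightarrow> bool) \<Rightarrow> 'a list \<Rightarrow> (bool list \<Rightarrow> 'a list) \<Rightarrow> nat \<Rightarrow>
    (nat \<Rightarrow> nat list) \<Rightarrow> bool" where
  "crowd b us X j T \<longleftrightarrow> (\<exists>l\<le>length us.
     \<exists>x\<in>set (us @ X (flip_at l (map (fl ({..<L} - {j}) b T) us))).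
     \<exists>y\<in>set (us @ X (flip_at l (map (fl ({..<L} - {j}) b T) us))).
       act x \<and> act y \<and> far x y \<and> set (T j) \<subseteq> S x \<inter> S y)"

lemma not_close_crowd:
  assumes far: "sorted_wrt far us"
    and nc: "\<not> close T (set us \<union> set (X (map (fl {..<L} b T) us)))"
  shows "\<exists>j<L. crowd b us X j T"
proof -
  from nc obtain j x y where j: "j < L" and xy: "act x" "act y" "far x y" "set (T j) \<subseteq> S x \<inter> S y"
    "x \<in> set us \<union> set (X (map (fl {..<L} b T) us))" "y \<in> set us \<union> set (X (map (fl {..<L} b T) us))"
    unfolding close_def far_def by (auto simp: not_le)
  have "crowd b us X j T"
  proof (cases "\<exists>x\<in>set us. \<exists>y\<in>set us. act x \<and> act y \<and> far x y \<and> set (T j) \<subseteq> S x \<inter> S y")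
    case True
    \<comment> \<open>The colliding pair is already in the first round, which does not depend on the
      flipped position, so any \<open>l\<close> serves.\<close>
    then show ?thesis unfolding crowd_def by (intro exI[of _ 0]) auto
  next
    case False
    from answers_without[where T = T and j = j and I = "{..<L}" and b = b, OF far this] obtain l where l: "l \<le> length us"
      "map (fl {..<L} b T) us = flip_at l (map (fl ({..<L} - {j}) b T) us)" by auto
    show ?thesis unfolding crowd_def
      using l(1) xy unfolding l(2) by (intro exI[of _ l]) auto
  qed
  then show ?thesis using j by auto
qed

text \<open>With all other terms fixed, the points queried for a given \<open>l\<close> do not
  involve \<open>T j\<close>, so \<open>T j\<close> is still uniform. A union bound over the
  positions \<open>l\<close> and the ordered pairs of points finishes: a far pair has at most k - h
  common elements and contains the random term with probability at most ((k - h) / m) ^ k.\<close>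

lemma crowd_count:
  assumes len: "\<And>a. length (X a) \<le> q" and j: "j < L"
  shows "real (card {T \<in> TT. crowd b us X j T})
    \<le> real ((length us + 1) * (length us + q)\<^sup>2 * (k - h) ^ k) / real (m ^ k) * real (card TT)"
  unfolding TT_def
proof (rule card_fun_upd_le)
  fix T assume "T \<in> {..<L} \<rightarrow>\<^sub>E terms"
  define A where "A l = us @ X (flip_at l (map (fl ({..<L} - {j}) b T) us))" for l
  have same: "fl ({..<L} - {j}) b (T(j := t)) = fl ({..<L} - {j}) b T" for t
  proof -
    have "hits ({..<L} - {j}) (T(j := t)) = hits ({..<L} - {j}) T"
      unfolding hits_def by (auto intro!: ext)
    then show ?thesis unfolding fl_def val_def by (auto intro!: ext)
  qed
  have lenA: "length (A l) \<le> length us + q" for l unfolding A_def using len by simp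
  let ?W = "\<lambda>x y. {t \<in> terms. act x \<and> act y \<and> far x y \<and> set t \<subseteq> S x \<inter> S y}"
  have W: "card (?W x y) \<le> (k - h) ^ k" for x y
  proof (cases "act x \<and> act y \<and> far x y")
    case True
    then have "S x \<inter> S y \<subseteq> {..<m}" using act_mid unfolding mid_def by blast
    moreover have "?W x y = {t \<in> {t. set t \<subseteq> {..<m} \<and> length t = k}. set t \<subseteq> S x \<inter> S y}"
      using True unfolding terms_def by auto
    ultimately have "card (?W x y) = card (S x \<inter> S y) ^ k"
      by (simp only: card_terms_within[OF finite_lessThan])
    also have "\<dots> \<le> (k - h) ^ k" using card_inter_far True by (intro power_mono) auto
    finally show ?thesis .
  next
    case False
    then have "?W x y = {}" by auto
    then show ?thesis by (simp only: card.empty)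
  qed
  have "{t \<in> terms. crowd b us X j (T(j := t))} \<subseteq>
      (\<Union>l\<in>{..length us}. \<Union>x\<in>set (A l). \<Union>y\<in>set (A l). ?W x y)"
  proof
    fix t assume t: "t \<in> {t \<in> terms. crowd b us X j (T(j := t))}"
    then obtain l x y where "l \<le> length us" "x \<in> set (A l)" "y \<in> set (A l)"
        "act x" "act y" "far x y" "set t \<subseteq> S x \<inter> S y"
      unfolding crowd_def same A_def[symmetric] fun_upd_same by blast
    then show "t \<in> (\<Union>l\<in>{..length us}. \<Union>x\<in>set (A l). \<Union>y\<in>set (A l). ?W x y)"
      using t by blast
  qed
  then have "card {t \<in> terms. crowd b us X j (T(j := t))} \<le>
      card (\<Union>l\<in>{..length us}. \<Union>x\<in>set (A l). \<Union>y\<in>set (A l). ?W x y)"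
    using finite_terms by (intro card_mono) auto
  also have "\<dots> \<le> (\<Sum>l\<in>{..length us}. card (\<Union>x\<in>set (A l). \<Union>y\<in>set (A l). ?W x y))"
    by (intro card_UN_le) auto
  also have "\<dots> \<le> (\<Sum>l\<in>{..length us}. (length us + q) * ((length us + q) * (k - h) ^ k))"
  proof (rule sum_mono)
    fix l
    have cA: "card (set (A l)) \<le> length us + q" using card_length[of "A l"] lenA[of l] by linarith
    have inner: "card (\<Union>y\<in>set (A l). ?W x y) \<le> (length us + q) * (k - h) ^ k" for x
    proof -
      have "card (\<Union>y\<in>set (A l). ?W x y) \<le> (\<Sum>y\<in>set (A l). card (?W x y))"
        by (intro card_UN_le) auto
      also have "\<dots> \<le> of_nat (card (set (A l))) * (k - h) ^ k"
        by (rule sum_bounded_above) (rule W)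
      also have "\<dots> \<le> (length us + q) * (k - h) ^ k" using cA by (simp add: mult_right_mono)
      finally show ?thesis .
    qed
    have "card (\<Union>x\<in>set (A l). \<Union>y\<in>set (A l). ?W x y)
        \<le> (\<Sum>x\<in>set (A l). card (\<Union>y\<in>set (A l). ?W x y))" by (intro card_UN_le) auto
    also have "\<dots> \<le> of_nat (card (set (A l))) * ((length us + q) * (k - h) ^ k)"
      by (rule sum_bounded_above) (rule inner)
    also have "\<dots> \<le> (length us + q) * ((length us + q) * (k - h) ^ k)"
      using cA by (simp add: mult_right_mono)
    finally show "card (\<Union>x\<in>set (A l). \<Union>y\<in>set (A l). ?W x y)
        \<le> (length us + q) * ((length us + q) * (k - h) ^ k)" .
  qed
  also have "\<dots> = (length us + 1) * (length us + q)\<^sup>2 * (k - h) ^ k"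
    by (simp add: power2_eq_square algebra_simps)
  finally have "real (card {t \<in> terms. crowd b us X j (T(j := t))}) \<le>
      real ((length us + 1) * (length us + q)\<^sup>2 * (k - h) ^ k)" by (rule of_nat_mono)
  also have "\<dots> = real ((length us + 1) * (length us + q)\<^sup>2 * (k - h) ^ k) / real (m ^ k) * real (card terms)"
    using k_less by (simp add: card_terms)
  finally show "real (card {t \<in> terms. crowd b us X j (T(j := t))}) \<le> \<dots>" .
qed (use j finite_terms terms_nonempty in auto)

lemma not_close_count:
  assumes len: "\<And>a. length (X a) \<le> q" and far: "sorted_wrt far us"
  shows "real (card {T \<in> TT. \<not> close T (set us \<union> set (X (map (fl {..<L} b T) us)))})
    \<le> real L * (real ((length us + 1) * (length us + q)\<^sup>2 * (k - h) ^ k) / real (m ^ k)) * real (card TT)"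
proof -
  have "{T \<in> TT. \<not> close T (set us \<union> set (X (map (fl {..<L} b T) us)))}
      \<subseteq> (\<Union>j<L. {T \<in> TT. crowd b us X j T})"
  proof
    fix T assume "T \<in> {T \<in> TT. \<not> close T (set us \<union> set (X (map (fl {..<L} b T) us)))}"
    then show "T \<in> (\<Union>j<L. {T \<in> TT. crowd b us X j T})"
      using not_close_crowd[OF far, where T = T and X = X and b = b] by auto
  qed
  then have "card {T \<in> TT. \<not> close T (set us \<union> set (X (map (fl {..<L} b T) us)))}
      \<le> card (\<Union>j<L. {T \<in> TT. crowd b us X j T})"
    using finite_TT by (intro card_mono) auto
  also have "\<dots> \<le> (\<Sum>j<L. card {T \<in> TT. crowd b us X j T})" by (intro card_UN_le) auto
  finally have "real (card {T \<in> TT. \<not> close T (set us \<union> set (X (map (fl {..<L} b T) us)))})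
      \<le> (\<Sum>j<L. real (card {T \<in> TT. crowd b us X j T}))" by (simp flip: of_nat_sum)
  also have "\<dots> \<le> (\<Sum>j<L. real ((length us + 1) * (length us + q)\<^sup>2 * (k - h) ^ k) / real (m ^ k) * real (card TT))"
    by (intro sum_mono crowd_count len) auto
  finally show ?thesis by simp
qed

text \<open>The set \<open>F\<close> is there because only some choices of terms make the functions
  with negated variables far from unate. The first error holds for each choice of terms and scales
  with \<open>card F\<close>; the second is known only on average over all terms and keeps the
  factor \<open>card TT\<close>.\<close>

lemma out_difference:
  assumes len: "\<And>a. length (X a) \<le> q" and far: "sorted_wrt far us" and F: "F \<subseteq> TT"
  shows "(\<Sum>T\<in>F. real (card {e \<in> EE. out (yes e) T us X D})) - (\<Sum>T\<in>F. real (card {e \<in> EE. out (no e) T us X D}))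
    \<le> real ((length us + q) * d) / real (m - k) * real (card F) * real (card EE) +
      real L * (real ((length us + 1) * (length us + q)\<^sup>2 * (k - h) ^ k) / real (m ^ k)) *
        real (card TT) * real (card EE)"
proof -
  let ?\<eta> = "real ((length us + q) * d) / real (m - k)"
  let ?\<beta> = "real L * (real ((length us + 1) * (length us + q)\<^sup>2 * (k - h) ^ k) / real (m ^ k)) * real (card TT)"
  let ?c = "\<lambda>T e. close T (set us \<union> set (X (map (fl {..<L} (yes e) T) us)))"
  have finF: "finite F" using F finite_TT finite_subset by auto
  have each: "real (card {e \<in> EE. out (yes e) T us X D}) - real (card {e \<in> EE. out (no e) T us X D})
      \<le> ?\<eta> * real (card EE) + real (card {e \<in> EE. \<not> ?c T e})" for T
  proof -
    let ?G = "{e \<in> EE. out (yes e) T us X D \<and> ?c T e}"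
    have "card {e \<in> EE. out (yes e) T us X D} \<le> card (?G \<union> {e \<in> EE. \<not> ?c T e})"
      using finite_EE by (intro card_mono) auto
    also have "\<dots> \<le> card ?G + card {e \<in> EE. \<not> ?c T e}" by (rule card_Un_le)
    finally have 1: "real (card {e \<in> EE. out (yes e) T us X D}) \<le> real (card ?G) + real (card {e \<in> EE. \<not> ?c T e})"
      by linarith
    have 2: "(1 - ?\<eta>) * real (card ?G) \<le> real (card {e \<in> EE. out (no e) T us X D})"
      by (rule out_count[OF len])
    have "card ?G \<le> card EE" using finite_EE by (intro card_mono) auto
    then have 3: "?\<eta> * real (card ?G) \<le> ?\<eta> * real (card EE)" by (intro mult_left_mono) auto
    have "y - n \<le> t * E + b" if "(1 - t) * x \<le> n" "y \<le> x + b" "t * x \<le> t * E" for t x n y b E :: real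
      using that by (simp add: left_diff_distrib)
    from this[OF 2 1 3] show ?thesis .
  qed
  \<comment> \<open>Enlarging \<open>F\<close> to \<open>TT\<close> allows the sums to be exchanged,
    after which the bound for random terms applies for each fixed \<open>e\<close>.\<close>
  have "(\<Sum>T\<in>F. card {e \<in> EE. \<not> ?c T e}) \<le> (\<Sum>T\<in>TT. card {e \<in> EE. \<not> ?c T e})"
    using F finite_TT by (intro sum_mono2) auto
  also have "\<dots> = (\<Sum>e\<in>EE. card {T \<in> TT. \<not> ?c T e})"
    using finite_TT finite_EE by (rule sum_card_swap)
  finally have "(\<Sum>T\<in>F. real (card {e \<in> EE. \<not> ?c T e})) \<le> (\<Sum>e\<in>EE. real (card {T \<in> TT. \<not> ?c T e}))"
    by (simp flip: of_nat_sum)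
  also have "\<dots> \<le> (\<Sum>e\<in>EE. ?\<beta>)" by (intro sum_mono not_close_count len far)
  finally have bad: "(\<Sum>T\<in>F. real (card {e \<in> EE. \<not> ?c T e})) \<le> ?\<beta> * real (card EE)"
    by (simp only: sum_constant mult.commute[of "real (card EE)"])
  have "(\<Sum>T\<in>F. real (card {e \<in> EE. out (yes e) T us X D})) - (\<Sum>T\<in>F. real (card {e \<in> EE. out (no e) T us X D}))
      \<le> (\<Sum>T\<in>F. ?\<eta> * real (card EE) + real (card {e \<in> EE. \<not> ?c T e}))"
    unfolding sum_subtractf[symmetric] by (rule sum_mono) (rule each)
  also have "\<dots> = ?\<eta> * real (card F) * real (card EE) + (\<Sum>T\<in>F. real (card {e \<in> EE. \<not> ?c T e}))"
    by (simp only: sum.distrib sum_constant) (simp only: ac_simps)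
  finally show ?thesis using bad by simp
qed

end

section \<open>Many violating edges\<close>

lemma card_PiE_one_other:
  assumes "finite I" "j \<in> I" "C \<subseteq> B" "C' \<subseteq> B"
  shows "card {T \<in> I \<rightarrow>\<^sub>E B. T j \<in> C \<and> (\<forall>l\<in>I - {j}. T l \<in> C')} = card C * card C' ^ (card I - 1)"
proof -
  have "{T \<in> I \<rightarrow>\<^sub>E B. T j \<in> C \<and> (\<forall>l\<in>I - {j}. T l \<in> C')} = PiE I (\<lambda>l. if l = j then C else C')"
    (is "?A = ?B")
  proof (intro equalityI subsetI)
    fix T assume "T \<in> ?A"
    then show "T \<in> ?B" using assms(2) by (intro PiE_I) (auto dest: PiE_arb)
  next
    fix T assume T: "T \<in> ?B"
    have mem: "T l \<in> (if l = j then C else C')" if "l \<in> I" for l using T that by (rule PiE_mem)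
    have "T j \<in> C" using mem[of j] assms(2) by simp
    moreover have "T l \<in> C'" if "l \<in> I - {j}" for l
      using mem[of l] that by simp
    moreover have "T l \<in> B" if "l \<in> I" for l
      using mem[OF that] assms(3,4) by (auto split: if_splits)
    then have "T \<in> I \<rightarrow>\<^sub>E B" using T by (auto intro!: PiE_I dest: PiE_arb)
    ultimately show "T \<in> ?A" by blast
  qed
  also have "card \<dots> = card C * (\<Prod>l\<in>I - {j}. card C')"
    using assms(1,2) by (simp add: card_PiE prod.remove[of I j] if_distrib[of card] cong: prod.cong_simp)
  finally show ?thesis using assms(1,2) by simp
qed

lemma sum_PiE_insert:
  fixes g :: "('a \<Rightarrow> 'b) \<Rightarrow> real"
  assumes "finite I" "j \<notin> I"
  shows "(\<Sum>e\<in>insert j I \<rightarrow>\<^sub>E A. g e) = (\<Sum>e\<in>I \<rightarrow>\<^sub>E A. \<Sum>i\<in>A. g (e(j := i)))"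
proof -
  have "(\<Sum>e\<in>insert j I \<rightarrow>\<^sub>E A. g e) = (\<Sum>(i, e)\<in>A \<times> (I \<rightarrow>\<^sub>E A). g (e(j := i)))"
    unfolding PiE_insert_eq
    by (subst sum.reindex[OF inj_combinator[OF assms(2)]]) (simp add: case_prod_unfold)
  also have "\<dots> = (\<Sum>i\<in>A. \<Sum>e\<in>I \<rightarrow>\<^sub>E A. g (e(j := i)))"
    by (simp add: sum.cartesian_product)
  also have "\<dots> = (\<Sum>e\<in>I \<rightarrow>\<^sub>E A. \<Sum>i\<in>A. g (e(j := i)))" by (rule sum.swap)
  finally show ?thesis .
qed

text \<open>Additivity of variance for independent coordinates: when a coordinate is added, the
  cross term vanishes because that coordinate is centered.\<close>

lemma centered_sum_square:
  fixes z :: "'a \<Rightarrow> 'b \<Rightarrow> real"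
  assumes "finite I" "finite A" "A \<noteq> {}" and zero: "\<And>j. j \<in> I \<Longrightarrow> (\<Sum>i\<in>A. z j i) = 0"
  shows "(\<Sum>e\<in>I \<rightarrow>\<^sub>E A. \<Sum>j\<in>I. z j (e j)) = 0 \<and>
    (\<Sum>e\<in>I \<rightarrow>\<^sub>E A. (\<Sum>j\<in>I. z j (e j))\<^sup>2) = real (card (I \<rightarrow>\<^sub>E A)) * (\<Sum>j\<in>I. (\<Sum>i\<in>A. (z j i)\<^sup>2) / real (card A))"
  using assms(1) zero
proof (induction I rule: finite_induct)
  case empty
  then show ?case by simp
next
  case (insert j I)
  let ?s = "\<lambda>e. \<Sum>l\<in>I. z l (e l)"
  have upd: "(\<Sum>l\<in>insert j I. z l ((e(j := i)) l)) = z j i + ?s e" for e i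
  proof -
    have "(\<Sum>l\<in>I. z l ((e(j := i)) l)) = ?s e"
      using insert.hyps by (intro sum.cong) auto
    then show ?thesis using insert.hyps by simp
  qed
  have IH: "(\<Sum>e\<in>I \<rightarrow>\<^sub>E A. ?s e) = 0"
    "(\<Sum>e\<in>I \<rightarrow>\<^sub>E A. (?s e)\<^sup>2) = real (card (I \<rightarrow>\<^sub>E A)) * (\<Sum>j\<in>I. (\<Sum>i\<in>A. (z j i)\<^sup>2) / real (card A))"
    using insert by auto
  have z0: "(\<Sum>i\<in>A. z j i) = 0" using insert by auto
  have cA: "real (card A) > 0" using assms(2,3) by (simp add: card_gt_0_iff)
  have card: "real (card (insert j I \<rightarrow>\<^sub>E A)) = real (card A) * real (card (I \<rightarrow>\<^sub>E A))"
    using insert.hyps by (simp add: card_PiE)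
  have "(\<Sum>e\<in>insert j I \<rightarrow>\<^sub>E A. \<Sum>l\<in>insert j I. z l (e l)) = (\<Sum>e\<in>I \<rightarrow>\<^sub>E A. \<Sum>i\<in>A. z j i + ?s e)"
    by (simp only: sum_PiE_insert[OF insert.hyps(1,2)] upd)
  also have "\<dots> = real (card A) * (\<Sum>e\<in>I \<rightarrow>\<^sub>E A. ?s e)"
    by (simp add: sum.distrib z0 sum_distrib_left)
  finally have 1: "(\<Sum>e\<in>insert j I \<rightarrow>\<^sub>E A. \<Sum>l\<in>insert j I. z l (e l)) = 0" using IH by simp
  have "(\<Sum>e\<in>insert j I \<rightarrow>\<^sub>E A. (\<Sum>l\<in>insert j I. z l (e l))\<^sup>2) = (\<Sum>e\<in>I \<rightarrow>\<^sub>E A. \<Sum>i\<in>A. (z j i + ?s e)\<^sup>2)"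
    by (simp only: sum_PiE_insert[OF insert.hyps(1,2)] upd)
  also have "\<dots> = (\<Sum>e\<in>I \<rightarrow>\<^sub>E A. (\<Sum>i\<in>A. (z j i)\<^sup>2) + real (card A) * (?s e)\<^sup>2)"
  proof (rule sum.cong)
    fix e
    have "(\<Sum>i\<in>A. (z j i + ?s e)\<^sup>2) = (\<Sum>i\<in>A. (z j i)\<^sup>2 + (2 * ?s e * z j i + (?s e)\<^sup>2))"
      by (simp add: power2_eq_square algebra_simps)
    also have "\<dots> = (\<Sum>i\<in>A. (z j i)\<^sup>2) + (2 * ?s e * (\<Sum>i\<in>A. z j i) + real (card A) * (?s e)\<^sup>2)"
      by (simp add: sum.distrib sum_distrib_left)
    finally show "(\<Sum>i\<in>A. (z j i + ?s e)\<^sup>2) = (\<Sum>i\<in>A. (z j i)\<^sup>2) + real (card A) * (?s e)\<^sup>2"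
      by (simp add: z0)
  qed simp
  also have "\<dots> = real (card (I \<rightarrow>\<^sub>E A)) * (\<Sum>i\<in>A. (z j i)\<^sup>2) + real (card A) * (\<Sum>e\<in>I \<rightarrow>\<^sub>E A. (?s e)\<^sup>2)"
    by (simp add: sum.distrib sum_distrib_left)
  also have "\<dots> = real (card (insert j I \<rightarrow>\<^sub>E A)) * (\<Sum>j\<in>insert j I. (\<Sum>i\<in>A. (z j i)\<^sup>2) / real (card A))"
    using insert.hyps cA unfolding IH(2) card by (simp add: algebra_simps)
  finally show ?case using 1 by simp
qed

lemma product_variance:
  fixes f :: "'a \<Rightarrow> 'b \<Rightarrow> real"
  assumes "finite I" "finite A" "A \<noteq> {}"
  shows "(\<Sum>e\<in>I \<rightarrow>\<^sub>E A. ((\<Sum>j\<in>I. f j (e j)) - (\<Sum>j\<in>I. (\<Sum>i\<in>A. f j i) / real (card A)))\<^sup>2)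
    \<le> real (card (I \<rightarrow>\<^sub>E A)) * (\<Sum>j\<in>I. (\<Sum>i\<in>A. (f j i)\<^sup>2) / real (card A))"
proof -
  define \<mu> where "\<mu> j = (\<Sum>i\<in>A. f j i) / real (card A)" for j
  define z where "z j i = f j i - \<mu> j" for j i
  have cA: "real (card A) > 0" using assms by (simp add: card_gt_0_iff)
  have z0: "(\<Sum>i\<in>A. z j i) = 0" for j
    unfolding z_def sum_subtractf using cA by (simp add: \<mu>_def)
  have "(\<Sum>j\<in>I. f j (e j)) - (\<Sum>j\<in>I. \<mu> j) = (\<Sum>j\<in>I. z j (e j))" for e
    by (simp add: z_def sum_subtractf)
  then have "(\<Sum>e\<in>I \<rightarrow>\<^sub>E A. ((\<Sum>j\<in>I. f j (e j)) - (\<Sum>j\<in>I. \<mu> j))\<^sup>2) =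
      real (card (I \<rightarrow>\<^sub>E A)) * (\<Sum>j\<in>I. (\<Sum>i\<in>A. (z j i)\<^sup>2) / real (card A))"
    using centered_sum_square[OF assms, of z] z0 by simp
  also have "\<dots> \<le> real (card (I \<rightarrow>\<^sub>E A)) * (\<Sum>j\<in>I. (\<Sum>i\<in>A. (f j i)\<^sup>2) / real (card A))"
  proof (rule mult_left_mono, rule sum_mono, rule divide_right_mono)
    fix j
    have "(\<Sum>i\<in>A. (f j i)\<^sup>2) = (\<Sum>i\<in>A. (z j i)\<^sup>2 + (2 * \<mu> j * z j i + (\<mu> j)\<^sup>2))"
      unfolding z_def by (simp add: power2_eq_square algebra_simps)
    also have "\<dots> = (\<Sum>i\<in>A. (z j i)\<^sup>2) + (2 * \<mu> j * (\<Sum>i\<in>A. z j i) + real (card A) * (\<mu> j)\<^sup>2)"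
      by (simp add: sum.distrib sum_distrib_left)
    finally show "(\<Sum>i\<in>A. (z j i)\<^sup>2) \<le> (\<Sum>i\<in>A. (f j i)\<^sup>2)" by (simp add: z0)
  qed auto
  finally show ?thesis unfolding \<mu>_def .
qed

text \<open>\<open>real L * (real k / real m) ^ k\<close> is the expected number of terms satisfied
  at a point of weight k. It is bounded below so that a constant fraction of the layer satisfies
  some term, and small enough that on layer k + 1, where it grows by a factor of at most 3, a second
  term is unlikely.\<close>

locale dense_term_family = term_family +
  fixes h :: nat
  assumes d_eq: "d = 2 * h + 2" and m_ge: "3 * k \<le> 2 * m"
    and L_lower: "1/24 \<le> real L * (real k / real m) ^ k"
    and L_upper: "real L * (real k / real m) ^ k \<le> 1/12"
begin

definition lay :: "nat set set" where "lay = {S. S \<subseteq> {..<m} \<and> card S = k}"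

text \<open>The edge from \<open>x\<close> to \<open>insert i x\<close> lies in part
  \<open>j\<close> alone: term j holds at both ends and no other term holds at either.\<close>

definition good :: "(nat \<Rightarrow> nat list) \<Rightarrow> nat \<Rightarrow> nat \<Rightarrow> nat set \<Rightarrow> bool" where
  "good T j i x \<longleftrightarrow> set (T j) \<subseteq> x \<and> i \<notin> x \<and> (\<forall>l\<in>{..<L} - {j}. \<not> set (T l) \<subseteq> insert i x)"

text \<open>For \<open>x\<close> in \<open>drops\<close>, adding the element \<open>e j\<close> stays in part \<open>j\<close> and switches the function
  with negated variables from true to false.\<close>

definition drops :: "(nat \<Rightarrow> nat list) \<Rightarrow> (nat \<Rightarrow> nat) \<Rightarrow> nat set set" where
  "drops T e = {x \<in> lay. \<exists>j<L. good T j (e j) x}"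

text \<open>The expectation of \<open>card (drops T e)\<close> over uniform \<open>e\<close>, with
  the terms fixed.\<close>

definition mean :: "(nat \<Rightarrow> nat list) \<Rightarrow> real" where
  "mean T = (\<Sum>j<L. (\<Sum>i<m. real (card {x \<in> lay. good T j i x})) / real m)"

definition rich :: "(nat \<Rightarrow> nat list) set" where
  "rich = {T \<in> TT. real (card lay) / 288 \<le> mean T}"

text \<open>The volume of a Hamming ball of radius \<open>d\<close>, which bounds how many points
  are not far from a given one.\<close>

definition near_bound :: nat where
  "near_bound = card {D. D \<subseteq> {..<m} \<and> card D \<le> d}"

section \<open>The expected number of violating edges\<close>

lemma finite_lay: "finite lay" unfolding lay_def by auto

lemma card_lay: "card lay = m choose k"
  unfolding lay_def using n_subsets[of "{..<m}" k] by simp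

lemma card_lay_pos: "card lay > 0" unfolding card_lay using k_less by simp

lemma good_unique: "good T j i x \<Longrightarrow> good T j' i' x \<Longrightarrow> j < L \<Longrightarrow> j' < L \<Longrightarrow> j = j'"
  unfolding good_def by blast

lemma card_drops: "card (drops T e) = (\<Sum>j<L. card {x \<in> lay. good T j (e j) x})"
proof -
  have "drops T e = (\<Union>j<L. {x \<in> lay. good T j (e j) x})" unfolding drops_def by auto
  also have "card \<dots> = (\<Sum>j<L. card {x \<in> lay. good T j (e j) x})"
    using finite_lay good_unique by (intro card_UN_disjoint) auto
  finally show ?thesis .
qed

text \<open>For each fixed i the inner sum over j is the size of \<open>drops\<close> for the
  constant choice e = i, a subset of the layer; averaging over i keeps the bound.\<close>

lemma mean_le: "mean T \<le> real (card lay)"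
proof -
  have "(\<Sum>j<L. real (card {x \<in> lay. good T j i x})) \<le> real (card lay)" for i
  proof -
    have "card (drops T (\<lambda>_. i)) \<le> card lay"
      using finite_lay by (intro card_mono) (auto simp: drops_def)
    then show ?thesis unfolding card_drops by (simp flip: of_nat_sum)
  qed
  then have "(\<Sum>i<m. \<Sum>j<L. real (card {x \<in> lay. good T j i x})) \<le> (\<Sum>i<m. real (card lay))"
    by (rule sum_mono)
  then have "(\<Sum>j<L. \<Sum>i<m. real (card {x \<in> lay. good T j i x})) \<le> real m * real (card lay)"
    by (subst sum.swap) simp
  then show ?thesis using k_less unfolding mean_def sum_divide_distrib[symmetric]
    by (simp add: field_simps)
qed

lemma card_good:
  assumes x: "x \<in> lay" and i: "i < m" "i \<notin> x" and j: "j < L"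
  shows "card {T \<in> TT. good T j i x} = k ^ k * (m ^ k - (k + 1) ^ k) ^ (L - 1)"
proof -
  have sub: "x \<subseteq> {..<m}" "card x = k" using x unfolding lay_def by auto
  then have fx: "finite x" using finite_subset by auto
  let ?C = "{t \<in> terms. set t \<subseteq> x}" and ?C' = "{t \<in> terms. \<not> set t \<subseteq> insert i x}"
  have "card ?C = k ^ k"
    using card_terms_within[OF finite_lessThan sub(1), of k] sub unfolding terms_def by simp
  moreover have "card ?C' = m ^ k - (k + 1) ^ k"
  proof -
    have "?C' = terms - {t \<in> terms. set t \<subseteq> insert i x}" by auto
    moreover have "card {t \<in> terms. set t \<subseteq> insert i x} = (k + 1) ^ k"
      using card_terms_within[OF finite_lessThan, of "insert i x" m k] sub i fx unfolding terms_def by simp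
    ultimately show ?thesis
      using finite_terms card_terms by (simp add: card_Diff_subset)
  qed
  moreover have "{T \<in> TT. good T j i x} =
      {T \<in> {..<L} \<rightarrow>\<^sub>E terms. T j \<in> ?C \<and> (\<forall>l\<in>{..<L} - {j}. T l \<in> ?C')}"
    unfolding TT_def good_def using i j by (auto simp: PiE_iff)
  ultimately show ?thesis
    using card_PiE_one_other[of "{..<L}" j ?C terms ?C'] j by simp
qed

text \<open>The constant is 144 = 3 * 24 * 2. A random index avoids a set of weight k with
  probability (m - k) / m \<ge> 1/3; the expected number of terms satisfied there is at least 1/24;
  and by Bernoulli the other terms avoid the enlarged set with probability at least 1/2, since (1 +
  1/k) ^ k \<le> 3 bounds their expected number by 1/2.\<close>

lemma density_bound:
  "real (card TT) * real m / 144 \<le> real ((m - k) * (L * (k ^ k * (m ^ k - (k + 1) ^ k) ^ (L - 1))))"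
proof -
  have L0: "L > 0" using L_lower by (cases L) auto
  have m0: "real m > 0" using k_less by simp
  have k1: "k + 1 \<le> m" using k_less by simp
  define z where "z = (real (k + 1) / real m) ^ k"
  have z01: "0 \<le> z" "z \<le> 1" unfolding z_def using k1 by (auto intro!: power_le_one)
  have "real (k + 1) / real m = real k / real m * (1 + 1 / real k)"
    using k_pos m0 by (simp add: field_simps)
  then have "z = (real k / real m) ^ k * (1 + 1 / real k) ^ k"
    unfolding z_def by (simp only: power_mult_distrib)
  also have "\<dots> \<le> (real k / real m) ^ k * 3"
  proof (rule mult_left_mono)
    have "(1 + 1 / real k) ^ k \<le> exp (1 / real k) ^ k"
      by (intro power_mono) (auto simp: add_nonneg_nonneg)
    also have "\<dots> = exp 1" using k_pos by (simp flip: exp_of_nat_mult)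
    finally show "(1 + 1 / real k) ^ k \<le> 3" using exp_le by linarith
  qed simp
  finally have "real L * z \<le> 3 * (real L * (real k / real m) ^ k)"
    by (metis mult.assoc mult.commute mult_left_mono of_nat_0_le_iff)
  then have Lz: "real L * z \<le> 1/2" using L_upper by linarith
  have "1 - real (L - 1) * z \<le> (1 + (-z)) ^ (L - 1)"
    using Bernoulli_inequality[of "-z" "L - 1"] z01 by simp
  moreover have "real (L - 1) * z \<le> real L * z" using z01 by (intro mult_right_mono) auto
  ultimately have pz: "1/2 \<le> (1 - z) ^ (L - 1)" using Lz by simp
  have "real (m ^ k - (k + 1) ^ k) = real (m ^ k) * (1 - z)"
  proof -
    have "(k + 1) ^ k \<le> m ^ k" using k1 by (intro power_mono) auto
    then have "real (m ^ k - (k + 1) ^ k) = real (m ^ k) - real ((k + 1) ^ k)" by (rule of_nat_diff)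
    then show ?thesis unfolding z_def using m0 by (simp add: power_divide algebra_simps)
  qed
  then have e: "real ((m ^ k - (k + 1) ^ k) ^ (L - 1)) = real (m ^ k) ^ (L - 1) * (1 - z) ^ (L - 1)"
    by (simp add: power_mult_distrib)
  have "real (card TT) * real m / 144 = (real m / 3) * (real (m ^ k) ^ L * (1/24 * (1/2)))"
    by (simp add: card_TT)
  also have "\<dots> \<le> real (m - k) * (real (m ^ k) ^ L * ((real L * (real k / real m) ^ k) * (1 - z) ^ (L - 1)))"
    using m_ge k_less L_lower pz by (intro mult_mono mult_left_mono) auto
  also have "real (m ^ k) ^ L = real (m ^ k) * real (m ^ k) ^ (L - 1)"
    using L0 by (cases L) auto
  also have "real (m - k) * (real (m ^ k) * real (m ^ k) ^ (L - 1) * ((real L * (real k / real m) ^ k) * (1 - z) ^ (L - 1)))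
      = real (m - k) * (real L * (real (k ^ k) * (real (m ^ k) ^ (L - 1) * (1 - z) ^ (L - 1))))"
    using m0 by (simp add: power_divide)
  also have "\<dots> = real ((m - k) * (L * (k ^ k * (m ^ k - (k + 1) ^ k) ^ (L - 1))))"
    unfolding e[symmetric] by simp
  finally show ?thesis .
qed

lemma sum_mean: "real (card lay) / 144 * real (card TT) \<le> (\<Sum>T\<in>TT. mean T)"
proof -
  let ?G = "k ^ k * (m ^ k - (k + 1) ^ k) ^ (L - 1)"
  have "(\<Sum>T\<in>TT. \<Sum>j<L. \<Sum>i<m. card {x \<in> lay. good T j i x})
      = (\<Sum>j<L. \<Sum>T\<in>TT. \<Sum>i<m. card {x \<in> lay. good T j i x})" by (rule sum.swap)
  also have "\<dots> = (\<Sum>j<L. \<Sum>i<m. \<Sum>T\<in>TT. card {x \<in> lay. good T j i x})"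
    by (intro sum.cong refl sum.swap)
  also have "\<dots> = (\<Sum>j<L. \<Sum>i<m. \<Sum>x\<in>lay. card {T \<in> TT. good T j i x})"
    by (intro sum.cong refl sum_card_swap finite_TT finite_lay)
  also have "\<dots> = (\<Sum>j<L. \<Sum>x\<in>lay. \<Sum>i<m. card {T \<in> TT. good T j i x})"
    by (intro sum.cong refl sum.swap)
  also have "\<dots> \<ge> (\<Sum>j<L. \<Sum>x\<in>lay. (m - k) * ?G)"
  proof (intro sum_mono)
    fix j x assume j: "j \<in> {..<L}" and x: "x \<in> lay"
    then have "x \<subseteq> {..<m}" "card x = k" unfolding lay_def by auto
    then have "card ({..<m} - x) = m - k" by (subst card_Diff_subset) (auto intro: finite_subset)
    then have "(m - k) * ?G = (\<Sum>i\<in>{..<m} - x. card {T \<in> TT. good T j i x})"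
      using card_good[OF x] j by simp
    also have "\<dots> \<le> (\<Sum>i<m. card {T \<in> TT. good T j i x})" by (intro sum_mono2) auto
    finally show "(m - k) * ?G \<le> (\<Sum>i<m. card {T \<in> TT. good T j i x})" .
  qed
  finally have "card lay * ((m - k) * (L * ?G)) \<le> (\<Sum>T\<in>TT. \<Sum>j<L. \<Sum>i<m. card {x \<in> lay. good T j i x})"
    by (simp add: algebra_simps)
  then have "real (card lay) * real ((m - k) * (L * ?G)) \<le>
      real (\<Sum>T\<in>TT. \<Sum>j<L. \<Sum>i<m. card {x \<in> lay. good T j i x})"
    unfolding of_nat_mult[symmetric] of_nat_le_iff .
  also have "\<dots> = real m * (\<Sum>T\<in>TT. mean T)"
    using k_less unfolding mean_def sum_divide_distrib[symmetric] by simp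
  finally have "real (card lay) * (real (card TT) * real m / 144) \<le> real m * (\<Sum>T\<in>TT. mean T)"
    using density_bound by (meson mult_left_mono of_nat_0_le_iff order_trans)
  then have "real m * (real (card lay) / 144 * real (card TT)) \<le> real m * (\<Sum>T\<in>TT. mean T)"
    by (simp add: algebra_simps)
  then show ?thesis using k_less by simp
qed

text \<open>Reverse Markov: the average of \<open>mean\<close> is at least 1/144 of its maximal
  value \<open>card lay\<close>, and the choices of terms outside \<open>rich\<close> contribute at
  most half of that.\<close>

lemma card_rich: "real (card TT) / 288 \<le> real (card rich)"
proof -
  have sub: "rich \<subseteq> TT" unfolding rich_def by auto
  have "(\<Sum>T\<in>TT. mean T) = (\<Sum>T\<in>rich. mean T) + (\<Sum>T\<in>TT - rich. mean T)"
    by (metis add.commute finite_TT sub sum.subset_diff)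
  also have "(\<Sum>T\<in>rich. mean T) \<le> (\<Sum>T\<in>rich. real (card lay))" by (intro sum_mono mean_le)
  also have "(\<Sum>T\<in>TT - rich. mean T) \<le> (\<Sum>T\<in>TT - rich. real (card lay) / 288)"
    by (intro sum_mono) (auto simp: rich_def)
  also have "\<dots> \<le> (\<Sum>T\<in>TT. real (card lay) / 288)" using finite_TT by (intro sum_mono2) auto
  finally have "(\<Sum>T\<in>TT. mean T) \<le> real (card rich) * real (card lay) + real (card TT) * (real (card lay) / 288)"
    by simp
  with sum_mean have "real (card lay) * (real (card TT) / 288) \<le> real (card lay) * real (card rich)"
    by (simp add: algebra_simps)
  then show ?thesis using card_lay_pos by simp
qed

section \<open>Concentration of the number of violating edges\<close>

lemma card_near:
  assumes "A \<subseteq> {..<m}"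
  shows "card {B. B \<subseteq> {..<m} \<and> card (sym_diff A B) \<le> d} \<le> near_bound"
  unfolding near_bound_def
proof (rule card_inj_on_le[where f = "\<lambda>B. sym_diff A B"])
  show "inj_on (\<lambda>B. sym_diff A B) {B. B \<subseteq> {..<m} \<and> card (sym_diff A B) \<le> d}"
    by (rule inj_onI) blast
qed (use assms in auto)

text \<open>This shows that no few terms dominate the layer. A square counts pairs (x, y) with the
  term inside both. For pairs at distance above d the intersection is small and such a term is rare;
  the remaining pairs are few, at most a Hamming ball for each x, and for them the expected number
  of common terms is at most 1.\<close>

lemma sum_square_weights:
  "(\<Sum>T\<in>TT. \<Sum>j<L. (real (card {x \<in> lay. set (T j) \<subseteq> x}))\<^sup>2)
    \<le> real (card TT) * (real L * (real (k - h) / real m) ^ k * (real (card lay))\<^sup>2 + real (card lay) * real near_bound)"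
proof -
  have m0: "real m > 0" using k_less by simp
  have sq: "(card {x \<in> lay. set (T j) \<subseteq> x})\<^sup>2 = card {p \<in> lay \<times> lay. set (T j) \<subseteq> fst p \<inter> snd p}"
    for T :: "nat \<Rightarrow> nat list" and j
  proof -
    have "{p \<in> lay \<times> lay. set (T j) \<subseteq> fst p \<inter> snd p} = {x \<in> lay. set (T j) \<subseteq> x} \<times> {x \<in> lay. set (T j) \<subseteq> x}"
      by auto
    then show ?thesis by (simp only: card_cartesian_product power2_eq_square)
  qed
  have cnt: "real (card {T \<in> TT. set (T j) \<subseteq> C}) = (real (card C) / real m) ^ k * real (card TT)"
    if "j < L" "C \<subseteq> {..<m}" for j C
  proof -
    have "{T \<in> TT. set (T j) \<subseteq> C} =
      {T \<in> {..<L} \<rightarrow>\<^sub>E terms. T j \<in> {t \<in> terms. set t \<subseteq> C} \<and> (\<forall>l\<in>{..<L} - {j}. T l \<in> terms)}"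
      unfolding TT_def using that by (auto simp: PiE_iff)
    then have "card {T \<in> TT. set (T j) \<subseteq> C} = card {t \<in> terms. set t \<subseteq> C} * card terms ^ (L - 1)"
      using card_PiE_one_other[of "{..<L}" j "{t \<in> terms. set t \<subseteq> C}" terms terms] that by simp
    also have "card {t \<in> terms. set t \<subseteq> C} = card C ^ k"
      using card_terms_within[OF finite_lessThan that(2), of k] unfolding terms_def by simp
    finally have "real (card {T \<in> TT. set (T j) \<subseteq> C}) = real (card C) ^ k * real (m ^ k) ^ (L - 1)"
      by (simp add: card_terms)
    moreover have "real (card TT) = real (m ^ k) * real (m ^ k) ^ (L - 1)"
      using that by (simp add: card_TT power_eq_if[of _ L])
    ultimately show ?thesis using m0 by (simp add: power_divide)
  qed
  have pair: "real L * (real (card (x \<inter> y)) / real m) ^ k \<le>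
      real L * (real (k - h) / real m) ^ k + (if card (sym_diff x y) \<le> d then 1 else 0)"
    if "x \<in> lay" "y \<in> lay" for x y
  proof -
    have xy: "finite x" "finite y" "card x = k" "card y = k"
      using that unfolding lay_def by (auto intro: finite_subset)
    show ?thesis
    proof (cases "card (sym_diff x y) \<le> d")
      case True
      have "card (x \<inter> y) \<le> k" using xy by (metis card_mono inf_le1)
      then have "real L * (real (card (x \<inter> y)) / real m) ^ k \<le> real L * (real k / real m) ^ k"
        by (intro mult_left_mono power_mono divide_right_mono) auto
      moreover have "0 \<le> real L * (real (k - h) / real m) ^ k" by simp
      ultimately show ?thesis using L_upper True by (simp only: if_True)
    next
      case False
      then have "card (x \<inter> y) \<le> k - h" using card_sym_diff[OF xy(1,2)] xy d_eq by linarith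
      then have "real L * (real (card (x \<inter> y)) / real m) ^ k \<le> real L * (real (k - h) / real m) ^ k"
        by (intro mult_left_mono power_mono divide_right_mono) auto
      then show ?thesis using False by simp
    qed
  qed
  have "(\<Sum>T\<in>TT. \<Sum>j<L. (card {x \<in> lay. set (T j) \<subseteq> x})\<^sup>2)
      = (\<Sum>j<L. \<Sum>T\<in>TT. card {p \<in> lay \<times> lay. set (T j) \<subseteq> fst p \<inter> snd p})"
    unfolding sq by (rule sum.swap)
  also have "\<dots> = (\<Sum>j<L. \<Sum>p\<in>lay \<times> lay. card {T \<in> TT. set (T j) \<subseteq> fst p \<inter> snd p})"
    by (intro sum.cong refl sum_card_swap finite_TT finite_cartesian_product finite_lay)
  finally have "real (\<Sum>T\<in>TT. \<Sum>j<L. (card {x \<in> lay. set (T j) \<subseteq> x})\<^sup>2)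
      = (\<Sum>j<L. \<Sum>p\<in>lay \<times> lay. real (card {T \<in> TT. set (T j) \<subseteq> fst p \<inter> snd p}))" by simp
  also have "\<dots> = (\<Sum>j<L. \<Sum>p\<in>lay \<times> lay. (real (card (fst p \<inter> snd p)) / real m) ^ k * real (card TT))"
    by (intro sum.cong refl cnt) (auto simp: lay_def)
  also have "\<dots> = (\<Sum>p\<in>lay \<times> lay. real L * (real (card (fst p \<inter> snd p)) / real m) ^ k) * real (card TT)"
    by (simp add: sum_distrib_left sum_distrib_right mult.assoc)
  also have "\<dots> \<le> (\<Sum>p\<in>lay \<times> lay. real L * (real (k - h) / real m) ^ k +
      (if card (sym_diff (fst p) (snd p)) \<le> d then 1 else 0)) * real (card TT)"
    by (intro mult_right_mono sum_mono pair) auto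
  also have "(\<Sum>p\<in>lay \<times> lay. real L * (real (k - h) / real m) ^ k +
      (if card (sym_diff (fst p) (snd p)) \<le> d then 1 else 0)) \<le>
      real L * (real (k - h) / real m) ^ k * (real (card lay))\<^sup>2 + real (card lay) * real near_bound"
  proof -
    have "(\<Sum>p\<in>lay \<times> lay. if card (sym_diff (fst p) (snd p)) \<le> d then 1 else 0 :: real)
        = (\<Sum>x\<in>lay. \<Sum>y\<in>lay. if card (sym_diff x y) \<le> d then 1 else 0)"
      by (simp add: sum.cartesian_product case_prod_unfold)
    also have "\<dots> = (\<Sum>x\<in>lay. real (card {y \<in> lay. card (sym_diff x y) \<le> d}))"
      by (simp only: sum.inter_filter[OF finite_lay, symmetric]) simp
    also have "\<dots> \<le> (\<Sum>x\<in>lay. real near_bound)"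
    proof (intro sum_mono of_nat_mono)
      fix x assume "x \<in> lay"
      then have "x \<subseteq> {..<m}" unfolding lay_def by auto
      have "card {y \<in> lay. card (sym_diff x y) \<le> d} \<le> card {B. B \<subseteq> {..<m} \<and> card (sym_diff x B) \<le> d}"
        by (intro card_mono) (auto simp: lay_def)
      also have "\<dots> \<le> near_bound" by (rule card_near) fact
      finally show "card {y \<in> lay. card (sym_diff x y) \<le> d} \<le> near_bound" .
    qed
    finally show ?thesis by (simp add: sum.distrib card_cartesian_product power2_eq_square)
  qed
  finally have "real (\<Sum>T\<in>TT. \<Sum>j<L. (card {x \<in> lay. set (T j) \<subseteq> x})\<^sup>2) \<le>
      (real L * (real (k - h) / real m) ^ k * (real (card lay))\<^sup>2 + real (card lay) * real near_bound) * real (card TT)"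
    by (simp add: mult_right_mono)
  then show ?thesis by (simp add: mult.commute)
qed

text \<open>Chebyshev over \<open>e\<close>, with the terms fixed: the number of drops is a sum of
  independent contributions, one per part, each at most the weight of its term. Its mean is at least
  \<open>card lay / 288\<close> on \<open>rich\<close>, so falling below half of that is a deviation
  of \<open>card lay / 576\<close>. The variance is then averaged over the terms.\<close>

lemma few_drops:
  "(\<Sum>T\<in>rich. real (card {e \<in> EE. real (card (drops T e)) < real (card lay) / 576}))
    \<le> 576\<^sup>2 * real (card TT) * real (card EE) *
      (real L * (real (k - h) / real m) ^ k + real near_bound / real (card lay))"
proof -
  let ?\<psi> = "real (card lay)"
  let ?w = "\<lambda>T j. real (card {x \<in> lay. set (T j) \<subseteq> x})"
  let ?y = "\<lambda>T j i. real (card {x \<in> lay. good T j i x})"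
  have \<psi>0: "?\<psi> > 0" using card_lay_pos by simp
  have m0: "real m > 0" using k_less by simp
  have sub: "rich \<subseteq> TT" unfolding rich_def by auto
  have each: "(?\<psi> / 576)\<^sup>2 * real (card {e \<in> EE. real (card (drops T e)) < ?\<psi> / 576})
      \<le> real (card EE) * (\<Sum>j<L. (?w T j)\<^sup>2)" if T: "T \<in> rich" for T
  proof -
    have "(?\<psi> / 576)\<^sup>2 * real (card {e \<in> EE. real (card (drops T e)) < ?\<psi> / 576})
        = (\<Sum>e\<in>{e \<in> EE. real (card (drops T e)) < ?\<psi> / 576}. (?\<psi> / 576)\<^sup>2)" by simp
    also have "\<dots> \<le> (\<Sum>e\<in>{e \<in> EE. real (card (drops T e)) < ?\<psi> / 576}. (real (card (drops T e)) - mean T)\<^sup>2)"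
    proof (rule sum_mono)
      fix e assume e: "e \<in> {e \<in> EE. real (card (drops T e)) < ?\<psi> / 576}"
      have "?\<psi> / 288 \<le> mean T" using T unfolding rich_def by simp
      then have "?\<psi> / 576 \<le> mean T - real (card (drops T e))" using e by simp
      then have "(?\<psi> / 576)\<^sup>2 \<le> (mean T - real (card (drops T e)))\<^sup>2"
        by (intro power_mono) auto
      then show "(?\<psi> / 576)\<^sup>2 \<le> (real (card (drops T e)) - mean T)\<^sup>2"
        by (simp add: power2_commute)
    qed
    also have "\<dots> \<le> (\<Sum>e\<in>EE. (real (card (drops T e)) - mean T)\<^sup>2)"
      using finite_EE by (intro sum_mono2) auto
    also have "\<dots> \<le> real (card EE) * (\<Sum>j<L. (\<Sum>i<m. (?y T j i)\<^sup>2) / real m)"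
      using product_variance[of "{..<L}" "{..<m}" "?y T"] k_less lessThan_empty_iff[of m]
      unfolding EE_def mean_def card_drops by simp
    also have "\<dots> \<le> real (card EE) * (\<Sum>j<L. (?w T j)\<^sup>2)"
    proof (rule mult_left_mono, rule sum_mono)
      fix j
      have "(\<Sum>i<m. (?y T j i)\<^sup>2) \<le> (\<Sum>i<m. (?w T j)\<^sup>2)"
        using finite_lay by (intro sum_mono power_mono of_nat_mono card_mono) (auto simp: good_def)
      then show "(\<Sum>i<m. (?y T j i)\<^sup>2) / real m \<le> (?w T j)\<^sup>2"
        using m0 by (simp add: field_simps)
    qed auto
    finally show ?thesis .
  qed
  let ?N = "\<Sum>T\<in>rich. real (card {e \<in> EE. real (card (drops T e)) < ?\<psi> / 576})"
  have "(?\<psi> / 576)\<^sup>2 * ?N \<le> (\<Sum>T\<in>rich. real (card EE) * (\<Sum>j<L. (?w T j)\<^sup>2))"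
    by (subst sum_distrib_left) (rule sum_mono, rule each)
  also have "\<dots> \<le> (\<Sum>T\<in>TT. real (card EE) * (\<Sum>j<L. (?w T j)\<^sup>2))"
    using finite_TT sub by (intro sum_mono2) (auto intro!: mult_nonneg_nonneg sum_nonneg)
  also have "\<dots> = real (card EE) * (\<Sum>T\<in>TT. \<Sum>j<L. (?w T j)\<^sup>2)" by (simp add: sum_distrib_left)
  also have "\<dots> \<le> real (card EE) * (real (card TT) *
      (real L * (real (k - h) / real m) ^ k * ?\<psi>\<^sup>2 + ?\<psi> * real near_bound))"
    by (intro mult_left_mono sum_square_weights) auto
  also have "\<dots> = (?\<psi> / 576)\<^sup>2 * (576\<^sup>2 * real (card TT) * real (card EE) *
      (real L * (real (k - h) / real m) ^ k + real near_bound / ?\<psi>))"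
    using \<psi>0 by (simp add: field_simps power2_eq_square)
  finally show ?thesis using \<psi>0 by simp
qed

end

section \<open>Rejection sampling\<close>

text \<open>The strategy is run on candidate points labelled with their values, a candidate with value
  \<open>False\<close> being discarded. Rounds of more than \<open>q\<close> queries are cut off, so that the number of
  queries is bounded also for labels that no admissible function produces.\<close>

fun leaf :: "nat \<Rightarrow> strategy \<Rightarrow> (bool list \<times> bool) list \<Rightarrow> bool list list \<times> (bool list \<Rightarrow> bool)" where
  "leaf q (Query xs D) us = (if length xs \<le> q then (xs, D) else ([], \<lambda>_. False))"
| "leaf q (Sample s) [] = ([], \<lambda>_. False)"
| "leaf q (Sample s) ((u, b) # us) = leaf q (if b then s u else Sample s) us"

definition accepts :: "nat \<Rightarrow> (bool list \<Rightarrow> bool) \<Rightarrow> strategy \<Rightarrow> bool list list \<Rightarrow> bool" where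
  "accepts q f \<sigma> us =
     (let l = leaf q \<sigma> (zip us (map f us)) in snd l (map f (fst l)))"

lemma length_leaf: "length (fst (leaf q \<sigma> us)) \<le> q"
  by (induction q \<sigma> us rule: leaf.induct) auto

lemma prob_bind_pmf:
  "measure_pmf.prob (bind_pmf M f) A = measure_pmf.expectation M (\<lambda>x. measure_pmf.prob (f x) A)"
  unfolding measure_pmf_bind
  by (rule measure_pmf.measure_bind[where N = "count_space UNIV"])
    (auto simp: measure_pmf_in_subprob_algebra)

definition strategy_accept :: "nat \<Rightarrow> (bool list \<Rightarrow> bool) \<Rightarrow> strategy \<Rightarrow> real" where
  "strategy_accept n f \<sigma> = measure_pmf.prob (run_strategy n f \<sigma>) {(b, t). b}"

lemma strategy_accept_Query: "strategy_accept n f (Query xs D) = (if D (map f xs) then 1 else 0)"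
  by (simp add: strategy_accept_def indicator_def)

lemma strategy_accept_Sample:
  assumes "finite (ones n f)" "ones n f \<noteq> {}"
  shows "strategy_accept n f (Sample s) = (\<Sum>u\<in>ones n f. strategy_accept n f (s u)) / real (card (ones n f))"
proof -
  have "measure_pmf.prob (map_pmf (\<lambda>(b, t). (b, Suc t)) M) {(b, t). b} = measure_pmf.prob M {(b, t). b}"
    for M :: "(bool \<times> nat) pmf"
    by (simp add: vimage_def case_prod_unfold)
  then show ?thesis
    using assms by (simp add: strategy_accept_def prob_bind_pmf integral_pmf_of_set)
qed

lemma card_lists_Suc:
  assumes "finite \<Omega>"
  shows "card {us. set us \<subseteq> \<Omega> \<and> length us = Suc r \<and> P us}
    = (\<Sum>u\<in>\<Omega>. card {us. set us \<subseteq> \<Omega> \<and> length us = r \<and> P (u # us)})"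
proof -
  have fin: "finite {us. set us \<subseteq> \<Omega> \<and> length us = r \<and> P (u # us)}" for u
    by (rule finite_subset[OF _ finite_lists_length_eq[OF assms, of r]]) auto
  have "{us. set us \<subseteq> \<Omega> \<and> length us = Suc r \<and> P us}
      = (\<Union>u\<in>\<Omega>. (#) u ` {us. set us \<subseteq> \<Omega> \<and> length us = r \<and> P (u # us)})"
    by (auto simp: length_Suc_conv)
  then have "card {us. set us \<subseteq> \<Omega> \<and> length us = Suc r \<and> P us}
      = (\<Sum>u\<in>\<Omega>. card ((#) u ` {us. set us \<subseteq> \<Omega> \<and> length us = r \<and> P (u # us)}))"
    using assms fin by (simp only:) (intro card_UN_disjoint; auto)
  then show ?thesis by (simp add: card_image)
qed

definition sim_accept :: "bool list set \<Rightarrow> nat \<Rightarrow> nat \<Rightarrow> (bool list \<Rightarrow> bool) \<Rightarrow> strategy \<Rightarrow> real" where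
  "sim_accept \<Omega> r q f \<sigma> =
     real (card {us. set us \<subseteq> \<Omega> \<and> length us = r \<and> accepts q f \<sigma> us}) / real (card \<Omega>) ^ r"

lemma sim_accept_Query:
  assumes "finite \<Omega>" "\<Omega> \<noteq> {}" "length xs \<le> q"
  shows "sim_accept \<Omega> r q f (Query xs D) = (if D (map f xs) then 1 else 0)"
  using assms by (simp add: sim_accept_def accepts_def card_lists_length_eq card_gt_0_iff)

lemma sim_accept_Sample:
  assumes "finite \<Omega>"
  shows "sim_accept \<Omega> (Suc r) q f (Sample s) =
    (\<Sum>u\<in>\<Omega>. sim_accept \<Omega> r q f (if f u then s u else Sample s)) / real (card \<Omega>)"
  unfolding sim_accept_def card_lists_Suc[OF assms]
  by (simp add: accepts_def sum_divide_distrib mult.commute)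

text \<open>The error term comes from the potential \<open>2 ^ p\<close>: it halves when a draw is accepted, which
  has probability at least one half, so each draw costs a factor of at most \<open>3/4\<close> on average.\<close>

lemma rejection_sampling:
  assumes fin: "finite \<Omega>" and ne: "\<Omega> \<noteq> {}" and cube: "\<Omega> \<subseteq> cube n"
    and sub: "ones n f \<subseteq> \<Omega>" and half: "card \<Omega> \<le> 2 * card (ones n f)"
    and calls: "\<forall>(b, t)\<in>set_pmf (run_strategy n f \<sigma>). t \<le> p" and p: "p \<le> q"
  shows "sim_accept \<Omega> r q f \<sigma> \<le> strategy_accept n f \<sigma> \<and>
    strategy_accept n f \<sigma> \<le> sim_accept \<Omega> r q f \<sigma> + 2 ^ p * (3/4) ^ r"
  using calls p
proof (induction r arbitrary: \<sigma> p)
  case 0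
  show ?case
  proof (cases \<sigma>)
    case (Query xs D)
    then have "length xs \<le> q" using 0 by auto
    then show ?thesis
      unfolding Query strategy_accept_Query sim_accept_Query[OF fin ne \<open>length xs \<le> q\<close>] by simp
  next
    case (Sample s)
    \<comment> \<open>When the candidates run out while a sample is still requested, the simulation
      rejects. It can therefore only lose acceptance probability, and the loss is at most 1, hence
      at most the potential.\<close>
    have "strategy_accept n f \<sigma> \<le> 1" "0 \<le> strategy_accept n f \<sigma>"
      unfolding strategy_accept_def by simp_all
    moreover have "sim_accept \<Omega> 0 q f \<sigma> = 0"
      unfolding sim_accept_def Sample accepts_def by (simp cong: conj_cong)
    moreover have "(1::real) \<le> 2 ^ p" by simp
    ultimately have "strategy_accept n f \<sigma> \<le> 2 ^ p" by linarith
    then show ?thesis using \<open>0 \<le> strategy_accept n f \<sigma>\<close> \<open>sim_accept \<Omega> 0 q f \<sigma> = 0\<close> by simp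
  qed
next
  case (Suc r)
  show ?case
  proof (cases \<sigma>)
    case (Query xs D)
    then have "length xs \<le> q" using Suc.prems by auto
    then show ?thesis
      unfolding Query strategy_accept_Query sim_accept_Query[OF fin ne \<open>length xs \<le> q\<close>] by simp
  next
    case (Sample s)
    let ?O = "ones n f"
    have finO: "finite ?O" using fin sub finite_subset by auto
    have cO: "card ?O > 0" using half fin ne by (metis card_gt_0_iff mult_0_right not_gr_zero not_le)
    then have neO: "?O \<noteq> {}" by auto
    have c\<Omega>: "real (card \<Omega>) > 0" using fin ne by (simp add: card_gt_0_iff)
    have fO: "f u \<longleftrightarrow> u \<in> ?O" if "u \<in> \<Omega>" for u using that cube unfolding ones_def by auto
    have setS: "set_pmf (run_strategy n f \<sigma>) =
        (\<Union>u\<in>?O. (\<lambda>(b, t). (b, Suc t)) ` set_pmf (run_strategy n f (s u)))"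
      unfolding Sample using finO neO by (simp add: set_pmf_of_set)
    \<comment> \<open>Some run makes this sample call, so the call bound \<open>p\<close> is
      positive and can drop by one after an accepted draw.\<close>
    obtain u0 where u0: "u0 \<in> ?O" using neO by auto
    obtain b0 t0 where "(b0, t0) \<in> set_pmf (run_strategy n f (s u0))"
      by (metis ex_in_conv set_pmf_not_empty surj_pair)
    then have "(b0, Suc t0) \<in> set_pmf (run_strategy n f \<sigma>)" unfolding setS using u0 by force
    then have "Suc t0 \<le> p" using Suc.prems by auto
    then obtain p' where p': "p = Suc p'" by (cases p) auto
    have IH: "sim_accept \<Omega> r q f (s u) \<le> strategy_accept n f (s u) \<and>
      strategy_accept n f (s u) \<le> sim_accept \<Omega> r q f (s u) + 2 ^ p' * (3/4) ^ r" if u: "u \<in> ?O" for u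
    proof (rule Suc.IH)
      show "\<forall>(b, t)\<in>set_pmf (run_strategy n f (s u)). t \<le> p'"
        using Suc.prems(1) u unfolding setS p' by force
      show "p' \<le> q" using Suc.prems p' by simp
    qed
    have IH0: "sim_accept \<Omega> r q f \<sigma> \<le> strategy_accept n f \<sigma> \<and>
      strategy_accept n f \<sigma> \<le> sim_accept \<Omega> r q f \<sigma> + 2 ^ p * (3/4) ^ r"
      by (rule Suc.IH[OF Suc.prems])
    define a where "a = strategy_accept n f \<sigma>"
    define b where "b = real (card ?O)"
    define w where "w = real (card \<Omega>)"
    have bw: "0 < b" "b \<le> w" "w \<le> 2 * b" "0 < w"
      using cO half card_mono[OF fin sub] c\<Omega> unfolding b_def w_def by auto
    have diff: "real (card (\<Omega> - ?O)) = w - b"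
      unfolding b_def w_def using card_mono[OF fin sub] by (simp add: card_Diff_subset[OF finO sub] of_nat_diff)
    have a: "(\<Sum>u\<in>?O. strategy_accept n f (s u)) = b * a"
      unfolding a_def b_def Sample strategy_accept_Sample[OF finO neO] using cO by simp
    have sim: "sim_accept \<Omega> (Suc r) q f \<sigma> * w = (\<Sum>u\<in>?O. sim_accept \<Omega> r q f (s u)) + (w - b) * sim_accept \<Omega> r q f \<sigma>"
    proof -
      have "sim_accept \<Omega> (Suc r) q f \<sigma> * w = (\<Sum>u\<in>\<Omega>. sim_accept \<Omega> r q f (if f u then s u else \<sigma>))"
        unfolding Sample sim_accept_Sample[OF fin] w_def using c\<Omega> by simp
      also have "\<dots> = (\<Sum>u\<in>\<Omega> - ?O. sim_accept \<Omega> r q f (if f u then s u else \<sigma>)) +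
          (\<Sum>u\<in>?O. sim_accept \<Omega> r q f (if f u then s u else \<sigma>))"
        by (rule sum.subset_diff[OF sub fin])
      also have "(\<Sum>u\<in>\<Omega> - ?O. sim_accept \<Omega> r q f (if f u then s u else \<sigma>)) = (\<Sum>u\<in>\<Omega> - ?O. sim_accept \<Omega> r q f \<sigma>)"
        by (intro sum.cong) (auto simp: fO)
      also have "(\<Sum>u\<in>?O. sim_accept \<Omega> r q f (if f u then s u else \<sigma>)) = (\<Sum>u\<in>?O. sim_accept \<Omega> r q f (s u))"
        using sub fO by (intro sum.cong) auto
      finally show ?thesis using diff by simp
    qed
    have lo: "(\<Sum>u\<in>?O. sim_accept \<Omega> r q f (s u)) \<le> b * a"
      unfolding a[symmetric] using IH by (intro sum_mono) auto
    have "b * a \<le> (\<Sum>u\<in>?O. sim_accept \<Omega> r q f (s u) + 2 ^ p' * (3/4) ^ r)"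
      unfolding a[symmetric] using IH by (intro sum_mono) auto
    then have hi: "b * a \<le> (\<Sum>u\<in>?O. sim_accept \<Omega> r q f (s u)) + b * (2 ^ p' * (3/4) ^ r)"
      by (simp add: sum.distrib b_def)
    have "sim_accept \<Omega> (Suc r) q f \<sigma> * w \<le> b * a + (w - b) * a"
      unfolding sim using lo IH0 bw by (intro add_mono mult_left_mono) (auto simp: a_def)
    then have 1: "sim_accept \<Omega> (Suc r) q f \<sigma> \<le> a" using bw by (simp add: algebra_simps)
    have "(w - b) * a \<le> (w - b) * (sim_accept \<Omega> r q f \<sigma> + 2 ^ p * (3/4) ^ r)"
      using IH0 bw by (intro mult_left_mono) (auto simp: a_def)
    with hi have "b * a + (w - b) * a \<le> sim_accept \<Omega> (Suc r) q f \<sigma> * w +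
        (b * (2 ^ p' * (3/4) ^ r) + (w - b) * (2 ^ p * (3/4) ^ r))"
      unfolding sim by (simp add: algebra_simps)
    also have "b * (2 ^ p' * (3/4) ^ r) + (w - b) * (2 ^ p * (3/4) ^ r) = (w - b / 2) * (2 ^ p * (3/4) ^ r)"
      unfolding p' by (simp add: algebra_simps)
    also have "\<dots> \<le> (w * (3/4)) * (2 ^ p * (3/4) ^ r)"
      using bw by (intro mult_right_mono) auto
    finally have "a * w \<le> (sim_accept \<Omega> (Suc r) q f \<sigma> + 2 ^ p * (3/4) ^ Suc r) * w"
      by (simp add: algebra_simps)
    then have "a \<le> sim_accept \<Omega> (Suc r) q f \<sigma> + 2 ^ p * (3/4) ^ Suc r" using bw by simp
    with 1 show ?thesis unfolding a_def by simp
  qed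
qed

section \<open>The hard functions\<close>

definition supp :: "bool list \<Rightarrow> nat set" where
  "supp x = {i. i < length x \<and> x ! i}"

definition ind :: "nat \<Rightarrow> nat set \<Rightarrow> bool list" where
  "ind n S = map (\<lambda>i. i \<in> S) [0..<n]"

lemma length_ind: "length (ind n S) = n" by (simp add: ind_def)

lemma ind_cube: "ind n S \<in> cube n" by (simp add: cube_def length_ind)

lemma supp_ind: "S \<subseteq> {..<n} \<Longrightarrow> supp (ind n S) = S"
  unfolding supp_def ind_def by auto

lemma ind_supp: "x \<in> cube n \<Longrightarrow> ind n (supp x) = x"
  unfolding cube_def ind_def supp_def by (intro nth_equalityI) auto

lemma finite_supp: "finite (supp x)" unfolding supp_def by auto

lemma inj_on_supp: "inj_on supp (cube n)"
  by (metis inj_onI ind_supp)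

lemma inj_on_ind: "inj_on (ind n) (Pow {..<n})"
  by (metis PowD inj_onI supp_ind)

lemma supp_update_True: "i < length x \<Longrightarrow> supp (x[i := True]) = insert i (supp x)"
  unfolding supp_def by (auto simp: nth_list_update)

lemma supp_update_False: "i < length x \<Longrightarrow> supp (x[i := False]) = supp x - {i}"
  unfolding supp_def by (auto simp: nth_list_update split: if_splits)

lemma nondecreasing_insert:
  assumes "nondecreasing_in n i g" "i < n" "S \<subseteq> {..<n}" "i \<notin> S" "g (ind n S)"
  shows "g (ind n (insert i S))"
proof -
  have len: "i < length (ind n S)" using assms by (simp add: length_ind)
  have "g ((ind n S)[i := False]) \<longrightarrow> g ((ind n S)[i := True])"
    using assms(1) ind_cube[of n S] unfolding nondecreasing_in_def by (auto simp: le_bool_def)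
  moreover have "(ind n S)[i := False] = ind n S"
    using assms supp_update_False[OF len] supp_ind[OF assms(3)] ind_supp[of "(ind n S)[i := False]" n]
    by (simp add: cube_def length_ind)
  moreover have "(ind n S)[i := True] = ind n (insert i S)"
    using assms supp_update_True[OF len] supp_ind[OF assms(3)] ind_supp[of "(ind n S)[i := True]" n]
    by (simp add: cube_def length_ind)
  ultimately show ?thesis using assms(5) by simp
qed

lemma nonincreasing_insert:
  assumes "nonincreasing_in n i g" "i < n" "S \<subseteq> {..<n}" "i \<notin> S" "g (ind n (insert i S))"
  shows "g (ind n S)"
proof -
  have len: "i < length (ind n S)" using assms by (simp add: length_ind)
  have "g ((ind n S)[i := True]) \<longrightarrow> g ((ind n S)[i := False])"
    using assms(1) ind_cube[of n S] unfolding nonincreasing_in_def by (auto simp: le_bool_def)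
  moreover have "(ind n S)[i := False] = ind n S"
    using assms supp_update_False[OF len] supp_ind[OF assms(3)] ind_supp[of "(ind n S)[i := False]" n]
    by (simp add: cube_def length_ind)
  moreover have "(ind n S)[i := True] = ind n (insert i S)"
    using assms supp_update_True[OF len] supp_ind[OF assms(3)] ind_supp[of "(ind n S)[i := True]" n]
    by (simp add: cube_def length_ind)
  ultimately show ?thesis using assms(5) by simp
qed

text \<open>The hard structure lives on the coordinates below m. Coordinate m selects between the
  hard half and a threshold half, and every satisfying assignment is zero above m, which keeps their
  number independent of n.\<close>

locale hard_instance = dense_term_family +
  fixes n :: nat
  assumes m_less: "m < n"
begin

definition active :: "bool list \<Rightarrow> bool" where
  "active x \<longleftrightarrow> length x = n \<and> supp x \<in> mid"

text \<open>Where coordinate \<open>m\<close> is set, the function is a plain threshold. This half alone contains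
  at least half of the satisfying assignments, and its boundary has increasing edges in every
  direction below \<open>m\<close>, so that a unate function decreasing in such a direction is far.\<close>

definition base :: "bool list \<Rightarrow> bool" where
  "base x = (if length x = n then supp x \<subseteq> {..m} \<and>
     (if m \<in> supp x then k + 1 \<le> card (supp x) else k + 2 \<le> card (supp x)) else undefined)"

sublocale query_view m k L d supp active base h
  by unfold_locales (auto simp: active_def d_eq)

definition set_fun :: "(nat \<Rightarrow> nat set \<Rightarrow> bool) \<Rightarrow> (nat \<Rightarrow> nat list) \<Rightarrow> nat set \<Rightarrow> bool" where
  "set_fun b T S \<longleftrightarrow> S \<subseteq> {..m} \<and>
     (if m \<in> S then k + 1 \<le> card S else k + 2 \<le> card S \<or> k \<le> card S \<and> val {..<L} b T S)"

abbreviation func :: "(nat \<Rightarrow> nat set \<Rightarrow> bool) \<Rightarrow> (nat \<Rightarrow> nat list) \<Rightarrow> bool list \<Rightarrow> bool" where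
  "func b T \<equiv> fl {..<L} b T"

text \<open>The pool of candidate points for rejection sampling. It does not depend on terms or
  parts, contains every satisfying assignment, and is at most twice as large as the set of
  them.\<close>

definition region :: "bool list set" where
  "region = {x \<in> cube n. supp x \<subseteq> {..m} \<and> k \<le> card (supp x - {m})}"

definition upper :: "nat set set" where
  "upper = {S. S \<subseteq> {..<m} \<and> k \<le> card S}"

section \<open>Size and unateness of the hard functions\<close>

lemma func_eq: "x \<in> cube n \<Longrightarrow> func b T x = set_fun b T (supp x)"
proof -
  assume "x \<in> cube n"
  then have len: "length x = n" by (simp add: cube_def)
  show ?thesis
  proof (cases "supp x \<subseteq> {..m} \<and> m \<notin> supp x")
    case True
    then have sub: "supp x \<subseteq> {..<m}" by (auto simp: le_less)
    have "k + 2 \<le> card (supp x) \<or> card (supp x) < k" if "supp x \<notin> mid"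
      using that sub unfolding mid_def by auto
    then show ?thesis using True len sub
      unfolding fl_def active_def base_def set_fun_def mid_def by auto
  next
    case False
    then have "\<not> active x" unfolding active_def mid_def by auto
    then show ?thesis using False len unfolding fl_def base_def set_fun_def by auto
  qed
qed

lemma func_ind: "S \<subseteq> {..<n} \<Longrightarrow> func b T (ind n S) = set_fun b T S"
  using func_eq[OF ind_cube] supp_ind by simp

lemma func_bool_funs: "func b T \<in> bool_funs n"
proof -
  have "func b T x = undefined" if "length x \<noteq> n" for x
  proof -
    have "\<not> active x" using that by (simp add: active_def)
    then show ?thesis using that by (simp add: fl_def base_def)
  qed
  then show ?thesis unfolding bool_funs_def cube_def by (auto simp: PiE_iff extensional_def)
qed

lemma finite_region: "finite region"
  unfolding region_def using finite_cube by auto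

lemma finite_upper: "finite upper" unfolding upper_def by auto

lemma lay_upper: "lay \<subseteq> upper" unfolding lay_def upper_def by auto

lemma upper_pos: "card upper > 0"
  using card_mono[OF finite_upper lay_upper] card_lay_pos by simp

lemma card_ind_image: "B \<subseteq> Pow {..<n} \<Longrightarrow> card (ind n ` B) = card B"
  using inj_on_ind by (intro card_image) (rule inj_on_subset)

lemma upper_insert: "card (insert m ` upper) = card upper"
  by (rule card_image) (auto simp: inj_on_def upper_def)

lemma region_eq: "region = ind n ` (upper \<union> insert m ` upper)"
proof
  show "ind n ` (upper \<union> insert m ` upper) \<subseteq> region"
  proof
    fix x assume "x \<in> ind n ` (upper \<union> insert m ` upper)"
    then obtain S where S: "S \<in> upper" "x = ind n S \<or> x = ind n (insert m S)" by auto
    have "S \<subseteq> {..<m}" "k \<le> card S" using S unfolding upper_def by auto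
    moreover from this m_less have "S \<subseteq> {..<n}" "insert m S \<subseteq> {..<n}" by auto
    moreover have "m \<notin> S" using calculation by auto
    ultimately show "x \<in> region" using S ind_cube unfolding region_def by (auto simp: supp_ind)
  qed
  show "region \<subseteq> ind n ` (upper \<union> insert m ` upper)"
  proof
    fix x assume x: "x \<in> region"
    then have "supp x \<subseteq> {..m}" "k \<le> card (supp x - {m})" unfolding region_def by blast+
    then have "supp x - {m} \<in> upper" unfolding upper_def by (force simp: le_less)
    then have "supp x \<in> upper \<union> insert m ` upper"
    proof (cases "m \<in> supp x")
      case True
      then have "supp x = insert m (supp x - {m})" by blast
      then show ?thesis using \<open>supp x - {m} \<in> upper\<close> by blast
    qed simp
    then show "x \<in> ind n ` (upper \<union> insert m ` upper)"
      using x ind_supp unfolding region_def by (metis (no_types, lifting) image_eqI mem_Collect_eq)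
  qed
qed

lemma upper_Pow: "upper \<subseteq> Pow {..<n}" "insert m ` upper \<subseteq> Pow {..<n}"
  using m_less unfolding upper_def by auto

lemma card_region: "card region = 2 * card upper"
proof -
  have "card region = card (upper \<union> insert m ` upper)"
    unfolding region_eq by (rule card_ind_image) (use upper_Pow in auto)
  also have "\<dots> = card upper + card (insert m ` upper)"
    using finite_upper by (intro card_Un_disjoint) (auto simp: upper_def)
  finally show ?thesis by (simp add: upper_insert)
qed

lemma ones_region: "ones n (func b T) \<subseteq> region"
proof
  fix x assume "x \<in> ones n (func b T)"
  then have x: "x \<in> cube n" "set_fun b T (supp x)" unfolding ones_def using func_eq by auto
  then show "x \<in> region"
    unfolding region_def set_fun_def using finite_supp[of x] by (auto split: if_splits)
qed

lemma ones_lower: "card upper \<le> card (ones n (func b T))"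
proof -
  have "ind n ` insert m ` upper \<subseteq> ones n (func b T)"
  proof
    fix x assume "x \<in> ind n ` insert m ` upper"
    then obtain S where S: "S \<in> upper" "x = ind n (insert m S)" by auto
    have "insert m S \<subseteq> {..<n}" using S upper_Pow by auto
    moreover have "set_fun b T (insert m S)"
      using S unfolding set_fun_def upper_def
      by (auto simp: card_insert_if finite_subset[of S "{..<m}"] dest: subsetD)
    ultimately show "x \<in> ones n (func b T)"
      unfolding ones_def using S func_ind ind_cube by auto
  qed
  moreover have "finite (ones n (func b T))" unfolding ones_def using finite_cube by auto
  ultimately have "card (ind n ` insert m ` upper) \<le> card (ones n (func b T))" by (intro card_mono)
  moreover have "card (ind n ` insert m ` upper) = card upper"
    unfolding card_ind_image[OF upper_Pow(2)] by (rule upper_insert)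
  ultimately show ?thesis by simp
qed

lemma ones_upper: "card (ones n (func b T)) \<le> 2 * card upper"
  using card_mono[OF finite_region ones_region] card_region by simp

text \<open>Enlarging a set can only add satisfied terms. A unique term either stays unique, and its
  constant keeps its value, or is joined by another, and then the value is true.\<close>

lemma set_fun_yes_mono:
  assumes "S \<subseteq> S'" "S' \<subseteq> {..m}" "set_fun (yes e) T S"
  shows "set_fun (yes e) T S'"
proof -
  have fin: "finite S'" using assms(2) finite_subset by blast
  then have fin2: "finite S" using assms(1) finite_subset by blast
  have card: "card S \<le> card S'" using assms fin by (intro card_mono)
  consider "m \<in> S" | "m \<notin> S" "m \<in> S'" | "m \<notin> S'" "k + 2 \<le> card S" | "m \<notin> S'" "k \<le> card S" "val {..<L} (yes e) T S"
    using assms unfolding set_fun_def by (auto split: if_splits)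
  then show ?thesis
  proof cases
    case 1
    then show ?thesis using assms card unfolding set_fun_def by auto
  next
    case 2
    \<comment> \<open>In the threshold half the weight k + 1 includes m itself, so weight k on the
      other coordinates suffices, and every true point of the hard half has it.\<close>
    then have "k \<le> card S" using assms(3) unfolding set_fun_def by auto
    moreover have "card (insert m S) \<le> card S'" using 2 assms fin by (intro card_mono) auto
    ultimately show ?thesis using 2 assms fin2 unfolding set_fun_def by auto
  next
    case 3
    then show ?thesis using assms card unfolding set_fun_def by auto
  next
    case 4
    have sub: "hits {..<L} T S \<subseteq> hits {..<L} T S'" using assms unfolding hits_def by auto
    have finh: "finite (hits {..<L} T S')" unfolding hits_def by auto
    from 4(3) have "val {..<L} (yes e) T S'"
      unfolding val_def
    proof
      assume "2 \<le> card (hits {..<L} T S)"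
      then show "2 \<le> card (hits {..<L} T S') \<or> (\<exists>j. hits {..<L} T S' = {j} \<and> yes e j S')"
        using card_mono[OF finh sub] by auto
    next
      assume "\<exists>j. hits {..<L} T S = {j} \<and> yes e j S"
      then obtain j where j: "hits {..<L} T S = {j}" "k \<le> e j" unfolding yes_def by auto
      show "2 \<le> card (hits {..<L} T S') \<or> (\<exists>j. hits {..<L} T S' = {j} \<and> yes e j S')"
      proof (cases "hits {..<L} T S' = {j}")
        case True
        then show ?thesis using j unfolding yes_def by auto
      next
        case False
        then have "{j} \<subset> hits {..<L} T S'" using sub j by auto
        then have "card {j} < card (hits {..<L} T S')" using finh by (rule psubset_card_mono[rotated])
        then show ?thesis by simp
      qed
    qed
    then show ?thesis using 4 assms card unfolding set_fun_def by auto
  qed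
qed

text \<open>The function increases in the coordinates up to m. Setting a coordinate above m makes it
  false, so it decreases there.\<close>

lemma yes_unate: "func (yes e) T \<in> Unate n"
  unfolding Unate_def
proof (intro CollectI conjI allI impI func_bool_funs)
  fix i assume i: "i < n"
  have upd: "x[i := True] \<in> cube n" "x[i := False] \<in> cube n" if "x \<in> cube n" for x
    using that unfolding cube_def by auto
  show "nondecreasing_in n i (func (yes e) T) \<or> nonincreasing_in n i (func (yes e) T)"
  proof (cases "i \<le> m")
    case True
    have "func (yes e) T (x[i := False]) \<le> func (yes e) T (x[i := True])" if x: "x \<in> cube n" for x
    proof (rule le_boolI)
      assume "func (yes e) T (x[i := False])"
      then have a: "set_fun (yes e) T (supp x - {i})"
        using func_eq[OF upd(2)[OF x]] supp_update_False[of i x] x i by (simp add: cube_def)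
      then have "supp x - {i} \<subseteq> {..m}" unfolding set_fun_def by blast
      then have "set_fun (yes e) T (insert i (supp x))"
        using True by (intro set_fun_yes_mono[OF _ _ a]) auto
      then show "func (yes e) T (x[i := True])"
        using func_eq[OF upd(1)[OF x]] supp_update_True[of i x] x i by (simp add: cube_def)
    qed
    then show ?thesis unfolding nondecreasing_in_def by blast
  next
    case False
    have "\<not> func (yes e) T (x[i := True])" if x: "x \<in> cube n" for x
      using func_eq[OF upd(1)[OF x]] supp_update_True[of i x] x i False
      unfolding set_fun_def by (auto simp: cube_def)
    then show ?thesis unfolding nonincreasing_in_def by (simp add: le_bool_def)
  qed
qed

text \<open>A coordinate lies in a fraction k / m \<ge> 1/2 of the layer. These sets supply the
  parallel boundary edges of the threshold half in direction i.\<close>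

lemma card_lay_containing:
  assumes "i < m"
  shows "card lay \<le> 2 * card {S \<in> lay. i \<in> S}"
proof -
  have "card {S. S \<subseteq> {..<m} - {i} \<and> card S = k} = (m - 1) choose k"
    using n_subsets[of "{..<m} - {i}" k] assms by simp
  moreover have "{S \<in> lay. i \<in> S} = lay - {S. S \<subseteq> {..<m} - {i} \<and> card S = k}"
    unfolding lay_def by auto
  moreover have "card (lay - {S. S \<subseteq> {..<m} - {i} \<and> card S = k}) =
      card lay - card {S. S \<subseteq> {..<m} - {i} \<and> card S = k}"
    by (intro card_Diff_subset) (auto simp: lay_def intro: finite_subset[of _ "Pow {..<m}"])
  ultimately have c: "card {S \<in> lay. i \<in> S} = card lay - ((m - 1) choose k)" by simp
  have "m * ((m - 1) choose k) = (m - k) * card lay"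
    unfolding card_lay by (rule binomial_absorb_comp[symmetric])
  then have "m * (2 * ((m - 1) choose k)) = (2 * (m - k)) * card lay" by simp
  also have "\<dots> \<le> m * card lay" using m_le by (intro mult_right_mono) auto
  finally have "2 * ((m - 1) choose k) \<le> card lay" using k_less by simp
  then show ?thesis using c by simp
qed

text \<open>On an edge where the function and \<open>g\<close> change in opposite directions,
  \<open>g\<close> errs at one end, so disjoint edges give distinct errors. If \<open>g\<close>
  increases in all directions below m, the edges are those leaving \<open>drops\<close>, where the
  function falls. Otherwise \<open>g\<close> decreases in some direction i < m, and the boundary
  edges of the threshold half in direction i serve. In both cases \<phi> selects the end at which
  \<open>g\<close> errs, and its injectivity is the disjointness of the edges.\<close>

lemma no_distance:
  assumes e: "e \<in> EE" and g: "g \<in> Unate n"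
  shows "min (card (drops T e)) (card lay div 2) \<le>
    card ((ones n (func (no e) T) - ones n g) \<union> (ones n g - ones n (func (no e) T)))"
proof -
  let ?f = "func (no e) T"
  let ?\<Delta> = "(ones n ?f - ones n g) \<union> (ones n g - ones n ?f)"
  have fin\<Delta>: "finite ?\<Delta>" unfolding ones_def using finite_cube by auto
  have \<Delta>: "ind n S \<in> ?\<Delta> \<longleftrightarrow> set_fun (no e) T S \<noteq> g (ind n S)" if "S \<subseteq> {..<n}" for S
    using that ind_cube func_ind unfolding ones_def by auto
  show ?thesis
  proof (cases "\<forall>i<m. nondecreasing_in n i g")
    case True
    define J where "J x = (SOME j. j < L \<and> good T j (e j) x)" for x
    have J: "J x < L" "good T (J x) (e (J x)) x" if "x \<in> drops T e" for x
      using someI_ex[of "\<lambda>j. j < L \<and> good T j (e j) x"] that unfolding J_def drops_def by auto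
    have em: "e j < m" if "j < L" for j using e that unfolding EE_def by auto
    define up where "up x = insert (e (J x)) x" for x
    have x: "x \<subseteq> {..<m}" "card x = k" "finite x" "e (J x) \<notin> x" "e (J x) < m" if "x \<in> drops T e" for x
      using J[OF that] em that unfolding drops_def lay_def good_def by (auto intro: finite_subset)
    have up: "up x \<subseteq> {..<m}" "card (up x) = k + 1" if "x \<in> drops T e" for x
      using x[OF that] unfolding up_def by auto
    define \<phi> where "\<phi> x = (if g (ind n x) then up x else x)" for x
    have hits: "hits {..<L} T x = {J x}" "hits {..<L} T (up x) = {J x}" if "x \<in> drops T e" for x
      using J[OF that] unfolding hits_def good_def up_def by auto
    have f1: "set_fun (no e) T x" if "x \<in> drops T e" for x
      using x[OF that] val_unique[OF hits(1)[OF that]] unfolding set_fun_def no_def by auto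
    have f0: "\<not> set_fun (no e) T (up x)" if "x \<in> drops T e" for x
      using up[OF that] val_unique[OF hits(2)[OF that]] unfolding set_fun_def no_def
      by (auto simp: up_def)
    have "ind n (\<phi> x) \<in> ?\<Delta>" if xd: "x \<in> drops T e" for x
    proof (cases "g (ind n x)")
      case g1: True
      have "g (ind n (up x))"
        unfolding up_def
      proof (rule nondecreasing_insert)
        show "nondecreasing_in n (e (J x)) g" using True x(5)[OF xd] by blast
        show "e (J x) < n" using x(5)[OF xd] m_less by simp
        show "x \<subseteq> {..<n}" using x(1)[OF xd] m_less by auto
      qed (use x(4)[OF xd] g1 in auto)
      moreover have "up x \<subseteq> {..<n}" using up(1)[OF xd] m_less by auto
      ultimately show ?thesis using \<Delta>[of "up x"] f0[OF xd] g1 unfolding \<phi>_def by simp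
    next
      case False
      moreover have "x \<subseteq> {..<n}" using x(1)[OF xd] m_less by auto
      ultimately show ?thesis using \<Delta>[of x] f1[OF xd] unfolding \<phi>_def by simp
    qed
    then have sub: "ind n ` \<phi> ` drops T e \<subseteq> ?\<Delta>" by auto
    have inj: "inj_on \<phi> (drops T e)"
    proof (rule inj_onI)
      fix x y assume xy: "x \<in> drops T e" "y \<in> drops T e" "\<phi> x = \<phi> y"
      have "up x \<noteq> y" "x \<noteq> up y" using x(2) up(2) xy by (metis Suc_eq_plus1 n_not_Suc_n)+
      \<comment> \<open>The upper end satisfies exactly one term, which reveals the part, hence the
        added element, hence the lower end.\<close>
      moreover have "x = y" if eq: "up x = up y"
      proof -
        have "J x = J y" using hits(2) xy eq by (metis singleton_inject)
        then show ?thesis using eq x(4) xy unfolding up_def by (metis Diff_insert_absorb)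
      qed
      ultimately show "x = y" using xy(3) unfolding \<phi>_def by (auto split: if_splits)
    qed
    have "card (drops T e) = card (ind n ` \<phi> ` drops T e)"
    proof -
      have "\<phi> ` drops T e \<subseteq> Pow {..<n}"
        using x(1) up(1) m_less unfolding \<phi>_def by (force split: if_splits)
      then show ?thesis using card_ind_image card_image[OF inj] by simp
    qed
    then show ?thesis using card_mono[OF fin\<Delta> sub] by simp
  next
    case False
    then obtain i where i: "i < m" "nonincreasing_in n i g"
    proof -
      from False obtain i where "i < m" "\<not> nondecreasing_in n i g" by blast
      moreover have "nondecreasing_in n i g \<or> nonincreasing_in n i g"
        using g m_less \<open>i < m\<close> unfolding Unate_def by simp
      ultimately show ?thesis using that by blast
    qed
    let ?B = "{S \<in> lay. i \<in> S}"
    define \<phi> where "\<phi> S = (if g (ind n (insert m S)) then insert m S - {i} else insert m S)" for S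
    have S: "S \<subseteq> {..<m}" "card S = k" "i \<in> S" "finite S" "m \<notin> S" if "S \<in> ?B" for S
      using that unfolding lay_def by (auto intro: finite_subset)
    have "ind n (\<phi> S) \<in> ?\<Delta>" if "S \<in> ?B" for S
    proof -
      note S = S[OF that]
      have subn: "insert m S \<subseteq> {..<n}" using S m_less by auto
      have f1: "set_fun (no e) T (insert m S)" using S unfolding set_fun_def by auto
      have f0: "\<not> set_fun (no e) T (insert m S - {i})"
      proof -
        have "m \<in> insert m S - {i}" "card (insert m S - {i}) = k" using S i by auto
        then show ?thesis unfolding set_fun_def by auto
      qed
      show ?thesis
      proof (cases "g (ind n (insert m S))")
        case True
        have "g (ind n (insert m S - {i}))"
        proof (rule nonincreasing_insert[OF i(2)])
          show "g (ind n (insert i (insert m S - {i})))" using True S by (simp add: insert_absorb)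
        qed (use i m_less subn in auto)
        then show ?thesis using \<Delta>[of "insert m S - {i}"] subn f0 True unfolding \<phi>_def by auto
      next
        case False
        then show ?thesis using \<Delta>[of "insert m S"] subn f1 unfolding \<phi>_def by auto
      qed
    qed
    then have sub: "ind n ` \<phi> ` ?B \<subseteq> ?\<Delta>" by auto
    have inj: "inj_on \<phi> ?B"
    proof (rule inj_onI)
      fix A B assume AB: "A \<in> ?B" "B \<in> ?B" "\<phi> A = \<phi> B"
      have rec: "insert i (\<phi> A) - {m} = A" if "A \<in> ?B" for A
        using S[OF that] i unfolding \<phi>_def by auto
      show "A = B" using rec AB by metis
    qed
    have "card lay div 2 \<le> card ?B" using card_lay_containing[OF i(1)] by simp
    also have "card ?B = card (ind n ` \<phi> ` ?B)"
    proof -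
      have "\<phi> ` ?B \<subseteq> Pow {..<n}" using S(1) m_less unfolding \<phi>_def by (force split: if_splits)
      then show ?thesis using card_ind_image card_image[OF inj] by simp
    qed
    also have "\<dots> \<le> card ?\<Delta>" by (rule card_mono[OF fin\<Delta> sub])
    finally show ?thesis by simp
  qed
qed

lemma no_far:
  assumes e: "e \<in> EE" and many: "real (card lay) / 576 \<le> real (card (drops T e))"
    and K: "real (2 * card upper) \<le> K * real (card lay)" and two: "2 \<le> card lay"
  shows "1 / (576 * K) \<le> reldist_Unate n (func (no e) T)"
  unfolding reldist_Unate_def
proof (subst Min_ge_iff)
  show "finite (reldist n (func (no e) T) ` Unate n)" using finite_Unate by simp
  show "reldist n (func (no e) T) ` Unate n \<noteq> {}" using Unate_nonempty by simp
  show "\<forall>a\<in>reldist n (func (no e) T) ` Unate n. 1 / (576 * K) \<le> a"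
  proof
    fix a assume "a \<in> reldist n (func (no e) T) ` Unate n"
    then obtain g where g: "g \<in> Unate n" "a = reldist n (func (no e) T) g" by auto
    let ?\<Delta> = "(ones n (func (no e) T) - ones n g) \<union> (ones n g - ones n (func (no e) T))"
    let ?o = "real (card (ones n (func (no e) T)))"
    have "real (card lay) / 576 \<le> real (card lay div 2)" using two by linarith
    then have num: "real (card lay) / 576 \<le> real (card ?\<Delta>)"
      using many no_distance[OF e g(1), of T] by linarith
    have o: "0 < ?o" "?o \<le> K * real (card lay)"
      using ones_lower[of "no e" T] ones_upper[of "no e" T] upper_pos K by linarith+
    have l0: "0 < real (card lay)" using card_lay_pos by simp
    have K0: "0 < K" using o l0 by (metis less_le_trans zero_less_mult_pos2)
    have "1 / (576 * K) = (real (card lay) / 576) / (K * real (card lay))" using l0 by simp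
    also have "\<dots> \<le> real (card ?\<Delta>) / ?o" using num o l0 by (intro frac_le) auto
    finally show "1 / (576 * K) \<le> a" using g unfolding reldist_def by simp
  qed
qed

end

section \<open>The error budget of a tester\<close>

text \<open>A birthday bound: each of fewer than r ^ 2 pairs of independent uniform points fails
  with probability at most B / |\<Omega>|. It is cleared of the denominator to stay in the
  naturals.\<close>

lemma card_not_sorted_wrt:
  assumes fin: "finite \<Omega>"
    and B: "\<And>y. y \<in> \<Omega> \<Longrightarrow> card {x \<in> \<Omega>. \<not> R x y} \<le> B"
  shows "card {us. set us \<subseteq> \<Omega> \<and> length us = r \<and> \<not> sorted_wrt R us} * card \<Omega> \<le> r\<^sup>2 * B * card \<Omega> ^ r"
proof (induction r)
  case 0
  have "{us. set us \<subseteq> \<Omega> \<and> length us = 0 \<and> \<not> sorted_wrt R us} = {}" by auto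
  then show ?case by (simp only: card.empty)
next
  case (Suc r)
  let ?bad = "{us. set us \<subseteq> \<Omega> \<and> length us = r \<and> \<not> sorted_wrt R us}"
  let ?all = "{us. set us \<subseteq> \<Omega> \<and> length us = r}"
  have fa: "finite ?all" by (rule finite_lists_length_eq[OF fin])
  have "card {us. set us \<subseteq> \<Omega> \<and> length us = Suc r \<and> \<not> sorted_wrt R us}
      = (\<Sum>u\<in>\<Omega>. card {us. set us \<subseteq> \<Omega> \<and> length us = r \<and> \<not> sorted_wrt R (u # us)})"
    by (rule card_lists_Suc[OF fin])
  also have "\<dots> \<le> (\<Sum>u\<in>\<Omega>. card ?bad + card {us \<in> ?all. \<exists>y\<in>set us. \<not> R u y})"
  proof (rule sum_mono)
    fix u
    have "{us. set us \<subseteq> \<Omega> \<and> length us = r \<and> \<not> sorted_wrt R (u # us)}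
        \<subseteq> ?bad \<union> {us \<in> ?all. \<exists>y\<in>set us. \<not> R u y}" by auto
    then have "card {us. set us \<subseteq> \<Omega> \<and> length us = r \<and> \<not> sorted_wrt R (u # us)}
        \<le> card (?bad \<union> {us \<in> ?all. \<exists>y\<in>set us. \<not> R u y})"
      by (rule card_mono[rotated]) (rule finite_subset[OF _ fa], auto)
    also have "\<dots> \<le> card ?bad + card {us \<in> ?all. \<exists>y\<in>set us. \<not> R u y}" by (rule card_Un_le)
    finally show "card {us. set us \<subseteq> \<Omega> \<and> length us = r \<and> \<not> sorted_wrt R (u # us)}
        \<le> card ?bad + card {us \<in> ?all. \<exists>y\<in>set us. \<not> R u y}" .
  qed
  also have "\<dots> = card \<Omega> * card ?bad + (\<Sum>us\<in>?all. card {u \<in> \<Omega>. \<exists>y\<in>set us. \<not> R u y})"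
    by (simp only: sum.distrib sum_constant sum_card_swap[OF fin fa] of_nat_id)
  also have "(\<Sum>us\<in>?all. card {u \<in> \<Omega>. \<exists>y\<in>set us. \<not> R u y}) \<le> of_nat (card ?all) * (r * B)"
  proof (rule sum_bounded_above)
    fix us assume us: "us \<in> ?all"
    have "{u \<in> \<Omega>. \<exists>y\<in>set us. \<not> R u y} = (\<Union>y\<in>set us. {u \<in> \<Omega>. \<not> R u y})" by auto
    also have "card \<dots> \<le> (\<Sum>y\<in>set us. card {u \<in> \<Omega>. \<not> R u y})" by (intro card_UN_le) auto
    also have "\<dots> \<le> of_nat (card (set us)) * B" using us B by (intro sum_bounded_above) auto
    also have "\<dots> \<le> r * B" using us card_length[of us] by (auto intro: mult_right_mono)
    finally show "card {u \<in> \<Omega>. \<exists>y\<in>set us. \<not> R u y} \<le> r * B" .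
  qed
  also have "of_nat (card ?all) * (r * B) = card \<Omega> ^ r * (r * B)"
    by (simp add: card_lists_length_eq[OF fin])
  finally have "card {us. set us \<subseteq> \<Omega> \<and> length us = Suc r \<and> \<not> sorted_wrt R us} * card \<Omega>
      \<le> (card \<Omega> * card ?bad + card \<Omega> ^ r * (r * B)) * card \<Omega>" by (intro mult_right_mono) auto
  also have "\<dots> = card \<Omega> * (card ?bad * card \<Omega>) + card \<Omega> ^ Suc r * (r * B)" by (simp add: algebra_simps)
  also have "\<dots> \<le> card \<Omega> * (r\<^sup>2 * B * card \<Omega> ^ r) + card \<Omega> ^ Suc r * (r * B)"
    using Suc.IH by (intro add_right_mono mult_left_mono) auto
  also have "\<dots> = (r\<^sup>2 + r) * (B * card \<Omega> ^ Suc r)" by (simp add: algebra_simps)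
  also have "\<dots> \<le> (Suc r)\<^sup>2 * (B * card \<Omega> ^ Suc r)"
    by (intro mult_right_mono) (auto simp: power2_eq_square)
  finally show ?case by (simp add: mult.assoc)
qed

section \<open>Acceptance of the two families compared\<close>

lemma accept_prob_eq: "accept_prob n f A = measure_pmf.expectation A (strategy_accept n f)"
  unfolding accept_prob_def run_def prob_bind_pmf strategy_accept_def ..

lemma reject_prob_eq: "reject_prob n f A = 1 - accept_prob n f A"
proof -
  have "{(b, t). \<not> b} = UNIV - {(b :: bool, t :: nat). b}" by auto
  then show ?thesis
    using measure_pmf.prob_compl[of "{(b, t). b}" "run n f A"]
    unfolding reject_prob_def accept_prob_def by simp
qed

lemma integrable_strategy_accept: "integrable (measure_pmf A) (strategy_accept n f)"
  by (rule measure_pmf.integrable_const_bound[where B = 1])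
    (auto simp: strategy_accept_def intro!: AE_pmfI)

context hard_instance
begin

lemma card_not_far:
  assumes "y \<in> region"
  shows "card {x \<in> region. \<not> far x y} \<le> near_bound"
proof (cases "active y")
  case True
  have "card {x \<in> region. \<not> far x y} \<le> card {B. B \<subseteq> {..<m} \<and> card (sym_diff (supp y) B) \<le> d}"
  proof (rule card_inj_on_le)
    show "inj_on supp {x \<in> region. \<not> far x y}"
      by (rule inj_on_subset[OF inj_on_supp[of n]]) (auto simp: region_def)
    show "supp ` {x \<in> region. \<not> far x y} \<subseteq> {B. B \<subseteq> {..<m} \<and> card (sym_diff (supp y) B) \<le> d}"
      unfolding far_def active_def mid_def by (auto simp: Un_commute)
    show "finite {B. B \<subseteq> {..<m} \<and> card (sym_diff (supp y) B) \<le> d}" by auto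
  qed
  also have "\<dots> \<le> near_bound"
    using True by (intro card_near) (auto simp: active_def mid_def)
  finally show ?thesis .
next
  case False
  then have "{x \<in> region. \<not> far x y} = {}" unfolding far_def by auto
  then show ?thesis by (simp only: card.empty)
qed

lemma accepts_out:
  "accepts q (func b T) \<sigma> us \<longleftrightarrow>
    out b T us (\<lambda>a. fst (leaf q \<sigma> (zip us a))) (\<lambda>a. snd (leaf q \<sigma> (zip us a)))"
  unfolding accepts_def out_def Let_def ..

lemma sum_sim_accept:
  assumes "finite F"
  shows "(\<Sum>T\<in>F. \<Sum>e\<in>EE. sim_accept region r q (func (b e) T) \<sigma>) * real (card region) ^ r
    = (\<Sum>us\<in>{us. set us \<subseteq> region \<and> length us = r}. \<Sum>T\<in>F. real (card {e \<in> EE. accepts q (func (b e) T) \<sigma> us}))"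
proof -
  let ?U = "{us. set us \<subseteq> region \<and> length us = r}"
  have fU: "finite ?U" by (rule finite_lists_length_eq[OF finite_region])
  have w: "real (card region) > 0" using card_region upper_pos by simp
  have "(\<Sum>T\<in>F. \<Sum>e\<in>EE. sim_accept region r q (func (b e) T) \<sigma>) * real (card region) ^ r
      = (\<Sum>T\<in>F. \<Sum>e\<in>EE. real (card {us \<in> ?U. accepts q (func (b e) T) \<sigma> us}))"
    unfolding sim_accept_def using w by (simp add: sum_distrib_right conj_assoc)
  also have "\<dots> = (\<Sum>T\<in>F. \<Sum>us\<in>?U. real (card {e \<in> EE. accepts q (func (b e) T) \<sigma> us}))"
    by (intro sum.cong refl) (simp only: of_nat_sum[symmetric] sum_card_swap[OF finite_EE fU])
  also have "\<dots> = (\<Sum>us\<in>?U. \<Sum>T\<in>F. real (card {e \<in> EE. accepts q (func (b e) T) \<sigma> us}))"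
    by (rule sum.swap)
  finally show ?thesis .
qed

text \<open>Candidate lists are drawn without looking at the function, so they can be fixed first. A
  list with two candidates near each other is charged the trivial bound; for the others the
  two-round comparison applies.\<close>

lemma sim_difference:
  assumes F: "F \<subseteq> TT"
  shows "(\<Sum>T\<in>F. \<Sum>e\<in>EE. sim_accept region r q (func (yes e) T) \<sigma>)
      - (\<Sum>T\<in>F. \<Sum>e\<in>EE. sim_accept region r q (func (no e) T) \<sigma>)
    \<le> (real r)\<^sup>2 * real near_bound / real (card region) * (real (card F) * real (card EE)) +
      (real ((r + q) * d) / real (m - k) * real (card F) * real (card EE) +
       real L * (real ((r + 1) * (r + q)\<^sup>2 * (k - h) ^ k) / real (m ^ k)) * real (card TT) * real (card EE))"
    (is "?Y - ?N \<le> ?a * ?G + ?\<beta>")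
proof -
  define bet where "bet = ?\<beta>"
  let ?U = "{us. set us \<subseteq> region \<and> length us = r}"
  let ?V = "{us. set us \<subseteq> region \<and> length us = r \<and> \<not> sorted_wrt far us}"
  let ?y = "\<lambda>b us. \<Sum>T\<in>F. real (card {e \<in> EE. accepts q (func (b e) T) \<sigma> us})"
  let ?w = "real (card region)"
  have finF: "finite F" using F finite_TT finite_subset by auto
  have fU: "finite ?U" by (rule finite_lists_length_eq[OF finite_region])
  have VU: "?V \<subseteq> ?U" by auto
  have w: "?w > 0" using card_region upper_pos by simp
  have y_le: "?y b us \<le> ?G" "0 \<le> ?y b us" for b us
  proof -
    have "?y b us \<le> (\<Sum>T\<in>F. real (card EE))"
      using finite_EE by (intro sum_mono of_nat_mono card_mono) auto
    then show "?y b us \<le> ?G" by simp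
  qed (simp add: sum_nonneg)
  have \<beta>0: "0 \<le> bet" unfolding bet_def by (intro add_nonneg_nonneg mult_nonneg_nonneg divide_nonneg_nonneg) auto
  have each: "?y yes us - ?y no us \<le> (if \<not> sorted_wrt far us then ?G else 0) + bet" if us: "us \<in> ?U" for us
  proof (cases "sorted_wrt far us")
    case True
    have "length us = r" using us by simp
    have "?y yes us - ?y no us \<le> bet"
      unfolding accepts_out bet_def
      using out_difference[OF length_leaf True F, of q] unfolding \<open>length us = r\<close> by simp
    then show ?thesis using True by simp
  next
    case False
    have "x - y \<le> (if P then g else 0) + t" if "P" "x \<le> g" "0 \<le> y" "0 \<le> t" for x y g t :: real and P
      using that by simp
    from this[OF False y_le(1) y_le(2) \<beta>0] show ?thesis .
  qed
  have "(?Y - ?N) * ?w ^ r = (\<Sum>us\<in>?U. ?y yes us - ?y no us)"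
    unfolding left_diff_distrib sum_sim_accept[OF finF] sum_subtractf ..
  also have "\<dots> \<le> (\<Sum>us\<in>?U. (if \<not> sorted_wrt far us then ?G else 0) + bet)"
    by (rule sum_mono) (rule each)
  also have "\<dots> = (\<Sum>us\<in>?U. if \<not> sorted_wrt far us then ?G else 0) + real (card ?U) * bet"
    by (simp only: sum.distrib sum_constant)
  also have "(\<Sum>us\<in>?U. if \<not> sorted_wrt far us then ?G else 0) = real (card ?V) * ?G"
    by (simp only: sum.inter_filter[OF fU, symmetric] sum_constant mem_Collect_eq conj_assoc)
  also have "real (card ?U) = ?w ^ r" using card_lists_length_eq[OF finite_region, of r] by simp
  finally have "(?Y - ?N) * ?w ^ r \<le> real (card ?V) * ?G + ?w ^ r * bet" .
  moreover have "real (card ?V) \<le> ?a * ?w ^ r"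
  proof -
    have "real (card ?V * card region) \<le> real (r\<^sup>2 * near_bound * card region ^ r)"
      by (intro of_nat_mono card_not_sorted_wrt[OF finite_region card_not_far])
    then show ?thesis using w by (simp add: field_simps)
  qed
  ultimately have "(?Y - ?N) * ?w ^ r \<le> ?a * ?w ^ r * ?G + ?w ^ r * bet"
    by (meson add_right_mono mult_right_mono of_nat_0_le_iff mult_nonneg_nonneg order_trans)
  then have "(?Y - ?N) * ?w ^ r \<le> (?a * ?G + bet) * ?w ^ r"
    by (simp only: distrib_right) (simp only: ac_simps)
  then show ?thesis using w unfolding bet_def[symmetric] by (simp only: mult_le_cancel_right_pos zero_less_power)
qed

lemma half_ones: "card region \<le> 2 * card (ones n (func b T))"
  using ones_lower[of b T] card_region by simp

text \<open>The simulation never accepts more often than the strategy itself, so its error is paid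
  once, on the side of the constants.\<close>

lemma strategy_difference:
  assumes F: "F \<subseteq> TT"
    and calls: "\<And>b T. \<forall>(v, t)\<in>set_pmf (run_strategy n (func b T) \<sigma>). t \<le> q"
  shows "(\<Sum>T\<in>F. \<Sum>e\<in>EE. strategy_accept n (func (yes e) T) \<sigma> - strategy_accept n (func (no e) T) \<sigma>)
    \<le> 2 ^ q * (3/4) ^ r * (real (card F) * real (card EE)) +
      ((real r)\<^sup>2 * real near_bound / real (card region) * (real (card F) * real (card EE)) +
      (real ((r + q) * d) / real (m - k) * real (card F) * real (card EE) +
       real L * (real ((r + 1) * (r + q)\<^sup>2 * (k - h) ^ k) / real (m ^ k)) * real (card TT) * real (card EE)))"
proof -
  have ne: "region \<noteq> {}" using card_region upper_pos by auto
  have cube: "region \<subseteq> cube n" unfolding region_def by auto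
  have rs: "sim_accept region r q (func b T) \<sigma> \<le> strategy_accept n (func b T) \<sigma> \<and>
      strategy_accept n (func b T) \<sigma> \<le> sim_accept region r q (func b T) \<sigma> + 2 ^ q * (3/4) ^ r" for b T
    by (rule rejection_sampling[OF finite_region ne cube ones_region half_ones calls order_refl])
  have "(\<Sum>T\<in>F. \<Sum>e\<in>EE. strategy_accept n (func (yes e) T) \<sigma> - strategy_accept n (func (no e) T) \<sigma>)
      \<le> (\<Sum>T\<in>F. \<Sum>e\<in>EE. 2 ^ q * (3/4) ^ r + (sim_accept region r q (func (yes e) T) \<sigma> - sim_accept region r q (func (no e) T) \<sigma>))"
  proof (intro sum_mono)
    fix T e
    show "strategy_accept n (func (yes e) T) \<sigma> - strategy_accept n (func (no e) T) \<sigma>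
      \<le> 2 ^ q * (3/4) ^ r + (sim_accept region r q (func (yes e) T) \<sigma> - sim_accept region r q (func (no e) T) \<sigma>)"
      using rs[of "yes e" T] rs[of "no e" T] by linarith
  qed
  also have "\<dots> = 2 ^ q * (3/4) ^ r * (real (card F) * real (card EE)) +
      ((\<Sum>T\<in>F. \<Sum>e\<in>EE. sim_accept region r q (func (yes e) T) \<sigma>)
      - (\<Sum>T\<in>F. \<Sum>e\<in>EE. sim_accept region r q (func (no e) T) \<sigma>))"
    by (simp only: sum.distrib sum_subtractf sum_constant) (simp only: ac_simps)
  finally show ?thesis by (rule order_trans[OF _ add_left_mono[OF sim_difference[OF F]]])
qed

text \<open>The summands are the ways to lose the gap of 1/3 between the two families: the
  candidates run out, two of them are near each other, a hidden variable is inspected, distant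
  queries share a term, or the function with negated variables has too few violating edges.\<close>

lemma tester_bound:
  assumes C: "real N / C \<le> real (card upper)" "real (2 * card upper) \<le> C * real N"
    and K: "real (2 * card upper) \<le> K * real (card lay)" and two: "2 \<le> card lay"
    and tester: "unateness_tester C (1 / (576 * K)) n N A"
    and most: "makes_at_most C n N A q"
  shows "1/3 \<le> 2 ^ q * (3/4) ^ r + (real r)\<^sup>2 * real near_bound / real (card region) +
      real ((r + q) * d) / real (m - k) +
      288 * (real L * (real ((r + 1) * (r + q)\<^sup>2 * (k - h) ^ k) / real (m ^ k))) +
      288 * (576\<^sup>2 * (real L * (real (k - h) / real m) ^ k + real near_bound / real (card lay)))"
proof -
  have input: "func b T \<in> inputs C n N" for b T
  proof -
    have "real (card upper) \<le> real (card (ones n (func b T)))"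
      "real (card (ones n (func b T))) \<le> real (2 * card upper)"
      by (rule of_nat_mono ones_lower ones_upper)+
    then show ?thesis using C func_bool_funs unfolding inputs_def by auto
  qed
  let ?d = "\<lambda>\<sigma>. \<Sum>T\<in>rich. \<Sum>e\<in>EE. strategy_accept n (func (yes e) T) \<sigma> - strategy_accept n (func (no e) T) \<sigma>"
  let ?a = "\<lambda>b T. accept_prob n (func b T) A"
  let ?E = "real (card EE)"
  let ?G = "real (card rich) * ?E"
  let ?few = "\<lambda>T. {e \<in> EE. real (card (drops T e)) < real (card lay) / 576}"
  let ?err = "2 ^ q * (3/4) ^ r :: real"
  let ?nr = "(real r)\<^sup>2 * real near_bound / real (card region)"
  let ?\<eta> = "real ((r + q) * d) / real (m - k)"
  let ?\<beta> = "real L * (real ((r + 1) * (r + q)\<^sup>2 * (k - h) ^ k) / real (m ^ k))"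
  let ?\<nu> = "576\<^sup>2 * (real L * (real (k - h) / real m) ^ k + real near_bound / real (card lay))"
  have sub: "rich \<subseteq> TT" unfolding rich_def by auto
  have fin: "finite rich" using sub finite_TT finite_subset by auto
  have E0: "?E > 0" unfolding card_EE using k_less by simp
  have R0: "real (card rich) > 0"
  proof -
    have "real (card TT) > 0" unfolding card_TT using k_less by simp
    then show ?thesis using card_rich by linarith
  qed
  have G0: "?G > 0" using E0 R0 by simp
  \<comment> \<open>Errors known on average over all terms are transferred to the rich ones, which
    are at least a 1/288 fraction; hence the two factors 288.\<close>
  have W: "real (card TT) * ?E \<le> 288 * ?G"
  proof -
    have "real (card TT) \<le> 288 * real (card rich)" using card_rich by linarith
    then have "real (card TT) * ?E \<le> (288 * real (card rich)) * ?E" by (rule mult_right_mono) simp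
    then show ?thesis by simp
  qed
  have diff: "(\<Sum>T\<in>rich. \<Sum>e\<in>EE. ?a (yes e) T - ?a (no e) T) = measure_pmf.expectation A ?d"
    unfolding accept_prob_eq
    by (simp add: Bochner_Integration.integral_sum Bochner_Integration.integral_diff
      integrable_strategy_accept)
  also have "\<dots> \<le> ?err * ?G + (?nr * ?G + (?\<eta> * real (card rich) * ?E + ?\<beta> * real (card TT) * ?E))"
  proof (rule measure_pmf.integral_le_const)
    show "integrable (measure_pmf A) ?d"
      by (intro Bochner_Integration.integrable_sum Bochner_Integration.integrable_diff integrable_strategy_accept)
    show "AE \<sigma> in measure_pmf A. ?d \<sigma> \<le> ?err * ?G + (?nr * ?G + (?\<eta> * real (card rich) * ?E + ?\<beta> * real (card TT) * ?E))"
    proof (rule AE_pmfI)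
      fix \<sigma> assume \<sigma>: "\<sigma> \<in> set_pmf A"
      show "?d \<sigma> \<le> ?err * ?G + (?nr * ?G + (?\<eta> * real (card rich) * ?E + ?\<beta> * real (card TT) * ?E))"
      proof (rule strategy_difference[OF sub])
        fix b T
        have "\<forall>(v, t)\<in>set_pmf (run n (func b T) A). t \<le> q"
          using most input unfolding makes_at_most_def by blast
        then show "\<forall>(v, t)\<in>set_pmf (run_strategy n (func b T) \<sigma>). t \<le> q"
          unfolding run_def set_bind_pmf using \<sigma> by blast
      qed
    qed
  qed
  finally have up: "(\<Sum>T\<in>rich. \<Sum>e\<in>EE. ?a (yes e) T - ?a (no e) T)
      \<le> ?err * ?G + (?nr * ?G + (?\<eta> * real (card rich) * ?E + ?\<beta> * real (card TT) * ?E))" .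
  have each: "1/3 - (if e \<in> ?few T then 1 else 0) \<le> ?a (yes e) T - ?a (no e) T" if "e \<in> EE" for e T
  proof -
    have y: "2/3 \<le> ?a (yes e) T"
      using tester input yes_unate unfolding unateness_tester_def by blast
    show ?thesis
    proof (cases "e \<in> ?few T")
      case True
      have "?a (no e) T \<le> 1" unfolding accept_prob_def by simp
      then show ?thesis using y True by simp
    next
      case False
      then have "1 / (576 * K) \<le> reldist_Unate n (func (no e) T)"
        using that by (intro no_far[OF _ _ K two]) auto
      then have "2/3 \<le> reject_prob n (func (no e) T) A"
        using tester input unfolding unateness_tester_def by blast
      then show ?thesis using y False unfolding reject_prob_eq by simp
    qed
  qed
  have "(\<Sum>T\<in>rich. \<Sum>e\<in>EE. 1/3 - (if e \<in> ?few T then 1 else 0)) \<le> (\<Sum>T\<in>rich. \<Sum>e\<in>EE. ?a (yes e) T - ?a (no e) T)"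
    by (intro sum_mono each)
  moreover have "(\<Sum>T\<in>rich. \<Sum>e\<in>EE. 1/3 - (if e \<in> ?few T then 1 else 0)) = 1/3 * ?G - (\<Sum>T\<in>rich. real (card (?few T)))"
  proof -
    have "(\<Sum>e\<in>EE. if e \<in> ?few T then 1 else 0 :: real) = real (card (?few T))" for T
      using finite_EE by (simp add: sum.If_cases Int_def)
    then show ?thesis by (simp add: sum_subtractf)
  qed
  moreover have "(\<Sum>T\<in>rich. real (card (?few T))) \<le> ?\<nu> * (real (card TT) * ?E)"
    using few_drops by (simp only: ac_simps)
  moreover have "?\<nu> * (real (card TT) * ?E) \<le> ?\<nu> * (288 * ?G)"
    by (rule mult_left_mono[OF W]) simp
  moreover have "?\<beta> * (real (card TT) * ?E) \<le> ?\<beta> * (288 * ?G)"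
    by (rule mult_left_mono[OF W]) simp
  moreover have "?\<beta> * real (card TT) * ?E = ?\<beta> * (real (card TT) * ?E)" "?\<eta> * real (card rich) * ?E = ?\<eta> * ?G"
    by (rule mult.assoc)+
  ultimately have "1/3 * ?G \<le> ?err * ?G + (?nr * ?G + (?\<eta> * ?G + ?\<beta> * (288 * ?G))) + ?\<nu> * (288 * ?G)"
    using up by linarith
  then have "1/3 * ?G \<le> (?err + ?nr + ?\<eta> + 288 * ?\<beta> + 288 * ?\<nu>) * ?G"
    by (simp only: distrib_right) (simp only: ac_simps)
  then show ?thesis using G0 by (simp only: mult_le_cancel_right_pos)
qed

end

section \<open>Choice of parameters\<close>

text \<open>Split u M elements into M blocks of size u and choose v from each. The induction step
  keeps one summand of the Vandermonde sum.\<close>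

lemma binomial_power_le: "(u choose v) ^ M \<le> (u * M) choose (v * M)"
proof (induction M)
  case (Suc M)
  have "(u choose v) ^ Suc M \<le> ((u * M) choose (v * M)) * (u choose v)"
    using Suc.IH by (simp add: mult.commute)
  also have "\<dots> = ((u * M) choose (v * M)) * (u choose (v * Suc M - v * M))" by simp
  also have "\<dots> \<le> (\<Sum>i\<le>v * Suc M. ((u * M) choose i) * (u choose (v * Suc M - i)))"
    by (rule member_le_sum[where f = "\<lambda>i. ((u * M) choose i) * (u choose (v * Suc M - i))"]) auto
  also have "\<dots> = (u * M + u) choose (v * Suc M)" by (rule vandermonde)
  finally show ?case by (simp add: add.commute)
qed simp

section \<open>Growth of the layer size and its share of the mass\<close>

lemma binomial_step_diagonal:
  assumes "m + 1 \<le> 2 * (k + 1)"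
  shows "(m + 1) choose (k + 1) \<le> 2 * (m choose k)"
proof -
  have "(k + 1) * ((m + 1) choose (k + 1)) = (m + 1) * (m choose k)"
    using Suc_times_binomial[of k m] by simp
  also have "\<dots> \<le> (2 * (k + 1)) * (m choose k)" using assms by (rule mult_right_mono) simp
  finally have "(k + 1) * ((m + 1) choose (k + 1)) \<le> (k + 1) * (2 * (m choose k))"
    by (simp only: ac_simps)
  then show ?thesis unfolding mult_le_cancel1 by (rule mp) simp
qed

lemma binomial_step_horizontal:
  assumes "m + 1 \<le> 4 * (m + 1 - k)"
  shows "(m + 1) choose k \<le> 4 * (m choose k)"
proof -
  have "(m + 1 - k) * ((m + 1) choose k) = (m + 1) * (m choose k)"
    using binomial_absorb_comp[of "m + 1" k] by simp
  also have "\<dots> \<le> (4 * (m + 1 - k)) * (m choose k)" using assms by (rule mult_right_mono) simp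
  finally have "(m + 1 - k) * ((m + 1) choose k) \<le> (m + 1 - k) * (4 * (m choose k))"
    by (simp only: ac_simps)
  then show ?thesis using assms by simp
qed

lemma binomial_diagonal_steps:
  assumes "m \<le> 2 * k"
  shows "(m + i) choose (k + i) \<le> 2 ^ i * (m choose k)"
proof (induction i)
  case (Suc i)
  have "(m + i + 1) choose (k + i + 1) \<le> 2 * ((m + i) choose (k + i))"
    by (rule binomial_step_diagonal) (use assms in simp)
  then show ?case using Suc.IH by simp
qed simp

lemma binomial_horizontal_steps:
  assumes "4 * k \<le> 3 * (m + 1)"
  shows "(m + i) choose k \<le> 4 ^ i * (m choose k)"
proof (induction i)
  case (Suc i)
  have "(m + i + 1) choose k \<le> 4 * ((m + i) choose k)"
    by (rule binomial_step_horizontal) (use assms in simp)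
  then show ?case using Suc.IH by simp
qed simp

definition layer_size :: "nat \<Rightarrow> nat \<Rightarrow> nat" where
  "layer_size g M = ((2 * g + 1) * M) choose ((g + 1) * M)"

text \<open>Consecutive layer sizes differ by a constant factor, so every large N is within that
  factor of one of them. The row grows by 2 g + 1 and the column by g + 1: g + 1 diagonal steps at a
  factor 2 and g horizontal ones at a factor 4.\<close>

lemma layer_size_Suc:
  assumes "1 \<le> g" "1 \<le> M"
  shows "layer_size g (Suc M) \<le> 8 ^ (g + 1) * layer_size g M"
proof -
  have gM: "g \<le> g * M" "M \<le> g * M" using assms by simp_all
  let ?m = "(2 * g + 1) * M" and ?k = "(g + 1) * M"
  have "(?m + (g + 1) + g) choose (?k + (g + 1)) \<le> 4 ^ g * ((?m + (g + 1)) choose (?k + (g + 1)))"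
  proof (rule binomial_horizontal_steps)
    have eqs: "4 * (?k + (g + 1)) = 4 * (g * M) + 4 * M + 4 * g + 4"
      "3 * (?m + (g + 1) + 1) = 6 * (g * M) + 3 * M + 3 * g + 6"
      by (simp_all add: algebra_simps)
    have "4 * w + 4 * M + 4 * g + 4 \<le> 6 * w + 3 * M + 3 * g + 6" if "g \<le> w" "M \<le> w" for w
      using that by linarith
    from this[OF gM] show "4 * (?k + (g + 1)) \<le> 3 * (?m + (g + 1) + 1)" unfolding eqs .
  qed
  also have "\<dots> \<le> 4 ^ g * (2 ^ (g + 1) * (?m choose ?k))"
    by (intro mult_left_mono binomial_diagonal_steps) (simp_all add: algebra_simps)
  also have "\<dots> \<le> 4 ^ (g + 1) * (2 ^ (g + 1) * (?m choose ?k))"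
    by (intro mult_right_mono power_increasing) auto
  also have "\<dots> = 8 ^ (g + 1) * (?m choose ?k)"
    by (simp only: mult.assoc[symmetric] power_mult_distrib[symmetric]) simp
  finally show ?thesis unfolding layer_size_def by (simp add: algebra_simps)
qed

text \<open>From (s + 1) C(m, s + 1) = (m - s) C(m, s), the sum S of the upper binomials satisfies k
  (S - C(m, k)) \<le> (m - k) S. For k = (g + 1) M and m = (2 g + 1) M this gives S \<le> (g + 1)
  C(m, k).\<close>

lemma sum_upper_binomials:
  "(2 * k - m) * (\<Sum>s=k..m. m choose s) \<le> k * (m choose k)"
proof (cases "k \<le> m \<and> m \<le> 2 * k")
  case True
  let ?S = "\<Sum>s=k..m. m choose s"
  have shift: "(\<Sum>s=k..m. Suc s * (m choose Suc s)) = (\<Sum>s=k..m. (m - s) * (m choose s))"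
  proof (rule sum.cong)
    fix s
    show "Suc s * (m choose Suc s) = (m - s) * (m choose s)"
      using binomial_absorption[of s m] binomial_absorb_comp[of m s] by simp
  qed simp
  have "?S = (m choose k) + (\<Sum>s=Suc k..m. m choose s)"
    using True by (simp add: sum.atLeast_Suc_atMost)
  also have "(\<Sum>s=Suc k..m. m choose s) = (\<Sum>s=Suc k..Suc m. m choose s)"
    using True by simp
  also have "\<dots> = (\<Sum>s=k..m. m choose Suc s)" by (rule sum.shift_bounds_cl_Suc_ivl)
  finally have S: "?S = (m choose k) + (\<Sum>s=k..m. m choose Suc s)" .
  have "k * (\<Sum>s=k..m. m choose Suc s) = (\<Sum>s=k..m. k * (m choose Suc s))"
    by (rule sum_distrib_left)
  also have "\<dots> \<le> (\<Sum>s=k..m. Suc s * (m choose Suc s))" by (intro sum_mono mult_right_mono) auto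
  also have "\<dots> \<le> (\<Sum>s=k..m. (m - k) * (m choose s))"
    unfolding shift by (intro sum_mono mult_right_mono) auto
  also have "\<dots> = (m - k) * ?S" by (rule sum_distrib_left[symmetric])
  finally have "k * ?S \<le> k * (m choose k) + (m - k) * ?S"
    by (subst S) (simp add: distrib_left)
  moreover have "k * ?S = (2 * k - m) * ?S + (m - k) * ?S"
    using True by (simp flip: distrib_right)
  ultimately show ?thesis by simp
next
  case False
  then show ?thesis by auto
qed

lemma card_bounded_subsets:
  assumes "1 \<le> m"
  shows "card {D. D \<subseteq> {..<m} \<and> card D \<le> d} \<le> (d + 1) * m ^ d"
proof -
  have "{D. D \<subseteq> {..<m} \<and> card D \<le> d} = (\<Union>s\<in>{..d}. {D. D \<subseteq> {..<m} \<and> card D = s})" by auto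
  also have "card \<dots> \<le> (\<Sum>s\<in>{..d}. card {D. D \<subseteq> {..<m} \<and> card D = s})"
    by (rule card_UN_le) simp
  also have "\<dots> \<le> of_nat (card {..d}) * m ^ d"
  proof (rule sum_bounded_above)
    fix s assume s: "s \<in> {..d}"
    have "m choose s \<le> m ^ s" by (cases "s \<le> m") (simp_all add: binomial_le_pow binomial_eq_0)
    also have "\<dots> \<le> m ^ d" using s assms by (intro power_increasing) auto
    finally show "card {D. D \<subseteq> {..<m} \<and> card D = s} \<le> m ^ d" by (simp add: n_subsets)
  qed
  finally show ?thesis by simp
qed

text \<open>The middle binomial is at least the average 2 ^ (2 g + 1) / (2 g + 2) of its row, and
  for large g the linear loss is smaller than 2 ^ ((1 - \<alpha>) (2 g + 1)).\<close>

lemma exists_dense_layer: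
  fixes \<alpha> :: real
  assumes "\<alpha> < 1"
  shows "\<exists>g\<ge>1. 2 powr (\<alpha> * (2 * real g + 1)) < real ((2 * g + 1) choose g)"
proof -
  define \<delta> where "\<delta> = 1 - \<alpha>"
  have "\<delta> > 0" using assms unfolding \<delta>_def by simp
  then have "eventually (\<lambda>g. 2 * real g + 2 < 2 powr (\<delta> * (2 * real g + 1))) at_top"
    by real_asymp
  then have "eventually (\<lambda>g. 1 \<le> g \<and> 2 * real g + 2 < 2 powr (\<delta> * (2 * real g + 1))) at_top"
    using eventually_ge_at_top[of "1::nat"] by eventually_elim auto
  then obtain g :: nat where g: "1 \<le> g" "2 * real g + 2 < 2 powr (\<delta> * (2 * real g + 1))"
    by (auto simp: eventually_at_top_linorder)
  have "(2::nat) ^ (2 * g + 1) = (\<Sum>i\<le>2 * g + 1. (2 * g + 1) choose i)"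
    by (rule choose_row_sum[symmetric])
  also have "\<dots> \<le> of_nat (card {..2 * g + 1}) * ((2 * g + 1) choose g)"
  proof (rule sum_bounded_above)
    fix i
    show "(2 * g + 1) choose i \<le> (2 * g + 1) choose g"
      using binomial_maximum[of "2 * g + 1" i] by simp
  qed
  finally have "2 ^ (2 * g + 1) \<le> (2 * g + 2) * ((2 * g + 1) choose g)" by simp
  then have "real (2 ^ (2 * g + 1)) \<le> real ((2 * g + 2) * ((2 * g + 1) choose g))" by (rule of_nat_mono)
  then have *: "2 powr (2 * real g + 1) \<le> (2 * real g + 2) * real ((2 * g + 1) choose g)"
  proof -
    have "2 powr (2 * real g + 1) = real (2 ^ (2 * g + 1))"
      using powr_realpow[of 2 "2 * g + 1"] by (simp add: add.commute)
    moreover have "real ((2 * g + 2) * ((2 * g + 1) choose g)) = (2 * real g + 2) * real ((2 * g + 1) choose g)"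
      by (simp only: of_nat_mult of_nat_add of_nat_numeral)
    ultimately show ?thesis using \<open>real (2 ^ (2 * g + 1)) \<le> real ((2 * g + 2) * ((2 * g + 1) choose g))\<close> by simp
  qed
  have "2 powr (\<alpha> * (2 * real g + 1)) * (2 * real g + 2) <
      2 powr (\<alpha> * (2 * real g + 1)) * 2 powr (\<delta> * (2 * real g + 1))"
    using g by (intro mult_strict_left_mono) auto
  also have "\<dots> = 2 powr (2 * real g + 1)"
    unfolding powr_add[symmetric] \<delta>_def by (simp add: algebra_simps)
  also note *
  finally show ?thesis using g by (intro exI[of _ g]) (simp add: mult.commute)
qed

text \<open>(1 - h / k) ^ k \<le> exp (- h), so a logarithmic h makes it polynomially unlikely that
  distant points share a term; the exponent 8 outweighs the cubic number of cases in the union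
  bound.\<close>

lemma exp_decay_bound:
  assumes "0 < k" "k \<le> m" and L: "real L * (real k / real m) ^ k \<le> 1"
    and h: "8 * ln (real m) \<le> real h"
  shows "real L * (real (k - h) / real m) ^ k \<le> real m powr (-8)"
proof -
  have m: "real m > 0" using assms by simp
  have "(real (k - h) / real k) ^ k \<le> exp (- real h)"
  proof (cases "h \<le> k")
    case True
    then have "real (k - h) / real k = 1 + (- (real h / real k))"
      using assms by (simp add: of_nat_diff field_simps)
    also have "\<dots> \<le> exp (- (real h / real k))" by (rule exp_ge_add_one_self)
    finally have "(real (k - h) / real k) ^ k \<le> exp (- (real h / real k)) ^ k"
      by (intro power_mono) auto
    also have "\<dots> = exp (- real h)" using assms by (simp flip: exp_of_nat_mult)
    finally show ?thesis .
  next
    case False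
    then show ?thesis using assms by (simp add: zero_power)
  qed
  also have "\<dots> \<le> exp (-8 * ln (real m))" using h by simp
  also have "\<dots> = real m powr (-8)" using m by (simp add: powr_def)
  finally have e: "(real (k - h) / real k) ^ k \<le> real m powr (-8)" .
  have "real L * (real (k - h) / real m) ^ k =
      (real L * (real k / real m) ^ k) * (real (k - h) / real k) ^ k"
    using assms by (simp add: power_divide)
  also have "\<dots> \<le> 1 * real m powr (-8)" using L e by (intro mult_mono) auto
  finally show ?thesis by simp
qed

lemma hard_instance_exists:
  fixes g M n :: nat
  defines "m \<equiv> (2 * g + 1) * M" and "k \<equiv> (g + 1) * M"
  defines "L \<equiv> nat \<lfloor>(real m / real k) ^ k / 12\<rfloor>" and "h \<equiv> nat \<lceil>8 * ln (real m)\<rceil>"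
  assumes "1 \<le> g" "7 \<le> M" "m < n"
  shows "hard_instance m k L (2 * h + 2) h n"
proof
  have gM: "M \<le> g * M" using assms(5) by simp
  have mk: "m = 2 * (g * M) + M" "k = g * M + M" unfolding m_def k_def by (simp_all add: algebra_simps)
  show "0 < k" "k < m" "m \<le> 2 * k" "3 * k \<le> 2 * m" using mk gM \<open>7 \<le> M\<close> by linarith+
  show "0 < 2 * h + 2" "2 * h + 2 = 2 * h + 2" by simp_all
  show "m < n" by fact
  let ?y = "(real m / real k) ^ k"
  have kp: "0 < real k" "0 < real m" using \<open>0 < k\<close> \<open>k < m\<close> by simp_all
  have "3/2 \<le> real m / real k" using \<open>3 * k \<le> 2 * m\<close> kp by (simp add: field_simps)
  then have "(3/2) ^ k \<le> ?y" by (intro power_mono) auto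
  moreover have "(3/2) ^ 7 \<le> (3/2 :: real) ^ k"
    using mk gM \<open>7 \<le> M\<close> by (intro power_increasing) auto
  moreover have "12 \<le> (3/2 :: real) ^ 7" by (simp add: eval_nat_numeral)
  ultimately have y: "12 \<le> ?y" by linarith
  \<comment> \<open>Since \<open>?y / 12\<close> is at least 1, rounding down loses at most a factor
    2, which separates 1/24 from 1/12. The requirement M \<ge> 7 is there for this: (3/2) ^ 7 \<ge>
    12.\<close>
  have L: "real L \<le> ?y / 12" "?y / 24 \<le> real L"
  proof -
    have "real L = of_int \<lfloor>?y / 12\<rfloor>" unfolding L_def using y by simp
    moreover have "1 \<le> \<lfloor>?y / 12\<rfloor>" using y by (simp add: le_floor_iff)
    ultimately show "real L \<le> ?y / 12" "?y / 24 \<le> real L" by linarith+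
  qed
  have inv: "?y * (real k / real m) ^ k = 1"
    using kp by (simp flip: power_mult_distrib)
  have "?y / 24 * (real k / real m) ^ k \<le> real L * (real k / real m) ^ k"
    by (rule mult_right_mono[OF L(2)]) simp
  then show "1/24 \<le> real L * (real k / real m) ^ k" using inv by simp
  have "real L * (real k / real m) ^ k \<le> ?y / 12 * (real k / real m) ^ k"
    by (rule mult_right_mono[OF L(1)]) simp
  then show "real L * (real k / real m) ^ k \<le> 1/12" using inv by simp
qed

lemma (in hard_instance) card_upper: "(2 * k - m) * card upper \<le> k * card lay"
proof -
  have "upper = (\<Union>s\<in>{k..m}. {S. S \<subseteq> {..<m} \<and> card S = s})"
    unfolding upper_def using card_mono[of "{..<m}"] by fastforce
  then have "card upper \<le> (\<Sum>s=k..m. card {S. S \<subseteq> {..<m} \<and> card S = s})"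
    using card_UN_le[of "{k..m}" "\<lambda>s. {S. S \<subseteq> {..<m} \<and> card S = s}"] by simp
  also have "\<dots> = (\<Sum>s=k..m. m choose s)" by (simp add: n_subsets)
  finally have "(2 * k - m) * card upper \<le> (2 * k - m) * (\<Sum>s=k..m. m choose s)" by simp
  also have "\<dots> \<le> k * card lay" unfolding card_lay by (rule sum_upper_binomials)
  finally show ?thesis .
qed


text \<open>The error terms of the tester bound at m = x, with h at most 8 ln x + 1. Together with
  1/20 for running out of candidates, the budgets add up to 3/10 < 1/3. The constant 4000 makes the
  term for hidden variables tend to 3 * 4 * 16 / 4000 < 1/10.\<close>

definition small_errors :: "real \<Rightarrow> bool" where
  "small_errors x \<longleftrightarrow> 7 \<le> x \<and>
     16 * x\<^sup>2 * ((16 * ln x + 5) * x powr (16 * ln x + 4) * 2 powr (- x / 2)) \<le> 1/20 \<and>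
     3 * (4 * (x / (4000 * ln x)) + 20) * (16 * ln x + 4) / x \<le> 1/10 \<and>
     288 * (125 * x ^ 3 * x powr (-8)) \<le> 1/20 \<and>
     288 * (576\<^sup>2 * (x powr (-8) + (16 * ln x + 5) * x powr (16 * ln x + 4) * 2 powr (- x / 2))) \<le> 1/20 \<and>
     x / (4000 * ln x) \<le> x \<and> 20 \<le> x"

lemma eventually_small_errors: "eventually small_errors at_top"
  unfolding small_errors_def by (intro eventually_conj; real_asymp)

lemma no_cheap_tester:
  fixes g M n N q :: nat
  defines "m \<equiv> (2 * g + 1) * M"
  defines "C \<equiv> 8 ^ (g + 1) + 2 * (real g + 1)"
  assumes g: "1 \<le> g" and M: "7 \<le> M" and n: "m < n"
    and small: "small_errors (real m)"
    and dense: "2 powr (real m / 2) \<le> real (layer_size g M)"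
    and N: "layer_size g M \<le> N" "N \<le> 8 ^ (g + 1) * layer_size g M"
    and tester: "unateness_tester C (1 / (576 * (2 * (real g + 1)))) n N A"
    and most: "makes_at_most C n N A q"
    and q: "real q \<le> real m / (4000 * ln (real m))"
  shows False
proof -
  define k where "k = (g + 1) * M"
  define L where "L = nat \<lfloor>(real m / real k) ^ k / 12\<rfloor>"
  define h where "h = nat \<lceil>8 * ln (real m)\<rceil>"
  \<comment> \<open>Three candidates per query beat the potential, as 2 * (3/4) ^ 3 < 1, and twenty
    more push the remaining error below 1/20.\<close>
  define r where "r = 3 * q + 20"
  define x where "x = real m"
  interpret hard_instance m k L "2 * h + 2" h n
    unfolding m_def k_def L_def h_def by (rule hard_instance_exists) (use g M n in \<open>simp_all add: m_def\<close>)
  have lay: "card lay = layer_size g M" unfolding layer_size_def m_def[symmetric] k_def[symmetric] by (rule card_lay)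
  have mk: "m = 2 * (g * M) + M" "k = g * M + M" unfolding m_def k_def by (simp_all add: algebra_simps)
  have "(2 * k - m) * card upper \<le> k * card lay" by (rule card_upper)
  moreover have "2 * k - m = M" unfolding mk by simp
  ultimately have "M * card upper \<le> M * ((g + 1) * card lay)" unfolding k_def by (simp only: ac_simps)
  then have "card upper \<le> (g + 1) * card lay" using M by simp
  then have "real (2 * card upper) \<le> real (2 * ((g + 1) * card lay))" by (intro of_nat_mono mult_left_mono) auto
  then have up: "real (2 * card upper) \<le> 2 * (real g + 1) * real (card lay)" by (simp add: algebra_simps)
  have lay_le: "card lay \<le> card upper" by (rule card_mono[OF finite_upper lay_upper])
  have psi0: "real (card lay) > 0" using card_lay_pos by simp
  have C1: "real N / C \<le> real (card upper)"
  proof -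
    have "real N \<le> real (8 ^ (g + 1) * card lay)" using N(2) lay by (simp only: of_nat_le_iff)
    also have "\<dots> = 8 ^ (g + 1) * real (card lay)" by simp
    also have "\<dots> \<le> C * real (card upper)"
      unfolding C_def using lay_le by (intro mult_mono) auto
    finally have "real N \<le> C * real (card upper)" .
    moreover have "0 < C" unfolding C_def by (simp add: add_pos_nonneg)
    ultimately show ?thesis by (simp add: divide_le_eq mult.commute)
  qed
  have C2: "real (2 * card upper) \<le> C * real N"
  proof -
    have "2 * (real g + 1) * real (card lay) \<le> C * real N"
      unfolding C_def using N(1) lay by (intro mult_mono) auto
    then show ?thesis using up by linarith
  qed
  have x: "7 \<le> x" "20 \<le> x" "x / (4000 * ln x) \<le> x" using small unfolding small_errors_def x_def by auto
  have qx: "real q \<le> x / (4000 * ln x)" "real q \<le> x" using q x unfolding x_def by linarith+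
  have ln0: "0 \<le> ln x" using x by simp
  have hx: "8 * ln x \<le> real h" "real h \<le> 8 * ln x + 1"
    unfolding h_def x_def[symmetric] using ln0 by linarith+
  have dense': "2 powr (x / 2) \<le> real (card lay)" using dense lay unfolding x_def by simp
  have "2 powr 1 \<le> 2 powr (x / 2)" using x by (intro powr_mono) auto
  then have two: "2 \<le> card lay" using dense' by simp
  define V where "V = (16 * ln x + 5) * x powr (16 * ln x + 4) * 2 powr (- x / 2)"
  have nb: "real near_bound / real (card lay) \<le> V"
  proof -
    have "near_bound \<le> (2 * h + 2 + 1) * m ^ (2 * h + 2)"
      unfolding near_bound_def using k_less by (intro card_bounded_subsets) simp
    then have "real near_bound \<le> real ((2 * h + 2 + 1) * m ^ (2 * h + 2))" by (rule of_nat_mono)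
    also have "\<dots> = (2 * real h + 3) * x ^ (2 * h + 2)" by (simp add: x_def distrib_right)
    also have "\<dots> = (2 * real h + 3) * x powr (2 * real h + 2)"
    proof -
      have "x powr real (2 * h + 2) = x ^ (2 * h + 2)" using x by (intro powr_realpow) simp
      then show ?thesis by (simp add: add.commute)
    qed
    also have "\<dots> \<le> (16 * ln x + 5) * x powr (16 * ln x + 4)"
      using hx x by (intro mult_mono powr_mono) auto
    finally have "real near_bound / real (card lay) \<le> (16 * ln x + 5) * x powr (16 * ln x + 4) / 2 powr (x / 2)"
      using dense' ln0 by (intro frac_le) auto
    then show ?thesis unfolding V_def by (simp add: powr_minus_divide)
  qed
  have decay: "real L * (real (k - h) / real m) ^ k \<le> x powr (-8)"
    unfolding x_def
  proof (rule exp_decay_bound)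
    show "real L * (real k / real m) ^ k \<le> 1" using L_upper by simp
    show "8 * ln (real m) \<le> real h" using hx unfolding x_def by simp
  qed (use k_pos k_less in auto)
  have t1: "2 ^ q * (3/4) ^ r \<le> (1/20 :: real)"
  proof -
    have "2 ^ q * (3/4) ^ r = (2 * (3/4) ^ 3) ^ q * (3/4 :: real) ^ 20"
      unfolding r_def by (simp only: power_add power_mult power_mult_distrib mult.assoc)
    also have "\<dots> \<le> 1 * (3/4) ^ 20" by (intro mult_right_mono power_le_one) (auto simp: eval_nat_numeral)
    also have "\<dots> \<le> (1/20 :: real)" by (simp add: eval_nat_numeral)
    finally show ?thesis .
  qed
  have rx: "real r \<le> 4 * x" "real (r + 1) \<le> 5 * x" "real (r + q) \<le> 5 * x" "real (r + q) = 4 * real q + 20"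
    unfolding r_def using qx x by simp_all
  have t2: "(real r)\<^sup>2 * real near_bound / real (card region) \<le> 1/20"
  proof -
    have "real (card lay) \<le> real (card region)" using card_region lay_le by simp
    then have "real near_bound / real (card region) \<le> real near_bound / real (card lay)"
      using psi0 by (intro divide_left_mono) (auto intro!: mult_pos_pos)
    then have "real near_bound / real (card region) \<le> V" using nb by linarith
    then have "(real r)\<^sup>2 * (real near_bound / real (card region)) \<le> (4 * x)\<^sup>2 * V"
      using rx by (intro mult_mono power_mono) auto
    also have "\<dots> = 16 * x\<^sup>2 * V" by (simp add: power2_eq_square)
    also have "\<dots> \<le> 1/20" using small unfolding small_errors_def V_def x_def by blast
    finally show ?thesis by simp
  qed
  have t3: "real ((r + q) * (2 * h + 2)) / real (m - k) \<le> 1/10"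
  proof -
    have "M \<le> g * M" using g by simp
    then have "m \<le> 3 * (m - k)" unfolding mk by simp
    then have "x \<le> 3 * real (m - k)" unfolding x_def by linarith
    then have mk3: "x / 3 \<le> real (m - k)" by simp
    have "real ((r + q) * (2 * h + 2)) = (4 * real q + 20) * (2 * real h + 2)"
      unfolding of_nat_mult rx(4) by simp
    also have "\<dots> \<le> (4 * (x / (4000 * ln x)) + 20) * (16 * ln x + 4)"
      using qx hx ln0 x by (intro mult_mono) auto
    finally have "real ((r + q) * (2 * h + 2)) / real (m - k) \<le>
        (4 * (x / (4000 * ln x)) + 20) * (16 * ln x + 4) / (x / 3)"
      using mk3 x ln0 by (intro frac_le) auto
    also have "\<dots> = 3 * (4 * (x / (4000 * ln x)) + 20) * (16 * ln x + 4) / x" by simp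
    also have "\<dots> \<le> 1/10" using small unfolding small_errors_def x_def by blast
    finally show ?thesis .
  qed
  have t4: "288 * (real L * (real ((r + 1) * (r + q)\<^sup>2 * (k - h) ^ k) / real (m ^ k))) \<le> 1/20"
  proof -
    have "real L * (real ((r + 1) * (r + q)\<^sup>2 * (k - h) ^ k) / real (m ^ k)) =
        (real (r + 1) * (real (r + q))\<^sup>2) * (real L * (real (k - h) / real m) ^ k)"
      by (simp only: of_nat_mult of_nat_power power_divide times_divide_eq_right) (simp only: ac_simps)
    also have "\<dots> \<le> ((5 * x) * (5 * x)\<^sup>2) * x powr (-8)"
      using rx decay x by (intro mult_mono power_mono) auto
    also have "\<dots> = 125 * x ^ 3 * x powr (-8)" by (simp add: power2_eq_square power3_eq_cube)
    finally have "288 * (real L * (real ((r + 1) * (r + q)\<^sup>2 * (k - h) ^ k) / real (m ^ k))) \<le>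
        288 * (125 * x ^ 3 * x powr (-8))" by (rule mult_left_mono) simp
    also have "\<dots> \<le> 1/20" using small unfolding small_errors_def x_def by blast
    finally show ?thesis .
  qed
  have t5: "288 * (576\<^sup>2 * (real L * (real (k - h) / real m) ^ k + real near_bound / real (card lay))) \<le> 1/20"
  proof -
    have "288 * (576\<^sup>2 * (real L * (real (k - h) / real m) ^ k + real near_bound / real (card lay)))
      \<le> 288 * (576\<^sup>2 * (x powr (-8) + V))"
      using decay nb by (intro mult_left_mono add_mono) auto
    also have "\<dots> \<le> 1/20" using small unfolding small_errors_def V_def x_def by blast
    finally show ?thesis .
  qed
  have "1/3 \<le> 2 ^ q * (3/4) ^ r + (real r)\<^sup>2 * real near_bound / real (card region) +
      real ((r + q) * (2 * h + 2)) / real (m - k) +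
      288 * (real L * (real ((r + 1) * (r + q)\<^sup>2 * (k - h) ^ k) / real (m ^ k))) +
      288 * (576\<^sup>2 * (real L * (real (k - h) / real m) ^ k + real near_bound / real (card lay)))"
    by (rule tester_bound[OF C1 C2 up two tester most])
  also have "\<dots> \<le> 1/20 + 1/20 + 1/10 + 1/20 + 1/20"
    by (intro add_mono t1 t2 t3 t4 t5)
  finally show False by simp
qed

lemma layer_size_dense:
  assumes "0 < \<alpha>" "2 powr (\<alpha> * (2 * real g + 1)) < real ((2 * g + 1) choose g)" "1 \<le> M"
  shows "2 powr (\<alpha> * real ((2 * g + 1) * M)) < real (layer_size g M)"
proof -
  have sym: "(2 * g + 1) choose g = (2 * g + 1) choose (g + 1)"
    using binomial_symmetric[of g "2 * g + 1"] by simp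
  have "2 powr (\<alpha> * real ((2 * g + 1) * M)) = (2 powr (\<alpha> * (2 * real g + 1))) ^ M"
    by (simp add: powr_realpow[symmetric] powr_powr algebra_simps)
  also have "\<dots> < real ((2 * g + 1) choose g) ^ M"
    using assms by (intro power_strict_mono) auto
  also have "\<dots> \<le> real (layer_size g M)"
    unfolding sym layer_size_def of_nat_power[symmetric] of_nat_le_iff by (rule binomial_power_le)
  finally show ?thesis .
qed


theorem theorem1p3:
  fixes \<alpha>\<^sub>0 :: real
  assumes "\<alpha>\<^sub>0 < 1"
  shows "\<exists>\<epsilon>\<^sub>0 > 0. \<exists>C \<ge> 1. \<exists>c > 0. \<exists>(k::nat) (N\<^sub>0::nat).
    \<forall>(n::nat) (N::nat) (A::nonadaptive_algorithm) (q::nat).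
      N \<ge> N\<^sub>0 \<longrightarrow> real N \<le> 2 powr (\<alpha>\<^sub>0 * real n) \<longrightarrow>
      unateness_tester C \<epsilon>\<^sub>0 n N A \<longrightarrow> makes_at_most C n N A q \<longrightarrow>
      real q \<ge> c * log 2 (real N) / (log 2 (log 2 (real N))) ^ k"
proof -
  \<comment> \<open>With \<alpha> \<ge> 1/2 the layer has at least 2 ^ (m / 2) elements, which
    dwarfs the Hamming balls even when the given exponent is small or negative.\<close>
  define \<alpha> where "\<alpha> = max \<alpha>\<^sub>0 (1/2)"
  have \<alpha>: "\<alpha> < 1" "1/2 \<le> \<alpha>" "\<alpha>\<^sub>0 \<le> \<alpha>" using assms unfolding \<alpha>_def by auto
  obtain g where g: "1 \<le> g" and dense: "2 powr (\<alpha> * (2 * real g + 1)) < real ((2 * g + 1) choose g)"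
    using exists_dense_layer[OF \<alpha>(1)] by auto
  obtain x0 where x0: "\<And>x. x0 \<le> x \<Longrightarrow> small_errors x"
    using eventually_small_errors unfolding eventually_at_top_linorder by auto
  \<comment> \<open>The first entry makes all errors small, the second forces M \<ge> 7. The factor
    8 ^ (g + 1) in the threshold for N absorbs the rounding of N to a layer size, so that m0 <
    m.\<close>
  define m0 where "m0 = max (nat \<lceil>x0\<rceil>) (7 * (2 * g + 1))"
  define N\<^sub>0 :: nat where "N\<^sub>0 = 8 ^ (g + 1) * 2 ^ m0"
  have m0: "x0 \<le> real m0" "7 * (2 * g + 1) \<le> m0"
    unfolding m0_def by (auto simp: le_max_iff_disj of_nat_max intro: order_trans[OF real_nat_ceiling_ge])
  \<comment> \<open>In \<open>?C\<close> one summand covers the rounding of N to a layer size, the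
    other the ratio of the satisfying assignments to the layer. This ratio is at most K = 2 (g + 1),
    and \<open>?\<epsilon>\<close> is 1 / (576 K).\<close>
  let ?C = "8 ^ (g + 1) + 2 * (real g + 1)" and ?\<epsilon> = "1 / (576 * (2 * (real g + 1)))"
  have main: "1 / 16000 * log 2 (real N) / (log 2 (log 2 (real N))) ^ 1 \<le> real q"
    if N: "N\<^sub>0 \<le> N" "real N \<le> 2 powr (\<alpha>\<^sub>0 * real n)"
      and tester: "unateness_tester ?C ?\<epsilon> n N A" and most: "makes_at_most ?C n N A q" for n N A q
  proof (rule ccontr)
    assume neg: "\<not> 1 / 16000 * log 2 (real N) / (log 2 (log 2 (real N))) ^ 1 \<le> real q"
    have layer: "2 powr (\<alpha> * real ((2 * g + 1) * M)) < real (layer_size g M)" if "1 \<le> M" for M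
      using \<alpha> dense that by (intro layer_size_dense) auto
    have "\<exists>M. N < layer_size g M"
    proof
      have "1 * real (N + 1) \<le> (\<alpha> * (2 * real g + 1)) * real (N + 1)"
      proof (rule mult_right_mono)
        have "1/2 * 3 \<le> \<alpha> * (2 * real g + 1)" using \<alpha> g by (intro mult_mono) auto
        then show "1 \<le> \<alpha> * (2 * real g + 1)" by simp
      qed simp
      then have "2 powr real (N + 1) \<le> 2 powr (\<alpha> * real ((2 * g + 1) * (N + 1)))"
        by (intro powr_mono) (simp_all add: algebra_simps)
      also have "\<dots> < real (layer_size g (N + 1))" by (rule layer) simp
      finally have "2 powr real (N + 1) < real (layer_size g (N + 1))" .
      then have "(2::nat) ^ (N + 1) < layer_size g (N + 1)"
        by (metis of_nat_less_iff of_nat_numeral of_nat_power powr_realpow zero_less_numeral)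
      moreover have "N + 1 < 2 ^ (N + 1)" by (rule less_exp)
      ultimately show "N < layer_size g (N + 1)" by linarith
    qed
    \<comment> \<open>M' - 1 is then the scale at which the layer size is at most N and within a
      constant factor of it.\<close>
    define M' where "M' = (LEAST M. N < layer_size g M)"
    have M': "N < layer_size g M'" unfolding M'_def using \<open>\<exists>M. N < layer_size g M\<close> by (rule LeastI_ex)
    define M where "M = M' - 1"
    have M'_ge: "7 < M'"
    proof (rule ccontr)
      assume "\<not> 7 < M'"
      then have "(2 * g + 1) * M' \<le> m0" using m0(2) by (metis le_trans mult.commute mult_le_mono2 not_less)
      then have "layer_size g M' \<le> 2 ^ m0"
        unfolding layer_size_def by (rule order_trans[OF binomial_le_pow2 power_increasing]) simp
      also have "\<dots> \<le> N\<^sub>0" unfolding N\<^sub>0_def by simp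
      finally show False using M' N(1) by linarith
    qed
    then have M: "M' = Suc M" "7 \<le> M" unfolding M_def by auto
    have N_ge: "layer_size g M \<le> N"
      using not_less_Least[of M "\<lambda>M. N < layer_size g M"] M unfolding M'_def[symmetric] by simp
    have "N < layer_size g (Suc M)" using M' M by simp
    also have "\<dots> \<le> 8 ^ (g + 1) * layer_size g M" using g M by (intro layer_size_Suc) auto
    finally have N_less: "N < 8 ^ (g + 1) * layer_size g M" .
    define m where "m = (2 * g + 1) * M"
    define x where "x = real m"
    have "layer_size g M \<le> 2 ^ m" unfolding layer_size_def m_def by (rule binomial_le_pow2)
    then have "8 ^ (g + 1) * layer_size g M \<le> 8 ^ (g + 1) * 2 ^ m" by simp
    with N_less have N_pow: "N < 8 ^ (g + 1) * 2 ^ m" by linarith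
    then have "8 ^ (g + 1) * 2 ^ m0 < 8 ^ (g + 1) * (2::nat) ^ m" using N(1) unfolding N\<^sub>0_def by linarith
    then have "m0 < m" by simp
    then have x: "x0 \<le> x" "real m0 \<le> x" using m0(1) unfolding x_def by linarith+
    have "real (7 * (2 * g + 1)) \<le> real m0" using m0(2) by (rule of_nat_mono)
    then have "14 * real g + 7 \<le> x" using x(2) by simp
    moreover have "1 \<le> real g" using g by simp
    ultimately have x_big: "3 * real g + 3 \<le> x" "4 \<le> x" by simp_all
    have lay_m: "2 powr (\<alpha> * x) < real (layer_size g M)"
      unfolding x_def m_def using M by (intro layer) simp
    \<comment> \<open>Density of the layer pays off here: 2 ^ (\<alpha> m) is below the layer size,
      hence below N, which is at most 2 ^ (\<alpha> n).\<close>
    have "m < n"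
    proof -
      have "2 powr (\<alpha> * x) < real N" using lay_m N_ge by linarith
      also note N(2)
      also have "2 powr (\<alpha>\<^sub>0 * real n) \<le> 2 powr (\<alpha> * real n)"
        using \<alpha> by (intro powr_mono mult_right_mono) auto
      finally have "\<alpha> * x < \<alpha> * real n" by simp
      then show ?thesis using \<alpha> unfolding x_def by simp
    qed
    have "2 powr (x / 2) \<le> 2 powr (\<alpha> * x)" using \<alpha> x_big by (intro powr_mono) auto
    then have half: "2 powr (x / 2) \<le> real (layer_size g M)" using lay_m by linarith
    define l where "l = log 2 (real N)"
    have Npos: "0 < real N" using half N_ge by (smt (verit) of_nat_le_iff powr_gt_zero)
    have l_le: "l \<le> 2 * x"
    proof -
      have "(8::nat) ^ (g + 1) * 2 ^ m = 2 ^ (3 * (g + 1) + m)" by (simp only: power_add power_mult) simp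
      then have "real N \<le> real (2 ^ (3 * (g + 1) + m))" using N_pow by (intro of_nat_mono) linarith
      also have "\<dots> = 2 powr (3 * real g + 3 + x)"
        using powr_realpow[of 2 "3 * (g + 1) + m"] by (simp add: x_def algebra_simps)
      finally have "l \<le> 3 * real g + 3 + x" unfolding l_def using Npos by (simp add: log_le_iff)
      then show ?thesis using x_big by linarith
    qed
    have l_ge: "x / 2 \<le> l"
    proof -
      have "2 powr (x / 2) \<le> real N" using half N_ge by linarith
      then show ?thesis unfolding l_def by (subst le_log_iff) (use Npos in simp_all)
    qed
    have lx: "2 \<le> log 2 x" using x_big by (simp add: le_log_iff)
    have "log 2 x / 2 \<le> log 2 x - 1" using lx by simp
    also have "\<dots> = log 2 (x / 2)" using x_big by (simp add: log_divide)
    also have "\<dots> \<le> log 2 l" using l_ge x_big by simp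
    finally have ll: "log 2 x / 2 \<le> log 2 l" .
    \<comment> \<open>Passing from log N to m costs a factor 2 in the numerator and 2 in the
      denominator, so 16000 = 4 * 4000.\<close>
    have "1 / 16000 * l / (log 2 l) ^ 1 \<le> 1 / 16000 * (2 * x) / (log 2 x / 2)"
      using l_le ll lx x_big by (simp only: power_one_right) (intro frac_le mult_left_mono; simp)
    also have "\<dots> = x / (4000 * log 2 x)" by simp
    also have "\<dots> \<le> x / (4000 * ln x)"
    proof -
      have "ln x \<le> log 2 x"
        using x_big ln_2_less_1 by (simp add: log_def le_divide_eq mult_left_le)
      moreover have "0 < ln x" using x_big by simp
      ultimately show ?thesis using x_big by (intro divide_left_mono) auto
    qed
    finally have "real q \<le> x / (4000 * ln x)" using neg unfolding l_def by linarith
    then show False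
      using no_cheap_tester[OF g M(2), of n N A q] x0[OF x(1)] half N_ge N_less tester most \<open>m < n\<close>
      unfolding x_def m_def by simp
  qed
  show ?thesis
  proof (intro exI conjI allI impI)
    show "0 < ?\<epsilon>" by simp
    show "1 \<le> ?C" using one_le_power[of "8::real" "g + 1"] by (intro add_increasing2) simp_all
    show "(0::real) < 1 / 16000" by simp
  qed (rule main)
qed

end
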